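(* For every $\lambda>1$ there exists $c>0$ such that the mixing time of the Glauber dynamics with parameter $\lambda$ on the set $\Omega_{m,n}$ of triangulations of $\Lambda^0_{m,n}$, in the absence of constraints, satisfies $$T_{\mathrm{mix}}\ge \exp\bigl(c\,n^2/m\bigr)$$ for all integers $m\ge1$ and $n\ge m^2/c$.
   Context: Triangulations. $\Lambda^0_{m,n}=\{0,1,\dots,m\}\times\{0,1,\dots,n\}\subset\mathbb{Z}^2$. An edge is a straight segment joining two points of $\Lambda^0_{m,n}$ and passing through no other integer point. Two edges cross if they are distinct and meet at a point that is not a common endpoint. A (full) triangulation of $\Lambda^0_{m,n}$ is a maximal set of pairwise noncrossing edges; $\Omega_{m,n}$ is the set of all of them. In every triangulation the set of midpoints of the edges is exactly $\Lambda=\Lambda_{m,n}=\bigl(\{0,\frac12,1,\dots,m\}\times\{0,\frac12,1,\dots,n\}\bigr)\setminus\Lambda^0_{m,n}$, each midpoint occurring once; so a triangulation is written $\sigma=\{\sigma_x\}_{x\in\Lambda}$, where $\sigma_x$ is the edge with midpoint $x$. Gibbs distribution. $|\sigma_x|$ is the $\ell_1$ length of $\sigma_x$, $|\sigma|=\sum_x|\sigma_x|$, and $\mu(\sigma)=\lambda^{|\sigma|}/\sum_{\tau\in\Omega_{m,n}}\lambda^{|\tau|}$. Glauber dynamics. An edge $\sigma_x$ lying in two triangles of $\sigma$ is flippable if the two triangles form a convex quadrilateral (then necessarily a parallelogram); the flip replaces $\sigma_x$ by the other diagonal $\sigma_x'$ (also with midpoint $x$). One step from $\sigma$: pick $x\in\Lambda$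 uniformly at random; if $\sigma_x$ is flippable to $\sigma'_x$, flip it with probability $\lambda^{|\sigma'_x|}/(\lambda^{|\sigma'_x|}+\lambda^{|\sigma_x|})$; otherwise do nothing. Mixing time. $T_{\mathrm{mix}}=\inf\{t\in\mathbb{N}:\max_{\sigma}\|p^t(\sigma,\cdot)-\mu\|\le 1/4\}$, where $p^t(\sigma,\cdot)$ is the law after $t$ steps started at $\sigma$ and $\|\cdot\|$ is total variation distance. *)

theory Defs
  imports "HOL-Probability.Probability"
begin

type_synonym point = "int \<times> int"

text \<open>An edge is represented by the two-element set of its endpoints; the segment itself is
  \<open>seg e\<close>.\<close>
type_synonym edge = "point set"

definition pt :: "point \<Rightarrow> real \<times> real" where
  "pt v = (real_of_int (fst v), real_of_int (snd v))"

definition seg :: "edge \<Rightarrow> (real \<times> real) set" where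
  "seg e = convex hull (pt ` e)"

definition Lambda0 :: "nat \<Rightarrow> nat \<Rightarrow> point set" where
  "Lambda0 m n = {0..int m} \<times> {0..int n}"

definition edges :: "nat \<Rightarrow> nat \<Rightarrow> edge set" where
  "edges m n = {{a, b} | a b. a \<in> Lambda0 m n \<and> b \<in> Lambda0 m n \<and> a \<noteq> b \<and>
     seg {a, b} \<inter> range pt = {pt a, pt b}}"

definition crossing :: "edge \<Rightarrow> edge \<Rightarrow> bool" where
  "crossing e f \<longleftrightarrow> e \<noteq> f \<and> (\<exists>p \<in> seg e \<inter> seg f. p \<notin> pt ` (e \<inter> f))"

definition noncrossing :: "edge set \<Rightarrow> bool" where
  "noncrossing T \<longleftrightarrow> (\<forall>e\<in>T. \<forall>f\<in>T. \<not> crossing e f)"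

definition Omega :: "nat \<Rightarrow> nat \<Rightarrow> edge set set" where
  "Omega m n = {T. T \<subseteq> edges m n \<and> noncrossing T \<and>
     (\<forall>T'. T \<subseteq> T' \<and> T' \<subseteq> edges m n \<and> noncrossing T' \<longrightarrow> T' = T)}"

definition Lambda :: "nat \<Rightarrow> nat \<Rightarrow> (real \<times> real) set" where
  "Lambda m n = {(real i / 2, real j / 2) | i j. i \<le> 2 * m \<and> j \<le> 2 * n} - pt ` Lambda0 m n"

definition mid :: "edge \<Rightarrow> real \<times> real" where
  "mid e = (1 / 2) *\<^sub>R (\<Sum>v\<in>e. pt v)"

definition edge_at :: "edge set \<Rightarrow> real \<times> real \<Rightarrow> edge" where
  "edge_at \<sigma> x = (THE e. e \<in> \<sigma> \<and> mid e = x)"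

definition l1_dist :: "point \<Rightarrow> point \<Rightarrow> nat" where
  "l1_dist a b = nat (\<bar>fst a - fst b\<bar> + \<bar>snd a - snd b\<bar>)"

text \<open>As \<open>e\<close> is an unordered pair of endpoints, its length is obtained as the \<open>\<ell>\<^sub>1\<close> diameter.\<close>
definition edge_length :: "edge \<Rightarrow> nat" where
  "edge_length e = Max ((\<lambda>(a, b). l1_dist a b) ` (e \<times> e))"

definition total_length :: "edge set \<Rightarrow> nat" where
  "total_length \<sigma> = (\<Sum>e\<in>\<sigma>. edge_length e)"

definition gibbs :: "real \<Rightarrow> nat \<Rightarrow> nat \<Rightarrow> edge set \<Rightarrow> real" where
  "gibbs lam m n \<sigma> = lam ^ total_length \<sigma> / (\<Sum>\<tau>\<in>Omega m n. lam ^ total_length \<tau>)"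

text \<open>A triangle of a triangulation is a face, given by its three vertices: a 3-cycle of edges
  whose interior is met by no edge.  (A 3-cycle of edges may also enclose further lattice points;
  such 3-cycles are not triangles of the triangulation.)\<close>
definition triangles :: "edge set \<Rightarrow> point set set" where
  "triangles \<sigma> = {t. card t = 3 \<and> (\<forall>e. e \<subseteq> t \<and> card e = 2 \<longrightarrow> e \<in> \<sigma>) \<and>
     (\<forall>e\<in>\<sigma>. seg e \<inter> interior (convex hull (pt ` t)) = {})}"

text \<open>The second conjunct rules out a union that is a convex set but only a triangle, with one of the
  four points in the middle of a side.\<close>
definition convex_quadrilateral :: "point set \<Rightarrow> point set \<Rightarrow> bool" where
  "convex_quadrilateral s t \<longleftrightarrow>
     (let Q = convex hull (pt ` s) \<union> convex hull (pt ` t)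
      in convex Q \<and> (\<forall>v \<in> s \<union> t. pt v extreme_point_of Q))"

definition flips_to :: "edge set \<Rightarrow> edge \<Rightarrow> edge \<Rightarrow> bool" where
  "flips_to \<sigma> e e' \<longleftrightarrow> e \<in> \<sigma> \<and> (\<exists>s \<in> triangles \<sigma>. \<exists>t \<in> triangles \<sigma>.
     s \<noteq> t \<and> e \<subseteq> s \<and> e \<subseteq> t \<and> convex_quadrilateral s t \<and> e' = (s \<union> t) - e)"

definition flippable :: "edge set \<Rightarrow> edge \<Rightarrow> bool" where
  "flippable \<sigma> e \<longleftrightarrow> (\<exists>e'. flips_to \<sigma> e e')"

definition flipped :: "edge set \<Rightarrow> edge \<Rightarrow> edge" where
  "flipped \<sigma> e = (THE e'. flips_to \<sigma> e e')"

definition glauber_step :: "real \<Rightarrow> nat \<Rightarrow> nat \<Rightarrow> edge set \<Rightarrow> edge set pmf" where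
  "glauber_step lam m n \<sigma> =
     bind_pmf (pmf_of_set (Lambda m n)) (\<lambda>x.
       let e = edge_at \<sigma> x; e' = flipped \<sigma> e in
       if flippable \<sigma> e then
         map_pmf (\<lambda>b. if b then insert e' (\<sigma> - {e}) else \<sigma>)
           (bernoulli_pmf (lam ^ edge_length e' / (lam ^ edge_length e' + lam ^ edge_length e)))
       else return_pmf \<sigma>)"

definition glauber_law :: "real \<Rightarrow> nat \<Rightarrow> nat \<Rightarrow> nat \<Rightarrow> edge set \<Rightarrow> edge set pmf" where
  "glauber_law lam m n t \<sigma> = ((\<lambda>p. bind_pmf p (glauber_step lam m n)) ^^ t) (return_pmf \<sigma>)"

definition tv_dist :: "'a set \<Rightarrow> ('a \<Rightarrow> real) \<Rightarrow> ('a \<Rightarrow> real) \<Rightarrow> real" where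
  "tv_dist S p q = (1 / 2) * (\<Sum>s\<in>S. \<bar>p s - q s\<bar>)"

text \<open>Valued in \<^typ>\<open>enat\<close>, so that the infimum of the empty set is infinity (on \<^typ>\<open>nat\<close> it
  would be 0).\<close>
definition mixing_time :: "real \<Rightarrow> nat \<Rightarrow> nat \<Rightarrow> enat" where
  "mixing_time lam m n = Inf (enat ` {t.
     Max ((\<lambda>\<sigma>. tv_dist (Omega m n) (pmf (glauber_law lam m n t \<sigma>)) (gibbs lam m n)) ` Omega m n)
       \<le> 1 / 4})"

end

theory Submission
  imports Defs
begin

text \<open>
  The chain is slow because its state space has two traps, separated by an energy barrier of order
  \<open>n\<^sup>2 / m\<close>, while the entropy that could help it out of a trap is only of order
  \<open>m n + n powr (3/2)\<close>.

  Call the columns \<open>x = 0, \<dots>, m\<close> alternately low and high. An edge between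
  neighbouring columns (a \<^emph>\<open>narrow\<close> edge, or \<^emph>\<open>rung\<close>) has
  \<^emph>\<open>gain\<close> \<open>c - a\<close>, where \<open>a\<close> is the height of its end
  in the low column and \<open>c\<close> that of its end in the high column; all other edges have
  gain zero. The rungs of a triangulation in one unit strip have distinct sums \<open>a + c\<close>,
  because these are twice the heights of their midpoints, and
  \<open>c - a \<le> min (a + c) (2 n - a - c)\<close>. Summing over the possible values of
  \<open>a + c\<close>, a strip has gain at most \<open>n\<^sup>2\<close> and a triangulation at
  most \<open>m n\<^sup>2\<close>. This is attained: in each strip join the bottom of the low column
  to all of the high column and the top of the high column to all of the low one
  (\<open>ground_state\<close>). Exchanging low and high columns negates the gain, so the
  triangulations with gain at least \<open>m n\<^sup>2 - \<theta>\<close> form two disjoint traps,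
  one for each choice, when \<open>\<theta> < m n\<^sup>2\<close>. One of them has Gibbs measure at
  most one half, and the chain is started at its ground state.

  The barrier. The length of a triangulation exceeds its gain by at most \<open>O(m n)\<close> plus
  the contribution of the bad edges, those that are wide or have negative gain. If an edge spans a
  strip and does not ascend from the low to the high column there, then every rung of the strip lies
  above it or below it, and the strip misses the optimum \<open>n\<^sup>2\<close> by
  \<open>n / 4\<close> times the distance of the middle of the edge in that strip from the bottom or
  the top (\<open>wrong_strip_loss\<close>). A wide edge spans two neighbouring strips of opposite
  orientation, so that in one of them it is of this kind; a narrow edge of negative gain is so in
  its own strip. With \<open>\<theta> = \<delta> n\<^sup>2 / m\<close>, all bad edges of a
  triangulation in the trap therefore lie within \<open>O(\<delta> n / m)\<close> of the bottom or
  the top (\<open>bad_edge_confined\<close>). There are only \<open>O(m + \<delta> n)\<close>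
  midpoints in that region, and an edge in it has length \<open>O(m + \<delta> n / m)\<close>: the
  bad edges contribute \<open>O(\<delta>\<^sup>2 n\<^sup>2 / m)\<close> and terms of lower order. As
  this is quadratic in \<open>\<delta>\<close>, for small \<open>\<delta>\<close> a triangulation
  from which one flip can leave the trap has length at most
  \<open>m n\<^sup>2 - \<theta> / 2\<close> (\<open>exit_energy\<close>), while the ground state has
  length at least \<open>m n\<^sup>2\<close>.

  The entropy. The rungs of a strip form a chain in the product order, hence are coded by two
  subsets of intervals of length \<open>O(n)\<close>; and a member of the trap has only
  \<open>O(n)\<close> wide edges. So the trap has at most \<open>exp (O(m n + n powr (3/2)))\<close>
  members (\<open>trap_card\<close>), and both terms are small multiples of
  \<open>n\<^sup>2 / m\<close> when \<open>m\<^sup>2 \<le> c n\<close>.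

  The dynamics. Flips are reversible (\<open>flip_reversible\<close>), so the chain satisfies
  detailed balance, and at any time the probability of being at a state is at most the ratio of its
  weight to that of the initial state. By a union bound over times and exit states
  (\<open>escape_bound\<close>) the trap still carries most of the mass unless the time is
  exponential in \<open>n\<^sup>2 / m\<close>, whereas its equilibrium mass is at most one half.
\<close>

section \<open>Edges and noncrossing families\<close>

lemma seg_pair: "seg {a, b} = closed_segment (pt a) (pt b)"
  by (simp add: seg_def segment_convex_hull)

lemma pt_eq_iff [simp]: "pt u = pt v \<longleftrightarrow> u = v"
  by (auto simp: pt_def prod_eq_iff)

lemma fst_pt [simp]: fixes v :: point shows "fst (pt v) = real_of_int (fst v)"
  and snd_pt [simp]: "snd (pt v) = real_of_int (snd v)"
  by (simp_all add: pt_def)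

lemma edge_lattice_point:
  assumes "e \<in> edges m n" "pt v \<in> seg e"
  shows "v \<in> e"
proof -
  from assms(1) obtain a b where e: "e = {a, b}" "seg {a, b} \<inter> range pt = {pt a, pt b}"
    unfolding edges_def by blast
  then have "pt v \<in> {pt a, pt b}" using assms(2) by blast
  then show ?thesis using e(1) by auto
qed

lemma edge_subset: "e \<in> edges m n \<Longrightarrow> e \<subseteq> Lambda0 m n"
  unfolding edges_def by auto

lemma finite_Lambda0 [simp]: "finite (Lambda0 m n)"
  by (simp add: Lambda0_def)

lemma finite_edges [simp]: "finite (edges m n)"
  by (rule finite_subset[of _ "Pow (Lambda0 m n)"]) (use edge_subset in auto)

lemma finite_Omega [simp]: "finite (Omega m n)"
  by (rule finite_subset[of _ "Pow (edges m n)"]) (auto simp: Omega_def)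

lemma Omega_finite: "\<sigma> \<in> Omega m n \<Longrightarrow> finite \<sigma>"
  by (rule finite_subset[of _ "edges m n"]) (auto simp: Omega_def)

lemma point_on_closed_segment:
  "z \<in> closed_segment (a::real\<times>real) b \<longleftrightarrow>
    (\<exists>u. 0 \<le> u \<and> u \<le> 1 \<and> fst z = (1 - u) * fst a + u * fst b \<and> snd z = (1 - u) * snd a + u * snd b)"
  by (auto simp: closed_segment_def prod_eq_iff)

lemma narrow_mem_edges:
  assumes "(k, a) \<in> Lambda0 m n" "(k + 1, c) \<in> Lambda0 m n"
  shows "{(k, a), (k + 1, c)} \<in> edges m n"
proof -
  have "seg {(k, a), (k + 1, c)} \<inter> range pt = {pt (k, a), pt (k + 1, c)}"
  proof
    show "seg {(k, a), (k + 1, c)} \<inter> range pt \<subseteq> {pt (k, a), pt (k + 1, c)}"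
    proof
      fix z assume zz: "z \<in> seg {(k, a), (k + 1, c)} \<inter> range pt"
      then obtain v where z: "z = pt v" by blast
      have "z \<in> closed_segment (pt (k, a)) (pt (k + 1, c))" using zz by (simp add: seg_pair)
      then obtain u where u: "0 \<le> u" "u \<le> 1"
          "fst z = (1 - u) * fst (pt (k,a)) + u * fst (pt (k+1,c))"
          "snd z = (1 - u) * snd (pt (k,a)) + u * snd (pt (k+1,c))"
        unfolding point_on_closed_segment by blast
      have "real_of_int (fst v) = real_of_int k + u"
        using u(3) by (simp add: z pt_def algebra_simps)
      then have "u = real_of_int (fst v - k)" by simp
      then have "u = 0 \<or> u = 1" using u(1,2)
        by (smt (verit, best) of_int_0_le_iff of_int_le_1_iff of_int_eq_0_iff of_int_eq_1_iff)
      then show "z \<in> {pt (k, a), pt (k + 1, c)}"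
        using u(3,4) by (auto simp: prod_eq_iff)
    qed
  qed (auto simp: seg_pair)
  moreover have "(k, a) \<noteq> (k + 1, c)" by simp
  ultimately show ?thesis using assms unfolding edges_def by blast
qed

text \<open>
  An edge that is not vertical can be listed from left to right; a vertical one has length one,
  since otherwise the lattice point above its lower end would lie in its interior.
\<close>
lemma edge_cases:
  assumes "e \<in> edges m n"
  obtains (vertical) x y where "e = {(x, y), (x, y + 1)}"
    | (across) x1 y1 x2 y2 where "e = {(x1, y1), (x2, y2)}" "x1 < x2"
        "0 \<le> x1" "x2 \<le> int m" "0 \<le> y1" "y1 \<le> int n" "0 \<le> y2" "y2 \<le> int n"
proof -
  from assms obtain u v where e: "e = {u, v}" "u \<in> Lambda0 m n" "v \<in> Lambda0 m n" "u \<noteq> v"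
    and prim: "seg {u, v} \<inter> range pt = {pt u, pt v}"
    unfolding edges_def by blast
  have vert: "snd q = snd p + 1" if "e = {p, q}" "fst p = fst q" "snd p < snd q" for p q
  proof (rule ccontr)
    assume "snd q \<noteq> snd p + 1"
    with that have gt: "snd p + 1 < snd q" by simp
    define r where "r = (fst p, snd p + 1)"
    define t where "t = 1 / (real_of_int (snd q) - real_of_int (snd p))"
    have "pt r \<in> closed_segment (pt p) (pt q)"
      unfolding point_on_closed_segment
    proof (intro exI[of _ t] conjI)
      have d: "real_of_int (snd q) - real_of_int (snd p) > 1" using gt by linarith
      then show "0 \<le> t" "t \<le> 1" by (auto simp: t_def)
      show "fst (pt r) = (1 - t) * fst (pt p) + t * fst (pt q)"
        using that by (simp add: r_def algebra_simps)
      have "t * (real_of_int (snd q) - real_of_int (snd p)) = 1"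
        using d by (simp add: t_def)
      then show "snd (pt r) = (1 - t) * snd (pt p) + t * snd (pt q)"
        by (simp add: r_def algebra_simps)
    qed
    then have "pt r \<in> seg e" by (simp add: that seg_pair)
    from edge_lattice_point[OF assms this] have "r = p \<or> r = q" using that by simp
    then have "snd r = snd p \<or> snd r = snd q" by auto
    then show False using gt by (simp add: r_def)
  qed
  obtain x1 y1 x2 y2 where uv: "u = (x1, y1)" "v = (x2, y2)" by (metis surj_pair)
  consider "x1 < x2" | "x2 < x1" | "x1 = x2" "y1 < y2" | "x1 = x2" "y2 < y1"
    using e(4) uv by fastforce
  then show thesis
  proof cases
    case 1 then show ?thesis using e uv across by (auto simp: Lambda0_def)
  next
    case 2
    have "e = {(x2, y2), (x1, y1)}" using e(1) uv by auto
    from across[OF this 2] show ?thesis using e(2,3) uv by (auto simp: Lambda0_def)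
  next
    case 3
    then have "y2 = y1 + 1" using vert[of u v] e uv by simp
    then show ?thesis using vertical e uv 3 by simp
  next
    case 4
    have s: "e = {v, u}" using e(1) by auto
    then have "y1 = y2 + 1" using vert[OF s] uv 4 by simp
    then show ?thesis using vertical[of x1 y2] s uv 4 by simp
  qed
qed

lemma edge_length_pair: fixes u v :: point shows "edge_length {u, v} = l1_dist u v"
proof -
  have "(\<lambda>(a, b). l1_dist a b) ` ({u, v} \<times> {u, v}) = {0, l1_dist u v}"
    by (auto simp: l1_dist_def abs_minus_commute)
  then show ?thesis by (simp add: edge_length_def)
qed

lemma noncrossingD:
  assumes "noncrossing T" "e \<in> T" "f \<in> T" "e \<noteq> f" "z \<in> seg e" "z \<in> seg f"
  shows "z \<in> pt ` (e \<inter> f)"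
  using assms unfolding noncrossing_def crossing_def by blast

text \<open>
  The ordinate at abscissa \<open>x\<close> of the line through \<open>u\<close> and
  \<open>v\<close>.
\<close>
definition height :: "point \<Rightarrow> point \<Rightarrow> real \<Rightarrow> real" where
  "height u v x = real_of_int (snd u) +
     real_of_int (snd v - snd u) / real_of_int (fst v - fst u) * (x - real_of_int (fst u))"

lemma height_on_seg:
  fixes u v :: point
  assumes "fst u < fst v" "real_of_int (fst u) \<le> x" "x \<le> real_of_int (fst v)"
  shows "(x, height u v x) \<in> seg {u, v}"
  unfolding seg_pair point_on_closed_segment
proof -
  define t where "t = (x - real_of_int (fst u)) / real_of_int (fst v - fst u)"
  have p: "real_of_int (fst v - fst u) > 0" using assms(1) by simp
  have t: "t * real_of_int (fst v - fst u) = x - real_of_int (fst u)"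
    using p by (simp add: t_def)
  have h: "height u v x = real_of_int (snd u) + real_of_int (snd v - snd u) * t"
    by (simp add: height_def t_def)
  have "0 \<le> t" "t \<le> 1" using assms p by (auto simp: t_def divide_simps)
  moreover have "x = (1 - t) * real_of_int (fst u) + t * real_of_int (fst v)"
    using t by (simp add: algebra_simps)
  moreover have "height u v x = (1 - t) * real_of_int (snd u) + t * real_of_int (snd v)"
    using h by (simp add: algebra_simps)
  ultimately show "\<exists>w. 0 \<le> w \<and> w \<le> 1 \<and>
      fst (x, height u v x) = (1 - w) * fst (pt u) + w * fst (pt v) \<and>
      snd (x, height u v x) = (1 - w) * snd (pt u) + w * snd (pt v)"
    by (intro exI[of _ t]) simp
qed

lemma height_affine: "height u v ((1 - t) * x + t * y) = (1 - t) * height u v x + t * height u v y"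
proof -
  define s where "s = real_of_int (snd v - snd u) / real_of_int (fst v - fst u)"
  have h: "height u v z = real_of_int (snd u) + s * (z - real_of_int (fst u))" for z
    by (simp add: height_def s_def)
  show ?thesis unfolding h by (simp add: algebra_simps)
qed

lemma height_ends: "height u v (real_of_int (fst u)) = real_of_int (snd u)"
  "fst u < fst v \<Longrightarrow> height u v (real_of_int (fst v)) = real_of_int (snd v)"
  by (auto simp: height_def)

text \<open>
  The difference of two affine functions that changes sign in a unit strip vanishes strictly inside
  it; there the two edges would meet in a point that is not a lattice point.
\<close>
lemma noncrossing_strip:
  fixes k a c :: int and u v :: point
  assumes T: "noncrossing T" and e: "{(k, a), (k + 1, c)} \<in> T" and f: "{u, v} \<in> T"
    and uv: "fst u \<le> k" "k + 1 \<le> fst v"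
  shows "(real_of_int a \<le> height u v (real_of_int k) \<and> real_of_int c \<le> height u v (real_of_int k + 1)) \<or>
    (height u v (real_of_int k) \<le> real_of_int a \<and> height u v (real_of_int k + 1) \<le> real_of_int c)"
proof (rule ccontr)
  assume neg: "\<not> ?thesis"
  define A where "A = real_of_int a - height u v (real_of_int k)"
  define C where "C = real_of_int c - height u v (real_of_int k + 1)"
  have AC: "A * C < 0" using neg unfolding A_def C_def by (auto simp: mult_less_0_iff not_le)
  define t where "t = A / (A - C)"
  have d: "A - C \<noteq> 0" using AC by (auto simp: mult_less_0_iff)
  have t: "0 < t" "t < 1" using AC by (auto simp: t_def mult_less_0_iff divide_simps)
  have zero: "(1 - t) * A + t * C = 0" using d by (simp add: t_def field_simps)
  define z where "z = (real_of_int k + t, height u v (real_of_int k + t))"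
  have hz: "height u v (real_of_int k + t) =
      (1 - t) * height u v (real_of_int k) + t * height u v (real_of_int k + 1)"
    using height_affine[of u v t "real_of_int k" "real_of_int k + 1"] by (simp add: algebra_simps)
  have zf: "z \<in> seg {u, v}"
    unfolding z_def
  proof (rule height_on_seg)
    show "fst u < fst v" using uv by linarith
    show "real_of_int (fst u) \<le> real_of_int k + t" using uv(1) t(1) by (smt (verit) of_int_le_iff)
    have "real_of_int (k + 1) \<le> real_of_int (fst v)" using uv(2) by (simp only: of_int_le_iff)
    then show "real_of_int k + t \<le> real_of_int (fst v)" using t(2) by simp
  qed
  have "snd z = (1 - t) * real_of_int a + t * real_of_int c"
    using zero unfolding z_def hz A_def C_def by (simp add: algebra_simps)
  then have ze: "z \<in> seg {(k, a), (k + 1, c)}"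
    unfolding seg_pair point_on_closed_segment
    by (intro exI[of _ t]) (use t in \<open>auto simp: z_def pt_def algebra_simps\<close>)
  have ne: "{(k, a), (k + 1, c)} \<noteq> {u, v}"
  proof
    assume "{(k, a), (k + 1, c)} = {u, v}"
    then have "u = (k, a)" "v = (k + 1, c)" using uv by (auto simp: doubleton_eq_iff)
    then show False using neg height_ends[of u v] by simp
  qed
  from noncrossingD[OF T e f ne ze zf] obtain w where "z = pt w" by blast
  then have "real_of_int (fst w) = real_of_int k + t" by (simp add: z_def pt_def prod_eq_iff)
  then have "t = real_of_int (fst w - k)" by simp
  with t have "0 < fst w - k" "fst w - k < 1" by linarith+
  then show False by linarith
qed

text \<open>
  The sum of the endpoints is twice the midpoint, and has the advantage of being a pair of integers.
\<close>
definition coord_sum :: "edge \<Rightarrow> int \<times> int" where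
  "coord_sum e = ((\<Sum>v\<in>e. fst v), (\<Sum>v\<in>e. snd v))"

lemma coord_sum_pair: fixes u v :: point shows "u \<noteq> v \<Longrightarrow> coord_sum {u, v} = (fst u + fst v, snd u + snd v)"
  by (simp add: coord_sum_def)

lemma mid_pair: fixes u v :: point shows "u \<noteq> v \<Longrightarrow>
    mid {u, v} = (real_of_int (fst u + fst v) / 2, real_of_int (snd u + snd v) / 2)"
  by (simp add: mid_def prod_eq_iff)

lemma mid_in_seg: fixes u v :: point shows "u \<noteq> v \<Longrightarrow> mid {u, v} \<in> seg {u, v}"
  unfolding seg_pair point_on_closed_segment
  by (intro exI[of _ "1/2"]) (simp add: mid_pair field_simps)

lemma edge_pair:
  assumes "e \<in> edges m n"
  shows "\<exists>u v. e = {u, v} \<and> u \<noteq> v"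
proof -
  obtain u v where "e = {u, v}" "u \<noteq> v" using assms unfolding edges_def by blast
  then show ?thesis by (intro exI conjI)
qed

text \<open>
  A common midpoint lies on both edges, so it would be a common endpoint of them; two edges with the
  same midpoint and a common endpoint coincide.
\<close>
lemma inj_on_mid:
  assumes "noncrossing T" "T \<subseteq> edges m n"
  shows "inj_on mid T"
proof (rule inj_onI, rule ccontr)
  fix e f assume ef: "e \<in> T" "f \<in> T" "mid e = mid f" "e \<noteq> f"
  obtain u v where e: "e = {u, v}" "u \<noteq> v" using ef(1) assms(2) edge_pair by blast
  obtain u' v' where f: "f = {u', v'}" "u' \<noteq> v'" using ef(2) assms(2) edge_pair by blast
  have "mid e \<in> pt ` (e \<inter> f)"
  proof (rule noncrossingD[OF assms(1) ef(1,2,4)])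
    show "mid e \<in> seg e" using mid_in_seg[OF e(2)] e(1) by simp
    show "mid e \<in> seg f" using mid_in_seg[OF f(2)] f(1) ef(3) by simp
  qed
  then obtain w where w: "w \<in> e" "w \<in> f" by blast
  have s: "fst u + fst v = fst u' + fst v'" "snd u + snd v = snd u' + snd v'"
    using ef(3) unfolding e(1) f(1) mid_pair[OF e(2)] mid_pair[OF f(2)]
    by (simp_all flip: of_int_add)
  have "e = f" using s w e f by (auto simp: prod_eq_iff doubleton_eq_iff)
  then show False using ef(4) by simp
qed

lemma inj_on_coord_sum:
  assumes "noncrossing T" "T \<subseteq> edges m n"
  shows "inj_on coord_sum T"
proof (rule inj_onI)
  fix e f assume ef: "e \<in> T" "f \<in> T" "coord_sum e = coord_sum f"
  have "mid e = (real_of_int (fst (coord_sum e)) / 2, real_of_int (snd (coord_sum e)) / 2)"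
    if "e \<in> T" for e
  proof -
    have "e \<in> edges m n" using that assms(2) by blast
    from edge_pair[OF this] obtain u v where "e = {u, v}" "u \<noteq> v" by auto
    then show ?thesis by (simp add: mid_pair coord_sum_pair)
  qed
  then have "mid e = mid f" using ef by simp
  then show "e = f" using inj_onD[OF inj_on_mid[OF assms]] ef(1,2) by simp
qed

lemma coord_sum_range:
  assumes "e \<in> edges m n"
  shows "coord_sum e \<in> {0..2 * int m} \<times> {0..2 * int n}"
proof -
  from edge_pair[OF assms] obtain u v where e: "e = {u, v}" "u \<noteq> v" by auto
  have "u \<in> Lambda0 m n" "v \<in> Lambda0 m n" using edge_subset[OF assms] e by auto
  then have "0 \<le> fst u" "fst u \<le> int m" "0 \<le> fst v" "fst v \<le> int m"
    "0 \<le> snd u" "snd u \<le> int n" "0 \<le> snd v" "snd v \<le> int n"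
    unfolding Lambda0_def by (auto simp: mem_Times_iff)
  then show ?thesis using e by (simp add: coord_sum_pair)
qed

lemma crossing_sym: "crossing e f \<longleftrightarrow> crossing f e"
  by (auto simp: crossing_def Int_commute)

lemma OmegaD:
  assumes "\<sigma> \<in> Omega m n"
  shows "\<sigma> \<subseteq> edges m n" "noncrossing \<sigma>"
  using assms by (auto simp: Omega_def)

text \<open>
  Maximality, used for single edges: this is the way in which edges are shown to exist.
\<close>
lemma Omega_maximal:
  assumes "\<sigma> \<in> Omega m n" "g \<in> edges m n" "\<And>f. f \<in> \<sigma> \<Longrightarrow> \<not> crossing g f"
  shows "g \<in> \<sigma>"
proof -
  have "noncrossing (insert g \<sigma>)"
    using OmegaD(2)[OF assms(1)] assms(3) by (auto simp: noncrossing_def crossing_sym) (auto simp: crossing_def)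
  then have "insert g \<sigma> = \<sigma>"
    using assms(1,2) unfolding Omega_def by blast
  then show ?thesis by blast
qed

section \<open>Gain of a unit strip\<close>

text \<open>
  The largest value of \<open>c - a\<close> for heights \<open>a\<close> and \<open>c\<close>
  between \<open>0\<close> and \<open>n\<close> with \<open>a + c = j\<close>.
\<close>
definition corner_weight :: "nat \<Rightarrow> int \<Rightarrow> int" where
  "corner_weight n j = min j (2 * int n - j)"

lemma sum_corner_weight: "(\<Sum>j\<in>{0..2 * int n}. corner_weight n j) = (int n)\<^sup>2"
proof (induction n)
  case 0
  then show ?case by (simp add: corner_weight_def)
next
  case (Suc n)
  have set_eq: "{0..2 * int (Suc n)} = insert 0 (insert (2 * int n + 2) ((\<lambda>j. j + 1) ` {0..2 * int n}))"
  proof -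
    have "(\<lambda>j. j + 1) ` {0..2 * int n} = {1..2 * int n + 1}"
      using image_add_atLeastAtMost'[of 1 0 "2 * int n"] by simp
    then show ?thesis by auto
  qed
  have "(\<Sum>j\<in>{0..2 * int (Suc n)}. corner_weight (Suc n) j) =
      corner_weight (Suc n) 0 + (corner_weight (Suc n) (2 * int n + 2) +
      (\<Sum>j\<in>(\<lambda>j. j + 1) ` {0..2 * int n}. corner_weight (Suc n) j))"
    unfolding set_eq by (subst sum.insert; (subst sum.insert)?; auto)
  also have "\<dots> = (\<Sum>j\<in>(\<lambda>j. j + 1) ` {0..2 * int n}. corner_weight (Suc n) j)"
    by (auto simp: corner_weight_def)
  also have "(\<Sum>j\<in>(\<lambda>j. j + 1) ` {0..2 * int n}. corner_weight (Suc n) j) =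
      (\<Sum>j\<in>{0..2 * int n}. corner_weight (Suc n) (j + 1))"
    by (subst sum.reindex) (auto simp: inj_on_def)
  also have "\<dots> = (\<Sum>j\<in>{0..2 * int n}. corner_weight n j + 1)"
    by (rule sum.cong) (auto simp: corner_weight_def)
  also have "\<dots> = (int n)\<^sup>2 + (2 * int n + 1)"
    using Suc by (simp add: sum.distrib)
  finally show ?case by (simp add: power2_eq_square algebra_simps)
qed

lemma corner_weight_nonneg: "j \<in> {0..2 * int n} \<Longrightarrow> 0 \<le> corner_weight n j"
  by (auto simp: corner_weight_def)

text \<open>
  Since each value of \<open>a + c\<close> occurs at most once, a bound for \<open>c - a\<close> in
  terms of \<open>a + c\<close> can be summed over all values, including those that do not occur.
\<close>
lemma rung_bound:
  fixes C :: "(int \<times> int) set" and U :: "int \<Rightarrow> real"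
  assumes C: "C \<subseteq> {0..int n} \<times> {0..int n}" and inj: "inj_on (\<lambda>(a, c). a + c) C"
    and U: "\<And>j. j \<in> {0..2 * int n} \<Longrightarrow> 0 \<le> U j"
    and le: "\<And>a c. (a, c) \<in> C \<Longrightarrow> real_of_int (c - a) \<le> U (a + c)"
  shows "real_of_int (\<Sum>(a, c)\<in>C. c - a) \<le> (\<Sum>j\<in>{0..2 * int n}. U j)"
proof -
  have "real_of_int (\<Sum>(a, c)\<in>C. c - a) = (\<Sum>p\<in>C. real_of_int (snd p - fst p))"
    by (simp add: case_prod_beta')
  also have "\<dots> \<le> (\<Sum>p\<in>C. U (fst p + snd p))"
    by (rule sum_mono) (use le in \<open>metis prod.collapse\<close>)
  also have "\<dots> = (\<Sum>j\<in>(\<lambda>(a, c). a + c) ` C. U j)"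
    using inj by (simp add: sum.reindex case_prod_beta' o_def)
  also have "\<dots> \<le> (\<Sum>j\<in>{0..2 * int n}. U j)"
  proof (rule sum_mono2)
    show "(\<lambda>(a, c). a + c) ` C \<subseteq> {0..2 * int n}" using C by fastforce
  qed (use U in auto)
  finally show ?thesis .
qed

lemma rung_sum_le:
  fixes C :: "(int \<times> int) set"
  assumes C: "C \<subseteq> {0..int n} \<times> {0..int n}" and inj: "inj_on (\<lambda>(a, c). a + c) C"
  shows "real_of_int (\<Sum>(a, c)\<in>C. c - a) \<le> (real n)\<^sup>2"
proof -
  have "real_of_int (\<Sum>(a, c)\<in>C. c - a) \<le> (\<Sum>j\<in>{0..2 * int n}. real_of_int (corner_weight n j))"
  proof (rule rung_bound[OF C inj])
    fix a c assume "(a, c) \<in> C"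
    then have "a \<in> {0..int n}" "c \<in> {0..int n}" using C by auto
    then show "real_of_int (c - a) \<le> real_of_int (corner_weight n (a + c))"
      unfolding of_int_le_iff by (auto simp: corner_weight_def)
  qed (use corner_weight_nonneg in force)
  also have "\<dots> = real_of_int (\<Sum>j\<in>{0..2 * int n}. corner_weight n j)" by simp
  finally show ?thesis by (simp only: sum_corner_weight) simp
qed

text \<open>
  The heights \<open>p\<close> and \<open>q\<close> are those of an obstacle, at the low and the
  high column, that descends towards the high column. A rung above it has \<open>a\<close> large, a
  rung below it has \<open>c\<close> small, and either way \<open>c - a\<close> falls short of
  \<open>corner_weight\<close>. A loss of half the smaller of \<open>p + q\<close> and
  \<open>2 n - (p + q)\<close> occurs for all sums in a window of length \<open>n / 4\<close> next
  to \<open>n\<close>.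
\<close>
lemma rung_sum_loss:
  fixes C :: "(int \<times> int) set" and p q :: real
  assumes C: "C \<subseteq> {0..int n} \<times> {0..int n}" and inj: "inj_on (\<lambda>(a, c). a + c) C"
    and pq: "0 \<le> q" "q \<le> p" "p \<le> real n"
    and comp: "\<And>a c. (a, c) \<in> C \<Longrightarrow> (real_of_int a \<le> p \<and> real_of_int c \<le> q) \<or> (p \<le> real_of_int a \<and> q \<le> real_of_int c)"
  shows "real_of_int (\<Sum>(a, c)\<in>C. c - a) \<le> (real n)\<^sup>2 - min (p + q) (2 * real n - (p + q)) * real n / 8"
proof -
  define t where "t = p + q"
  define w where "w = min t (2 * real n - t)"
  \<comment> \<open>The window lies on the same side of \<open>n\<close> as \<open>t\<close>. Below
      \<open>n\<close> a rung over the obstacle has \<open>2 a \<ge> t\<close>, a rung under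
      it has \<open>2 c \<le> t\<close>, and \<open>a + c \<ge> 3 n / 4\<close>; the case
      above \<open>n\<close> is symmetric.\<close>
  define J where "J = (if t \<le> real n then {j. 3 * int n \<le> 4 * j \<and> j \<le> int n}
      else {j. int n \<le> j \<and> 4 * j \<le> 5 * int n})"
  define U where "U j = real_of_int (corner_weight n j) - (if j \<in> J then w / 2 else 0)" for j
  have w0: "0 \<le> w" using pq by (auto simp: w_def t_def)
  have tb: "q \<le> t / 2" "t / 2 \<le> p" "0 \<le> t" "t \<le> 2 * real n" using pq by (auto simp: t_def)
  have Jsub: "J \<subseteq> {0..2 * int n}" by (auto simp: J_def)
  have cardJ: "real n / 4 \<le> real (card J)"
  proof (cases "t \<le> real n")
    case True
    then have "J = {(3 * int n + 3) div 4..int n}" by (auto simp: J_def)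
    then have "real (card J) = real (nat (int n + 1 - (3 * int n + 3) div 4))" by simp
    moreover have "int n + 1 - (3 * int n + 3) div 4 \<ge> 0" by linarith
    moreover have "4 * (int n + 1 - (3 * int n + 3) div 4) \<ge> int n" by presburger
    ultimately show ?thesis by linarith
  next
    case False
    then have "J = {int n..5 * int n div 4}" by (auto simp: J_def)
    then have "real (card J) = real (nat (5 * int n div 4 + 1 - int n))" by simp
    moreover have "5 * int n div 4 + 1 - int n \<ge> 0" by linarith
    moreover have "4 * (5 * int n div 4 + 1 - int n) \<ge> int n" by presburger
    ultimately show ?thesis by linarith
  qed
  have "real_of_int (\<Sum>(a, c)\<in>C. c - a) \<le> (\<Sum>j\<in>{0..2 * int n}. U j)"
  proof (rule rung_bound[OF C inj])
    fix j assume j: "j \<in> {0..2 * int n}"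
    show "0 \<le> U j"
    proof (cases "j \<in> J")
      case True
      have "real_of_int (4 * corner_weight n j) \<ge> real_of_int (3 * int n)"
        using True unfolding of_int_le_iff by (auto simp: J_def corner_weight_def split: if_splits)
      moreover have "w \<le> real n" by (auto simp: w_def)
      ultimately show ?thesis using True by (simp add: U_def)
    next
      case False
      then show ?thesis using corner_weight_nonneg[OF j] by (simp add: U_def)
    qed
  next
    fix a c assume ac: "(a, c) \<in> C"
    have rng: "a \<in> {0..int n}" "c \<in> {0..int n}" using C ac by auto
    show "real_of_int (c - a) \<le> U (a + c)"
    proof (cases "a + c \<in> J")
      case False
      have "c - a \<le> corner_weight n (a + c)" using rng by (auto simp: corner_weight_def)
      then have "real_of_int (c - a) \<le> real_of_int (corner_weight n (a + c))"
        by (simp only: of_int_le_iff)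
      then show ?thesis using False by (simp add: U_def)
    next
      case True
      show ?thesis
      proof (cases "t \<le> real n")
        case t: True
        have j: "3 * int n \<le> 4 * (a + c)" "a + c \<le> int n" using True t by (auto simp: J_def)
        have "real_of_int (3 * int n) \<le> real_of_int (4 * (a + c))" using j(1) by (simp only: of_int_le_iff)
        then have j1: "3 * real n \<le> 4 * real_of_int a + 4 * real_of_int c" by simp
        have "corner_weight n (a + c) = a + c" using j by (simp add: corner_weight_def)
        moreover have "w = t" using t by (simp add: w_def)
        ultimately have U_eq: "U (a + c) = real_of_int a + real_of_int c - t / 2"
          using True by (simp add: U_def)
        show ?thesis
          using comp[OF ac]
        proof (elim disjE conjE)
          assume "real_of_int a \<le> p" "real_of_int c \<le> q"
          then show ?thesis unfolding U_eq of_int_diff using tb t j1 by linarith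
        next
          assume "p \<le> real_of_int a" "q \<le> real_of_int c"
          then show ?thesis unfolding U_eq of_int_diff using tb t j1 by linarith
        qed
      next
        case t: False
        have j: "int n \<le> a + c" "4 * (a + c) \<le> 5 * int n" using True t by (auto simp: J_def)
        have "real_of_int (4 * (a + c)) \<le> real_of_int (5 * int n)" using j(2) by (simp only: of_int_le_iff)
        then have j1: "4 * real_of_int a + 4 * real_of_int c \<le> 5 * real n" by simp
        have "corner_weight n (a + c) = 2 * int n - (a + c)" using j by (simp add: corner_weight_def)
        moreover have "w = 2 * real n - t" using t by (simp add: w_def)
        ultimately have U_eq: "U (a + c) = 2 * real n - (real_of_int a + real_of_int c) - (2 * real n - t) / 2"
          using True by (simp add: U_def)
        show ?thesis
          using comp[OF ac]
        proof (elim disjE conjE)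
          assume "real_of_int c \<le> q"
          then have "2 * real_of_int c \<le> t" "t \<le> 2 * real n" using tb by linarith+
          then show ?thesis unfolding U_eq of_int_diff by argo
        next
          assume "p \<le> real_of_int a"
          then have "4 * real_of_int c \<le> 5 * real n - 2 * t" using tb j1 by linarith
          then show ?thesis unfolding U_eq of_int_diff using t by argo
        qed
      qed
    qed
  qed
  also have "(\<Sum>j\<in>{0..2 * int n}. U j) =
      real_of_int (\<Sum>j\<in>{0..2 * int n}. corner_weight n j) - (\<Sum>j\<in>{0..2 * int n}. if j \<in> J then w / 2 else 0)"
    by (simp add: U_def sum_subtractf)
  also have "(\<Sum>j\<in>{0..2 * int n}. if j \<in> J then w / 2 else 0) = real (card J) * (w / 2)"
  proof -
    have "(\<Sum>j\<in>{0..2 * int n}. if j \<in> J then w / 2 else 0) = (\<Sum>j\<in>{0..2 * int n} \<inter> J. w / 2)"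
      by (subst sum.inter_restrict) auto
    also have "{0..2 * int n} \<inter> J = J" using Jsub by blast
    finally show ?thesis by simp
  qed
  also have "real_of_int (\<Sum>j\<in>{0..2 * int n}. corner_weight n j) = (real n)\<^sup>2"
    by (simp only: sum_corner_weight) simp
  also have "(real n)\<^sup>2 - real (card J) * (w / 2) \<le> (real n)\<^sup>2 - real n / 4 * (w / 2)"
    using mult_right_mono[OF cardJ, of "w / 2"] w0 by simp
  finally show ?thesis unfolding w_def t_def by (simp add: mult.commute)
qed

definition narrow :: "edge \<Rightarrow> bool" where
  "narrow e \<longleftrightarrow> (\<exists>k a c. e = {(k, a), (k + 1, c)})"

text \<open>
  The low and the high column of the strip between the columns \<open>k\<close> and
  \<open>k + 1\<close>: the even columns are low if \<open>b\<close> holds, and the odd ones are low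
  otherwise. Hence the orientations of neighbouring strips are opposite.
\<close>
definition low_col :: "bool \<Rightarrow> int \<Rightarrow> int" where
  "low_col b k = (if even k = b then k else k + 1)"

definition high_col :: "bool \<Rightarrow> int \<Rightarrow> int" where
  "high_col b k = (if even k = b then k + 1 else k)"

text \<open>
  The first coordinate of \<open>p\<close> is the height in the low column, whichever side that is
  on.
\<close>
definition rung :: "bool \<Rightarrow> int \<Rightarrow> int \<times> int \<Rightarrow> edge" where
  "rung b k p = {(low_col b k, fst p), (high_col b k, snd p)}"

text \<open>
  Summing signed heights over the endpoints gives the difference of the heights in the high and in
  the low column without reference to the strip.
\<close>
definition gain :: "bool \<Rightarrow> edge \<Rightarrow> int" where
  "gain b e = (if narrow e then \<Sum>v\<in>e. if even (fst v) = b then - snd v else snd v else 0)"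

definition total_gain :: "bool \<Rightarrow> edge set \<Rightarrow> int" where
  "total_gain b \<sigma> = (\<Sum>e\<in>\<sigma>. gain b e)"

definition rungs :: "bool \<Rightarrow> edge set \<Rightarrow> int \<Rightarrow> (int \<times> int) set" where
  "rungs b \<sigma> k = {p. rung b k p \<in> \<sigma>}"

lemma rung_cases:
  "rung b k p = {(k, if even k = b then fst p else snd p), (k + 1, if even k = b then snd p else fst p)}"
  by (auto simp: rung_def low_col_def high_col_def)

lemma narrow_rung: "narrow (rung b k p)"
  unfolding narrow_def rung_cases by blast

lemma narrowE:
  assumes "narrow e"
  obtains k p where "e = rung b k p"
proof -
  obtain k a c where e: "e = {(k, a), (k + 1, c)}" using assms unfolding narrow_def by blast
  have "e = rung b k (if even k = b then (a, c) else (c, a))"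
    unfolding e rung_cases by simp
  then show thesis by (rule that)
qed

lemma rung_inj:
  assumes "rung b k p = rung b k' p'"
  shows "k = k'" "p = p'"
proof -
  have k: "k = k'"
    using assms unfolding rung_cases by (auto simp: doubleton_eq_iff)
  show "k = k'" by (fact k)
  show "p = p'"
    using assms unfolding k rung_cases by (auto simp: doubleton_eq_iff prod_eq_iff split: if_splits)
qed

lemma gain_rung: "gain b (rung b k p) = snd p - fst p"
proof (cases "even k = b")
  case True
  then have "(even (k + 1) = b) = False" by auto
  with True show ?thesis unfolding gain_def using narrow_rung[of b k p]
    by (simp add: rung_cases)
next
  case False
  then have "(even (k + 1) = b) = True" by auto
  with False show ?thesis unfolding gain_def using narrow_rung[of b k p]
    by (simp add: rung_cases)
qed

text \<open>The symmetry between the two traps.\<close>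
lemma gain_swap: "gain (\<not> b) e = - gain b e"
  by (auto simp: gain_def simp flip: sum_negf intro!: sum.cong)

lemma total_gain_swap: "total_gain (\<not> b) \<sigma> = - total_gain b \<sigma>"
  by (simp add: total_gain_def gain_swap sum_negf)

lemma rung_coord_sum: "coord_sum (rung b k p) = (2 * k + 1, fst p + snd p)"
  unfolding rung_cases by (subst coord_sum_pair) auto

lemma rung_range:
  assumes "rung b k p \<in> edges m n"
  shows "0 \<le> k" "k < int m" "p \<in> {0..int n} \<times> {0..int n}"
  using edge_subset[OF assms] unfolding rung_cases
  by (auto simp: Lambda0_def mem_Times_iff split: if_splits)

lemma rungs_range:
  assumes "\<sigma> \<subseteq> edges m n"
  shows "rungs b \<sigma> k \<subseteq> {0..int n} \<times> {0..int n}"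
  using assms rung_range(3) unfolding rungs_def by blast

lemma rungs_inj:
  assumes "noncrossing \<sigma>" "\<sigma> \<subseteq> edges m n"
  shows "inj_on (\<lambda>(a, c). a + c) (rungs b \<sigma> k)"
proof (rule inj_onI)
  fix p p' assume p: "p \<in> rungs b \<sigma> k" "p' \<in> rungs b \<sigma> k"
    and eq: "(case p of (a, c) \<Rightarrow> a + c) = (case p' of (a, c) \<Rightarrow> a + c)"
  have "rung b k p = rung b k p'"
    by (rule inj_onD[OF inj_on_coord_sum[OF assms]])
      (use p eq in \<open>auto simp: rungs_def rung_coord_sum case_prod_beta'\<close>)
  then show "p = p'" by (rule rung_inj)
qed

text \<open>
  Every narrow edge is a rung of exactly one strip, so the gain can be estimated strip by strip.
\<close>
lemma total_gain_strips:
  assumes \<sigma>: "\<sigma> \<subseteq> edges m n"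
  shows "total_gain b \<sigma> = (\<Sum>k\<in>{0..<int m}. \<Sum>(a, c)\<in>rungs b \<sigma> k. c - a)"
proof -
  have fin: "finite \<sigma>" using finite_subset[OF \<sigma>] by simp
  have finr: "finite (rungs b \<sigma> k)" for k
    using finite_subset[OF rungs_range[OF \<sigma>]] by blast
  define S where "S = Sigma {0..<int m} (rungs b \<sigma>)"
  have inj: "inj_on (\<lambda>(k, p). rung b k p) S"
    by (rule inj_onI) (auto dest: rung_inj)
  have img: "(\<lambda>(k, p). rung b k p) ` S = {e \<in> \<sigma>. narrow e}"
  proof
    show "(\<lambda>(k, p). rung b k p) ` S \<subseteq> {e \<in> \<sigma>. narrow e}"
      by (auto simp: S_def rungs_def narrow_rung)
    show "{e \<in> \<sigma>. narrow e} \<subseteq> (\<lambda>(k, p). rung b k p) ` S"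
    proof
      fix e assume e: "e \<in> {e \<in> \<sigma>. narrow e}"
      then obtain k p where kp: "e = rung b k p" using narrowE[of e b] by blast
      have "rung b k p \<in> edges m n" using e kp \<sigma> by blast
      from rung_range[OF this] have "(k, p) \<in> S"
        using e kp by (auto simp: S_def rungs_def)
      then show "e \<in> (\<lambda>(k, p). rung b k p) ` S" using kp by force
    qed
  qed
  have "total_gain b \<sigma> = (\<Sum>e\<in>{e \<in> \<sigma>. narrow e}. gain b e)"
    unfolding total_gain_def by (rule sum.mono_neutral_right) (use fin in \<open>auto simp: gain_def\<close>)
  also have "\<dots> = (\<Sum>(k, p)\<in>S. gain b (rung b k p))"
    unfolding img[symmetric] by (subst sum.reindex[OF inj]) (simp add: case_prod_beta' o_def)
  also have "\<dots> = (\<Sum>(k, p)\<in>S. snd p - fst p)"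
    by (simp add: gain_rung)
  also have "\<dots> = (\<Sum>k\<in>{0..<int m}. \<Sum>p\<in>rungs b \<sigma> k. snd p - fst p)"
    unfolding S_def by (rule sum.Sigma[symmetric]) (use finr in auto)
  finally show ?thesis by (simp add: case_prod_beta')
qed

lemma rung_comparable:
  fixes u v :: point
  assumes T: "noncrossing \<sigma>" and f: "{u, v} \<in> \<sigma>" and uv: "fst u \<le> k" "k + 1 \<le> fst v"
    and p: "(a, c) \<in> rungs b \<sigma> k"
  shows "(real_of_int a \<le> height u v (real_of_int (low_col b k)) \<and>
      real_of_int c \<le> height u v (real_of_int (high_col b k))) \<or>
    (height u v (real_of_int (low_col b k)) \<le> real_of_int a \<and>
      height u v (real_of_int (high_col b k)) \<le> real_of_int c)"
proof -
  have "{(k, if even k = b then a else c), (k + 1, if even k = b then c else a)} \<in> \<sigma>"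
    using p by (cases "even k = b") (auto simp: rungs_def rung_cases)
  from noncrossing_strip[OF T this f uv] show ?thesis
    by (cases "even k = b") (auto simp: low_col_def high_col_def)
qed

lemma height_bounds:
  fixes u v :: point
  assumes "u \<in> Lambda0 m n" "v \<in> Lambda0 m n" "fst u < fst v"
    "real_of_int (fst u) \<le> x" "x \<le> real_of_int (fst v)"
  shows "0 \<le> height u v x" "height u v x \<le> real n"
proof -
  define t where "t = (x - real_of_int (fst u)) / real_of_int (fst v - fst u)"
  have p: "real_of_int (fst v - fst u) > 0" using assms(3) by simp
  have h: "height u v x = (1 - t) * real_of_int (snd u) + t * real_of_int (snd v)"
    by (simp add: height_def t_def algebra_simps diff_divide_distrib add_divide_distrib)
  have t: "0 \<le> t" "t \<le> 1" using assms p by (auto simp: t_def divide_simps)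
  have uv: "0 \<le> snd u" "snd u \<le> int n" "0 \<le> snd v" "snd v \<le> int n"
    using assms by (auto simp: Lambda0_def mem_Times_iff)
  have r: "0 \<le> real_of_int (snd u)" "real_of_int (snd u) \<le> real n"
    "0 \<le> real_of_int (snd v)" "real_of_int (snd v) \<le> real n"
    using uv by linarith+
  show "0 \<le> height u v x" unfolding h using t r by simp
  have "(1 - t) * real_of_int (snd u) + t * real_of_int (snd v) \<le> (1 - t) * real n + t * real n"
    by (intro add_mono mult_left_mono) (use t r in auto)
  then show "height u v x \<le> real n" unfolding h by (simp add: algebra_simps)
qed

text \<open>
  All other strips have gain at most \<open>n\<^sup>2\<close>, so a loss in one strip is a loss of
  the total gain. If the total gain is within \<open>\<theta>\<close> of its maximum, then an edge
  that does not ascend towards the high column must run close to the bottom or to the top.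
\<close>
lemma wrong_strip_loss:
  fixes u v :: point
  assumes T: "noncrossing \<sigma>" "\<sigma> \<subseteq> edges m n" and f: "{u, v} \<in> \<sigma>"
    and uv: "fst u \<le> k" "k + 1 \<le> fst v"
    and wrong: "height u v (real_of_int (high_col b k)) \<le> height u v (real_of_int (low_col b k))"
    and G: "real m * (real n)\<^sup>2 - \<theta> \<le> real_of_int (total_gain b \<sigma>)"
  defines "t \<equiv> height u v (real_of_int k) + height u v (real_of_int (k + 1))"
  shows "min t (2 * real n - t) * real n \<le> 8 * \<theta>"
proof -
  have f': "{u, v} \<in> edges m n" using T(2) f by blast
  have uvL: "u \<in> Lambda0 m n" "v \<in> Lambda0 m n" using edge_subset[OF f'] by auto
  have k: "k \<in> {0..<int m}" using uv uvL by (auto simp: Lambda0_def mem_Times_iff)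
  have lo: "real_of_int (fst u) \<le> real_of_int (low_col b k)" "real_of_int (low_col b k) \<le> real_of_int (fst v)"
    "real_of_int (fst u) \<le> real_of_int (high_col b k)" "real_of_int (high_col b k) \<le> real_of_int (fst v)"
    unfolding of_int_le_iff using uv by (auto simp: low_col_def high_col_def)
  have lt: "fst u < fst v" using uv by linarith
  define S where "S j = real_of_int (\<Sum>(a, c)\<in>rungs b \<sigma> j. c - a)" for j
  have t: "t = height u v (real_of_int (low_col b k)) + height u v (real_of_int (high_col b k))"
    by (simp add: t_def low_col_def high_col_def)
  have Sk: "S k \<le> (real n)\<^sup>2 - min t (2 * real n - t) * real n / 8"
    unfolding S_def t
    by (rule rung_sum_loss[OF rungs_range[OF T(2)] rungs_inj[OF T]])
      (use height_bounds[OF uvL lt] lo wrong rung_comparable[OF T(1) f uv] in auto)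
  have "real_of_int (total_gain b \<sigma>) = (\<Sum>j\<in>{0..<int m}. S j)"
    by (simp add: total_gain_strips[OF T(2)] S_def case_prod_beta')
  also have "\<dots> = S k + (\<Sum>j\<in>{0..<int m} - {k}. S j)"
    by (rule sum.remove) (use k in auto)
  also have "(\<Sum>j\<in>{0..<int m} - {k}. S j) \<le> (\<Sum>j\<in>{0..<int m} - {k}. (real n)\<^sup>2)"
    unfolding S_def by (intro sum_mono rung_sum_le[OF rungs_range[OF T(2)] rungs_inj[OF T]])
  also have "(\<Sum>j\<in>{0..<int m} - {k}. (real n)\<^sup>2) = (real m - 1) * (real n)\<^sup>2"
  proof -
    have "real (card ({0..<int m} - {k})) = real m - 1"
      using k by (simp add: card_Diff_singleton)
    then show ?thesis by simp
  qed
  finally have "real_of_int (total_gain b \<sigma>) \<le> real m * (real n)\<^sup>2 - min t (2 * real n - t) * real n / 8"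
    using Sk by (simp add: algebra_simps)
  then show ?thesis using G by linarith
qed

section \<open>Confinement of bad edges\<close>

definition wide :: "edge \<Rightarrow> bool" where
  "wide e \<longleftrightarrow> (\<exists>u v. e = {u, v} \<and> fst u + 2 \<le> fst v)"

text \<open>The edges whose length is not accounted for by their gain.\<close>
definition bad :: "bool \<Rightarrow> edge \<Rightarrow> bool" where
  "bad b e \<longleftrightarrow> wide e \<or> gain b e < 0"

lemma height_step: "height u v (x + y) = height u v x + real_of_int (snd v - snd u) / real_of_int (fst v - fst u) * y"
proof -
  define s where "s = real_of_int (snd v - snd u) / real_of_int (fst v - fst u)"
  have h: "height u v z = real_of_int (snd u) + s * (z - real_of_int (fst u))" for z
    by (simp add: height_def s_def)
  show ?thesis unfolding h s_def[symmetric] by (simp add: algebra_simps)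
qed

text \<open>
  A wide edge has constant slope, so in every second strip that it spans it fails to ascend towards
  the high column and is close to the bottom or to the top there. Its slope is therefore at most
  \<open>\<eta>\<close> in absolute value, too small to pass from the bottom to the top within two
  strips, so it stays on one side.
\<close>
lemma wide_edge_confined:
  fixes u v :: point
  assumes T: "noncrossing \<sigma>" "\<sigma> \<subseteq> edges m n" and f: "{u, v} \<in> \<sigma>" and uv: "fst u + 2 \<le> fst v"
    and G: "real m * (real n)\<^sup>2 - \<theta> \<le> real_of_int (total_gain b \<sigma>)"
    and \<eta>: "8 * \<theta> \<le> \<eta> * real n" "6 * \<eta> < 2 * real n" and n: "0 < n"
  shows "(real_of_int (snd u) \<le> 2 * \<eta> \<and> real_of_int (snd v) \<le> 2 * \<eta>) \<or>
    (real n - 2 * \<eta> \<le> real_of_int (snd u) \<and> real n - 2 * \<eta> \<le> real_of_int (snd v))"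
proof -
  have f': "{u, v} \<in> edges m n" using T(2) f by blast
  have uvL: "u \<in> Lambda0 m n" "v \<in> Lambda0 m n" using edge_subset[OF f'] by auto
  have lt: "fst u < fst v" using uv by linarith
  define s where "s = real_of_int (snd v - snd u) / real_of_int (fst v - fst u)"
  define h where "h k = height u v (real_of_int k)" for k
  have hstep: "h (k + j) = h k + s * real_of_int j" for k j
    using height_step[of u v "real_of_int k" "real_of_int j"] by (simp add: h_def s_def)
  have hb: "0 \<le> h k" "h k \<le> real n" if "fst u \<le> k" "k \<le> fst v" for k
    using height_bounds[OF uvL lt, of "real_of_int k"] that by (auto simp: h_def)
  have n0: "0 < real n" using n by simp
  \<comment> \<open>Of the first two strips, one in which the edge does not ascend towards the high column.
      The strips \<open>\<kappa> + 2 r\<close> have the same orientation.\<close>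
  define \<kappa> where "\<kappa> = (if h (high_col b (fst u)) \<le> h (low_col b (fst u)) then fst u else fst u + 1)"
  have \<kappa>: "\<kappa> = fst u \<or> \<kappa> = fst u + 1" by (simp add: \<kappa>_def)
  have wrong\<kappa>: "(even \<kappa> = b \<and> s \<le> 0) \<or> (even \<kappa> \<noteq> b \<and> 0 \<le> s)"
    using hstep[of "fst u" 1] by (auto simp: \<kappa>_def low_col_def high_col_def)
  \<comment> \<open>Twice the height of the edge in the middle of strip \<open>\<kappa> + 2 r\<close>.\<close>
  define t where "t r = h (\<kappa> + 2 * int r) + h (\<kappa> + 2 * int r + 1)" for r
  have two: "t r \<le> \<eta> \<or> 2 * real n - t r \<le> \<eta>" if r: "\<kappa> + 2 * int r + 1 \<le> fst v" for r
  proof -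
    let ?k = "\<kappa> + 2 * int r"
    have "height u v (real_of_int (high_col b ?k)) \<le> height u v (real_of_int (low_col b ?k))"
      using wrong\<kappa> hstep[of ?k 1] by (auto simp: low_col_def high_col_def h_def)
    from wrong_strip_loss[OF T f _ r this G] \<kappa>
    have "min (t r) (2 * real n - t r) * real n \<le> 8 * \<theta>"
      by (auto simp: t_def h_def)
    then have "min (t r) (2 * real n - t r) * real n \<le> \<eta> * real n" using \<eta>(1) by linarith
    then have "min (t r) (2 * real n - t r) \<le> \<eta>" using n0 by simp
    then show ?thesis by linarith
  qed
  have tstep: "t (Suc r) = t r + 4 * s" for r
    using hstep[of "\<kappa> + 2 * int r" 2] hstep[of "\<kappa> + 2 * int r + 1" 2]
    by (simp add: t_def algebra_simps)
  have ts: "h (\<kappa> + 2 * int r + 1) = h (\<kappa> + 2 * int r) + s" for r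
    using hstep[of "\<kappa> + 2 * int r" 1] by simp
  have hr: "0 \<le> h (\<kappa> + 2 * int r)" "0 \<le> h (\<kappa> + 2 * int r + 1)"
      "h (\<kappa> + 2 * int r) \<le> real n" "h (\<kappa> + 2 * int r + 1) \<le> real n"
    if "\<kappa> + 2 * int r + 1 \<le> fst v" for r
    using hb[of "\<kappa> + 2 * int r"] hb[of "\<kappa> + 2 * int r + 1"] that \<kappa> by auto
  have low: "\<kappa> + 2 * int r + 1 \<le> fst v \<Longrightarrow> t 0 \<le> \<eta> \<Longrightarrow> t r \<le> \<eta>" for r
  proof (induction r)
    case (Suc r)
    then have r: "\<kappa> + 2 * int r + 1 \<le> fst v" by simp
    have "\<bar>s\<bar> \<le> \<eta>" using Suc.IH[OF r Suc.prems(2)] hr[OF r] ts[of r] by (auto simp: t_def)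
    then show ?case using two[OF Suc.prems(1)] tstep[of r] Suc.IH[OF r Suc.prems(2)] \<eta>(2) by linarith
  qed simp
  have high: "\<kappa> + 2 * int r + 1 \<le> fst v \<Longrightarrow> 2 * real n - t 0 \<le> \<eta> \<Longrightarrow> 2 * real n - t r \<le> \<eta>" for r
  proof (induction r)
    case (Suc r)
    then have r: "\<kappa> + 2 * int r + 1 \<le> fst v" by simp
    have "\<bar>s\<bar> \<le> \<eta>" using Suc.IH[OF r Suc.prems(2)] hr[OF r] ts[of r] by (auto simp: t_def)
    then show ?case using two[OF Suc.prems(1)] tstep[of r] Suc.IH[OF r Suc.prems(2)] \<eta>(2) by linarith
  qed simp
  have \<kappa>v: "\<kappa> + 2 * int 0 + 1 \<le> fst v" using \<kappa> uv by auto
  \<comment> \<open>The last of these strips; the edge ends there or one column later.\<close>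
  define r where "r = nat ((fst v - 1 - \<kappa>) div 2)"
  have r: "int r = (fst v - 1 - \<kappa>) div 2" using \<kappa>v by (simp add: r_def)
  have last: "\<kappa> + 2 * int r + 1 = fst v \<or> \<kappa> + 2 * int r + 1 = fst v - 1"
    unfolding r by presburger
  then have rv: "\<kappa> + 2 * int r + 1 \<le> fst v" by auto
  have hu: "real_of_int (snd u) = h \<kappa> \<or> real_of_int (snd u) = h \<kappa> - s"
    using \<kappa> height_ends(1)[of u v] hstep[of "fst u" 1] by (auto simp: h_def)
  have hv: "real_of_int (snd v) = h (\<kappa> + 2 * int r + 1) \<or> real_of_int (snd v) = h (\<kappa> + 2 * int r + 1) + s"
  proof -
    have "h (fst v) = real_of_int (snd v)" using height_ends(2)[OF lt] by (simp add: h_def)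
    moreover have "h (fst v) = h (fst v - 1) + s" using hstep[of "fst v - 1" 1] by simp
    ultimately show ?thesis using last by metis
  qed
  show ?thesis
    using two[OF \<kappa>v]
  proof
    assume l: "t 0 \<le> \<eta>"
    have "\<bar>s\<bar> \<le> \<eta>" using l hr[OF \<kappa>v] ts[of 0] by (auto simp: t_def)
    moreover have "h \<kappa> \<le> \<eta>" using l hr[OF \<kappa>v] by (auto simp: t_def)
    moreover have "h (\<kappa> + 2 * int r + 1) \<le> \<eta>" using low[OF rv l] hr[OF rv] by (auto simp: t_def)
    ultimately show ?thesis using hu hv by linarith
  next
    assume l: "2 * real n - t 0 \<le> \<eta>"
    have "\<bar>s\<bar> \<le> \<eta>" using l hr[OF \<kappa>v] ts[of 0] by (auto simp: t_def)
    moreover have "real n - h \<kappa> \<le> \<eta>" using l hr[OF \<kappa>v] by (auto simp: t_def)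
    moreover have "real n - h (\<kappa> + 2 * int r + 1) \<le> \<eta>" using high[OF rv l] hr[OF rv] by (auto simp: t_def)
    ultimately show ?thesis using hu hv by linarith
  qed
qed

text \<open>A rung of negative gain descends towards the high column in its own strip.\<close>
lemma narrow_bad_edge_confined:
  assumes T: "noncrossing \<sigma>" "\<sigma> \<subseteq> edges m n" and f: "rung b k p \<in> \<sigma>" and p: "snd p < fst p"
    and G: "real m * (real n)\<^sup>2 - \<theta> \<le> real_of_int (total_gain b \<sigma>)"
    and \<eta>: "8 * \<theta> \<le> \<eta> * real n"
  shows "(real_of_int (fst p) \<le> \<eta> \<and> real_of_int (snd p) \<le> \<eta>) \<or>
    (real n - \<eta> \<le> real_of_int (fst p) \<and> real n - \<eta> \<le> real_of_int (snd p))"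
proof -
  define u where "u = (k, if even k = b then fst p else snd p)"
  define v where "v = (k + 1, if even k = b then snd p else fst p)"
  have e: "{u, v} \<in> \<sigma>" using f by (simp add: rung_cases u_def v_def)
  have "rung b k p \<in> edges m n" using T(2) f by blast
  note rng = rung_range(3)[OF this]
  have n0: "0 < real n" using rng p by (cases n) (auto simp: mem_Times_iff)
  have h: "height u v (real_of_int k) = real_of_int (snd u)"
    "height u v (real_of_int (k + 1)) = real_of_int (snd v)"
    using height_ends[of u v] by (simp_all add: u_def v_def)
  have "height u v (real_of_int (high_col b k)) \<le> height u v (real_of_int (low_col b k))"
    using h p by (auto simp: low_col_def high_col_def u_def v_def)
  from wrong_strip_loss[OF T e _ _ this G]
  have "min (real_of_int (snd u) + real_of_int (snd v)) (2 * real n - (real_of_int (snd u) + real_of_int (snd v))) * real n \<le> 8 * \<theta>"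
    using h by (simp add: u_def v_def)
  then have "min (real_of_int (snd u) + real_of_int (snd v)) (2 * real n - (real_of_int (snd u) + real_of_int (snd v))) * real n \<le> \<eta> * real n"
    using \<eta> by linarith
  then have m: "min (real_of_int (snd u) + real_of_int (snd v)) (2 * real n - (real_of_int (snd u) + real_of_int (snd v))) \<le> \<eta>"
    using n0 by simp
  have uv: "real_of_int (snd u) + real_of_int (snd v) = real_of_int (fst p) + real_of_int (snd p)"
    by (simp add: u_def v_def)
  have "0 \<le> real_of_int (fst p)" "0 \<le> real_of_int (snd p)" "real_of_int (fst p) \<le> real n" "real_of_int (snd p) \<le> real n"
    using rng by (auto simp: mem_Times_iff)
  then show ?thesis using m unfolding uv by linarith
qed

lemma bad_edge_confined:
  assumes T: "noncrossing \<sigma>" "\<sigma> \<subseteq> edges m n" and e: "e \<in> \<sigma>" "bad b e"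
    and G: "real m * (real n)\<^sup>2 - \<theta> \<le> real_of_int (total_gain b \<sigma>)"
    and \<eta>: "0 \<le> \<eta>" "8 * \<theta> \<le> \<eta> * real n" "6 * \<eta> < 2 * real n" and n: "0 < n"
  shows "(\<forall>v\<in>e. real_of_int (snd v) \<le> 2 * \<eta>) \<or> (\<forall>v\<in>e. real n - 2 * \<eta> \<le> real_of_int (snd v))"
proof (cases "wide e")
  case True
  then obtain u v where uv: "e = {u, v}" "fst u + 2 \<le> fst v" unfolding wide_def by blast
  have "{u, v} \<in> \<sigma>" using e uv by simp
  from wide_edge_confined[OF T this uv(2) G \<eta>(2,3) n] show ?thesis by (auto simp: uv(1))
next
  case False
  then have g: "gain b e < 0" using e(2) by (simp add: bad_def)
  then have "narrow e" by (auto simp: gain_def split: if_splits)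
  then obtain k p where kp: "e = rung b k p" using narrowE by blast
  have "snd p < fst p" using g by (simp add: kp gain_rung)
  from narrow_bad_edge_confined[OF T _ this G \<eta>(2), of k] e(1) kp
  show ?thesis using \<eta>(1) unfolding kp rung_def by auto
qed

lemma gain_not_narrow: "\<not> narrow e \<Longrightarrow> gain b e = 0"
  by (simp add: gain_def)

lemma vertical_not_narrow: "\<not> narrow {(x, y), (x, z)}"
  unfolding narrow_def by (auto simp: doubleton_eq_iff)

text \<open>
  A rung with ends at heights \<open>a\<close> and \<open>c\<close> has length
  \<open>1 + \<bar>c - a\<bar>\<close>, which is \<open>1\<close> plus its gain unless the gain is
  negative. For bad edges the right-hand side carries twice the length, which also pays for a
  negative gain.
\<close>
lemma edge_length_gain:
  assumes "e \<in> edges m n"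
  shows "int (edge_length e) \<le> 1 + gain b e + (if bad b e then 2 * int (edge_length e) else 0)"
  using assms
proof (cases rule: edge_cases)
  case (vertical x y)
  then have "edge_length e = 1" by (simp add: edge_length_pair l1_dist_def)
  moreover have "gain b e = 0" using vertical by (simp add: gain_not_narrow vertical_not_narrow)
  ultimately show ?thesis by simp
next
  case (across x1 y1 x2 y2)
  show ?thesis
  proof (cases "x2 = x1 + 1")
    case True
    then have n: "narrow e" unfolding narrow_def using across(1) by blast
    then obtain k p where kp: "e = rung b k p" using narrowE by blast
    have len: "int (edge_length e) = 1 + \<bar>snd p - fst p\<bar>"
      unfolding kp rung_cases edge_length_pair l1_dist_def by auto
    show ?thesis
    proof (cases "snd p - fst p < 0")
      case True
      then have "bad b e" by (simp add: bad_def kp gain_rung)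
      then show ?thesis using True len by (simp add: kp gain_rung)
    next
      case False
      then show ?thesis using len by (auto simp: kp gain_rung)
    qed
  next
    case False
    then have w: "fst (x1, y1) + 2 \<le> fst (x2, y2)" using across(2) by simp
    then have wd: "wide e" unfolding wide_def using across(1) by blast
    have "\<not> narrow e" unfolding narrow_def across(1) using w by (auto simp: doubleton_eq_iff)
    then show ?thesis using wd by (simp add: bad_def gain_not_narrow)
  qed
qed

lemma card_le_midpoints:
  assumes "noncrossing \<sigma>" "\<sigma> \<subseteq> edges m n"
  shows "card \<sigma> \<le> (2 * m + 1) * (2 * n + 1)"
proof -
  have "card \<sigma> = card (coord_sum ` \<sigma>)" using inj_on_coord_sum[OF assms] by (simp add: card_image)
  also have "\<dots> \<le> card ({0..2 * int m} \<times> {0..2 * int n})"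
    by (rule card_mono) (use assms(2) coord_sum_range in blast)+
  finally show ?thesis by (simp add: card_cartesian_product nat_add_distrib nat_mult_distrib)
qed

text \<open>
  Edges correspond to midpoints, and the midpoints of these edges lie in two horizontal bands of
  height \<open>h\<close>.
\<close>
lemma card_confined_edges:
  assumes T: "noncrossing S" "S \<subseteq> edges m n" and h: "0 \<le> h"
    and conf: "\<And>e. e \<in> S \<Longrightarrow> (\<forall>v\<in>e. real_of_int (snd v) \<le> h) \<or> (\<forall>v\<in>e. real n - h \<le> real_of_int (snd v))"
  shows "real (card S) \<le> 2 * (2 * real m + 1) * (2 * h + 1)"
proof -
  define H where "H = \<lfloor>2 * h\<rfloor>"
  have H: "0 \<le> H" "real_of_int H \<le> 2 * h" using h by (auto simp: H_def)
  have sub: "coord_sum ` S \<subseteq> {0..2 * int m} \<times> ({0..H} \<union> {2 * int n - H..2 * int n})"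
  proof
    fix z assume "z \<in> coord_sum ` S"
    then obtain e where e: "e \<in> S" "z = coord_sum e" by blast
    have ed: "e \<in> edges m n" using e T by blast
    from edge_pair[OF ed] obtain u v where uv: "e = {u, v}" "u \<noteq> v" by auto
    have z: "z = (fst u + fst v, snd u + snd v)" using e uv by (simp add: coord_sum_pair)
    have rng: "z \<in> {0..2 * int m} \<times> {0..2 * int n}" using coord_sum_range[OF ed] e by simp
    from conf[OF e(1)] have "snd z \<le> H \<or> 2 * int n - H \<le> snd z"
    proof
      assume "\<forall>v\<in>e. real_of_int (snd v) \<le> h"
      then have "real_of_int (snd u + snd v) \<le> 2 * h" using uv by auto
      then show ?thesis by (simp add: z H_def le_floor_iff)
    next
      assume "\<forall>v\<in>e. real n - h \<le> real_of_int (snd v)"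
      then have "real n - h \<le> real_of_int (snd u)" "real n - h \<le> real_of_int (snd v)" using uv by auto
      then have "real_of_int (2 * int n - (snd u + snd v)) \<le> 2 * h" by simp
      then have "2 * int n - (snd u + snd v) \<le> H" unfolding H_def le_floor_iff .
      then show ?thesis by (simp add: z)
    qed
    then show "z \<in> {0..2 * int m} \<times> ({0..H} \<union> {2 * int n - H..2 * int n})"
      using rng by (auto simp: mem_Times_iff)
  qed
  have "card S = card (coord_sum ` S)" using inj_on_coord_sum[OF T] by (simp add: card_image)
  also have "\<dots> \<le> card ({0..2 * int m} \<times> ({0..H} \<union> {2 * int n - H..2 * int n}))"
    by (rule card_mono[OF _ sub]) simp
  also have "\<dots> \<le> (2 * m + 1) * (nat (H + 1) + nat (H + 1))"
  proof -
    have "card ({0..H} \<union> {2 * int n - H..2 * int n}) \<le> card {0..H} + card {2 * int n - H..2 * int n}"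
      by (rule card_Un_le)
    then show ?thesis unfolding card_cartesian_product by (intro mult_mono) auto
  qed
  finally have "real (card S) \<le> real ((2 * m + 1) * (nat (H + 1) + nat (H + 1)))" by (simp only: of_nat_le_iff)
  also have "\<dots> = (2 * real m + 1) * (2 * (real_of_int H + 1))"
    using H(1) by (simp add: algebra_simps)
  also have "\<dots> \<le> (2 * real m + 1) * (2 * (2 * h + 1))" by (intro mult_left_mono) (use H(2) in auto)
  finally show ?thesis by (simp add: algebra_simps)
qed

lemma confined_edge_length:
  assumes ed: "e \<in> edges m n" and h: "0 \<le> h"
    and conf: "(\<forall>v\<in>e. real_of_int (snd v) \<le> h) \<or> (\<forall>v\<in>e. real n - h \<le> real_of_int (snd v))"
  shows "real (edge_length e) \<le> real m + h"
proof -
  from edge_pair[OF ed] obtain u v where uv: "e = {u, v}" "u \<noteq> v" by auto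
  have L: "u \<in> Lambda0 m n" "v \<in> Lambda0 m n" using edge_subset[OF ed] uv by auto
  have "\<bar>fst u - fst v\<bar> \<le> int m" using L by (auto simp: Lambda0_def mem_Times_iff)
  then have "real_of_int \<bar>fst u - fst v\<bar> \<le> real m" by linarith
  moreover have r: "0 \<le> snd u" "0 \<le> snd v" "snd u \<le> int n" "snd v \<le> int n"
    using L by (auto simp: Lambda0_def mem_Times_iff)
  have "real_of_int \<bar>snd u - snd v\<bar> \<le> h"
    using conf
  proof
    assume "\<forall>v\<in>e. real_of_int (snd v) \<le> h"
    then show ?thesis using uv r by (auto simp: abs_if)
  next
    assume "\<forall>v\<in>e. real n - h \<le> real_of_int (snd v)"
    then have "real n - h \<le> real_of_int (snd u)" "real n - h \<le> real_of_int (snd v)" using uv by auto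
    moreover have "real_of_int (snd u) \<le> real n" "real_of_int (snd v) \<le> real n" using r by linarith+
    ultimately show ?thesis by (auto simp: abs_if)
  qed
  moreover have "real (edge_length e) = real_of_int \<bar>fst u - fst v\<bar> + real_of_int \<bar>snd u - snd v\<bar>"
    by (simp add: uv edge_length_pair l1_dist_def)
  ultimately show ?thesis by linarith
qed

text \<open>
  In a triangulation of nearly maximal gain the bad edges are confined, hence few and short, and the
  length is the gain up to controlled errors. The factor \<open>4 \<eta> + 1\<close> comes from the
  number of bad edges and \<open>m + 2 \<eta>\<close> from their lengths.
\<close>
lemma total_length_le:
  assumes T: "noncrossing \<sigma>" "\<sigma> \<subseteq> edges m n"
    and G: "real m * (real n)\<^sup>2 - \<theta> \<le> real_of_int (total_gain b \<sigma>)"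
    and \<eta>: "0 \<le> \<eta>" "8 * \<theta> \<le> \<eta> * real n" "6 * \<eta> < 2 * real n" and n: "0 < n"
  shows "real (total_length \<sigma>) \<le> real_of_int (total_gain b \<sigma>) + (2 * real m + 1) * (2 * real n + 1)
     + 4 * (2 * real m + 1) * (4 * \<eta> + 1) * (real m + 2 * \<eta>)"
proof -
  have fin: "finite \<sigma>" using finite_subset[OF T(2)] by simp
  define B where "B = {e \<in> \<sigma>. bad b e}"
  have BT: "noncrossing B" "B \<subseteq> edges m n" using T by (auto simp: B_def noncrossing_def)
  have conf: "(\<forall>v\<in>e. real_of_int (snd v) \<le> 2 * \<eta>) \<or> (\<forall>v\<in>e. real n - 2 * \<eta> \<le> real_of_int (snd v))" if "e \<in> B" for e
    using bad_edge_confined[OF T _ _ G \<eta> n, of e] that by (auto simp: B_def)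
  have cB: "real (card B) \<le> 2 * (2 * real m + 1) * (4 * \<eta> + 1)"
    using card_confined_edges[OF BT _ conf] \<eta>(1) by simp
  have "int (total_length \<sigma>) \<le> (\<Sum>e\<in>\<sigma>. 1 + gain b e + (if bad b e then 2 * int (edge_length e) else 0))"
    unfolding total_length_def of_nat_sum by (intro sum_mono edge_length_gain[of _ m n]) (use T in blast)
  also have "\<dots> = int (card \<sigma>) + total_gain b \<sigma> + (\<Sum>e\<in>B. 2 * int (edge_length e))"
    using fin by (simp add: sum.distrib total_gain_def B_def sum.inter_filter)
  finally have "real_of_int (int (total_length \<sigma>)) \<le> real_of_int (int (card \<sigma>) + total_gain b \<sigma> + (\<Sum>e\<in>B. 2 * int (edge_length e)))"
    by (simp only: of_int_le_iff)
  then have 1: "real (total_length \<sigma>) \<le> real (card \<sigma>) + real_of_int (total_gain b \<sigma>) + (\<Sum>e\<in>B. 2 * real (edge_length e))"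
    by simp
  have "(\<Sum>e\<in>B. 2 * real (edge_length e)) \<le> (\<Sum>e\<in>B. 2 * (real m + 2 * \<eta>))"
  proof (intro sum_mono mult_left_mono)
    fix e assume e: "e \<in> B"
    then show "real (edge_length e) \<le> real m + 2 * \<eta>"
      using confined_edge_length[of e m n "2 * \<eta>"] conf[OF e] BT(2) \<eta>(1) by auto
  qed auto
  also have "\<dots> = real (card B) * (2 * (real m + 2 * \<eta>))" by simp
  also have "\<dots> \<le> 2 * (2 * real m + 1) * (4 * \<eta> + 1) * (2 * (real m + 2 * \<eta>))"
    by (intro mult_right_mono cB) (use \<eta> in auto)
  finally have 2: "(\<Sum>e\<in>B. 2 * real (edge_length e)) \<le> 4 * (2 * real m + 1) * (4 * \<eta> + 1) * (real m + 2 * \<eta>)"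
    by (simp add: algebra_simps)
  have "real (card \<sigma>) \<le> real ((2 * m + 1) * (2 * n + 1))"
    using card_le_midpoints[OF T] by (simp only: of_nat_le_iff)
  also have "\<dots> = (2 * real m + 1) * (2 * real n + 1)" by (simp add: algebra_simps)
  finally show ?thesis using 1 2 by linarith
qed

lemma abs_gain_le:
  assumes "e \<in> edges m n"
  shows "\<bar>gain b e\<bar> \<le> int n"
proof (cases "narrow e")
  case True
  then obtain k p where kp: "e = rung b k p" using narrowE by blast
  then have "p \<in> {0..int n} \<times> {0..int n}" using rung_range(3)[of b k p m n] assms by simp
  then show ?thesis by (auto simp: kp gain_rung mem_Times_iff)
qed (simp add: gain_not_narrow)

section \<open>Counting triangulations with few wide edges\<close>

definition is_chain :: "(int \<times> int) set \<Rightarrow> bool" where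
  "is_chain C \<longleftrightarrow> (\<forall>p\<in>C. \<forall>q\<in>C. (fst p \<le> fst q \<and> snd p \<le> snd q) \<or> (fst q \<le> fst p \<and> snd q \<le> snd p))"

text \<open>
  On a chain in the product order both \<open>plain_sum\<close> and \<open>skew_sum\<close> are
  strictly increasing, and together they determine a pair.
\<close>
definition plain_sum :: "int \<times> int \<Rightarrow> int" where "plain_sum p = fst p + snd p"
definition skew_sum :: "int \<times> int \<Rightarrow> int" where "skew_sum p = 2 * fst p + snd p"

lemma rank_inj:
  fixes S :: "int set"
  assumes "finite S" "x \<in> S" "y \<in> S" "card {j \<in> S. j < x} = card {j \<in> S. j < y}"
  shows "x = y"
proof -
  have False if "x < y" "x \<in> S" "card {j \<in> S. j < x} = card {j \<in> S. j < y}" for x y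
  proof -
    have "{j \<in> S. j < x} \<subset> {j \<in> S. j < y}" using that by auto
    then have "card {j \<in> S. j < x} < card {j \<in> S. j < y}" by (intro psubset_card_mono) (use assms(1) in auto)
    then show False using that by simp
  qed
  then show ?thesis using assms by (metis linorder_cases)
qed

lemma chain_rank:
  assumes C: "is_chain C" and p: "p \<in> C"
  shows "card {j \<in> plain_sum ` C. j < plain_sum p} = card {j \<in> skew_sum ` C. j < skew_sum p}"
proof -
  have lt: "plain_sum q < plain_sum p \<longleftrightarrow> skew_sum q < skew_sum p" if "q \<in> C" for q
    using C that p unfolding is_chain_def plain_sum_def skew_sum_def by fastforce
  have inj: "inj_on plain_sum C" "inj_on skew_sum C"
    using C unfolding is_chain_def plain_sum_def skew_sum_def inj_on_def by (fastforce simp: prod_eq_iff)+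
  have "{j \<in> plain_sum ` C. j < plain_sum p} = plain_sum ` {q \<in> C. plain_sum q < plain_sum p}" by auto
  moreover have "{j \<in> skew_sum ` C. j < skew_sum p} = skew_sum ` {q \<in> C. plain_sum q < plain_sum p}" using lt by auto
  moreover have "card (plain_sum ` {q \<in> C. plain_sum q < plain_sum p}) = card {q \<in> C. plain_sum q < plain_sum p}"
    by (rule card_image) (rule inj_on_subset[OF inj(1)], auto)
  moreover have "card (skew_sum ` {q \<in> C. plain_sum q < plain_sum p}) = card {q \<in> C. plain_sum q < plain_sum p}"
    by (rule card_image) (rule inj_on_subset[OF inj(2)], auto)
  ultimately show ?thesis by simp
qed

text \<open>
  An element of a chain has the same rank among the values of \<open>plain_sum\<close> as among
  those of \<open>skew_sum\<close>. So the two sets of values can be matched by rank, and they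
  determine the chain: a chain in a square of side \<open>n\<close> costs only two subsets of
  intervals of length \<open>O(n)\<close>.
\<close>
lemma chain_determined:
  assumes C: "is_chain C" "is_chain D" and fin: "finite C"
    and eq: "plain_sum ` C = plain_sum ` D" "skew_sum ` C = skew_sum ` D"
  shows "C \<subseteq> D"
proof
  fix p assume p: "p \<in> C"
  then have "plain_sum p \<in> plain_sum ` D" using eq(1) by blast
  then obtain q where q: "q \<in> D" "plain_sum p = plain_sum q" by blast
  have "card {j \<in> skew_sum ` C. j < skew_sum p} = card {j \<in> skew_sum ` C. j < skew_sum q}"
    using chain_rank[OF C(1) p] chain_rank[OF C(2) q(1)] unfolding eq q(2) by simp
  then have "skew_sum p = skew_sum q"
    using rank_inj[of "skew_sum ` C" "skew_sum p" "skew_sum q"] fin p q(1) eq(2) by blast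
  then have "p = q" using q(2) by (simp add: plain_sum_def skew_sum_def prod_eq_iff)
  then show "p \<in> D" using q by simp
qed

text \<open>Two rungs of the same strip do not cross, so one lies above the other.\<close>
lemma rungs_chain:
  assumes T: "noncrossing \<sigma>"
  shows "is_chain (rungs b \<sigma> k)"
  unfolding is_chain_def
proof (intro ballI)
  fix p q assume p: "p \<in> rungs b \<sigma> k" and q: "q \<in> rungs b \<sigma> k"
  define u where "u = (k, if even k = b then fst q else snd q)"
  define v where "v = (k + 1, if even k = b then snd q else fst q)"
  have e: "{u, v} \<in> \<sigma>" using q by (simp add: rungs_def rung_cases u_def v_def)
  have h: "height u v (real_of_int k) = real_of_int (snd u)"
    "height u v (real_of_int (k + 1)) = real_of_int (snd v)"
    using height_ends[of u v] by (simp_all add: u_def v_def)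
  have "(real_of_int (fst p) \<le> height u v (real_of_int (low_col b k)) \<and>
      real_of_int (snd p) \<le> height u v (real_of_int (high_col b k))) \<or>
    (height u v (real_of_int (low_col b k)) \<le> real_of_int (fst p) \<and>
      height u v (real_of_int (high_col b k)) \<le> real_of_int (snd p))"
    by (rule rung_comparable[OF T e]) (use p in \<open>auto simp: u_def v_def\<close>)
  moreover have "height u v (real_of_int (low_col b k)) = real_of_int (fst q)"
    "height u v (real_of_int (high_col b k)) = real_of_int (snd q)"
    using h by (auto simp: low_col_def high_col_def u_def v_def)
  ultimately show "(fst p \<le> fst q \<and> snd p \<le> snd q) \<or> (fst q \<le> fst p \<and> snd q \<le> snd p)" by simp
qed

lemma card_small_subsets:
  assumes S: "finite S"
  shows "card {B. B \<subseteq> S \<and> card B \<le> M} \<le> (card S + 1) ^ M"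
proof (induction M)
  case 0
  have "{B. B \<subseteq> S \<and> card B \<le> 0} = {{}}" using S by (auto dest: finite_subset)
  then show ?case by simp
next
  case (Suc M)
  let ?F = "\<lambda>(x, B). case x of None \<Rightarrow> B | Some a \<Rightarrow> insert a B"
  let ?P = "insert None (Some ` S) \<times> {B. B \<subseteq> S \<and> card B \<le> M}"
  have finP: "finite ?P" using S by auto
  have "{B. B \<subseteq> S \<and> card B \<le> Suc M} \<subseteq> ?F ` ?P"
  proof
    fix B assume B: "B \<in> {B. B \<subseteq> S \<and> card B \<le> Suc M}"
    then have finB: "finite B" using S finite_subset by blast
    show "B \<in> ?F ` ?P"
    proof (cases "B = {}")
      case True
      then have "B = ?F (None, {})" by simp
      moreover have "(None, {}) \<in> ?P" by simp
      ultimately show ?thesis by (rule image_eqI)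
    next
      case False
      then obtain a where a: "a \<in> B" by blast
      have "B = ?F (Some a, B - {a})" using a by auto
      moreover have "(Some a, B - {a}) \<in> ?P" using a B finB by auto
      ultimately show ?thesis by (rule image_eqI)
    qed
  qed
  then have "card {B. B \<subseteq> S \<and> card B \<le> Suc M} \<le> card ?P"
    using surj_card_le[OF finP] by blast
  also have "\<dots> = (card S + 1) * card {B. B \<subseteq> S \<and> card B \<le> M}"
    using S by (simp add: card_cartesian_product card_image)
  also have "\<dots> \<le> (card S + 1) * (card S + 1) ^ M" by (intro mult_left_mono Suc.IH) simp
  finally show ?case by simp
qed

lemma card_edges_le: "card (edges m n) \<le> ((m + 1) * (n + 1))\<^sup>2"
proof -
  have "edges m n \<subseteq> (\<lambda>(u, v). {u, v}) ` (Lambda0 m n \<times> Lambda0 m n)" unfolding edges_def by auto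
  then have "card (edges m n) \<le> card (Lambda0 m n \<times> Lambda0 m n)" by (rule surj_card_le[rotated]) simp
  also have "\<dots> = ((m + 1) * (n + 1))\<^sup>2"
    by (simp add: card_cartesian_product Lambda0_def power2_eq_square nat_add_distrib)
  finally show ?thesis .
qed

definition vertical_edges :: "nat \<Rightarrow> nat \<Rightarrow> edge set" where
  "vertical_edges m n = (\<lambda>(x, y). {(x, y), (x, y + 1)}) ` ({0..int m} \<times> {0..<int n})"

lemma edge_kinds:
  assumes "e \<in> edges m n"
  shows "e \<in> vertical_edges m n \<or> narrow e \<or> wide e"
  using assms
proof (cases rule: edge_cases)
  case (vertical x y)
  have "(x, y) \<in> {0..int m} \<times> {0..<int n}"
    using edge_subset[OF assms] unfolding vertical by (auto simp: Lambda0_def)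
  then show ?thesis unfolding vertical_edges_def vertical by auto
next
  case (across x1 y1 x2 y2)
  show ?thesis
  proof (cases "x2 = x1 + 1")
    case True
    then have "narrow e" unfolding narrow_def using across(1) by blast
    then show ?thesis by simp
  next
    case False
    then have "fst (x1, y1) + 2 \<le> fst (x2, y2)" using across(2) by simp
    then have "wide e" unfolding wide_def using across(1) by blast
    then show ?thesis by simp
  qed
qed

text \<open>
  A triangulation is determined by the two sets of sums of its rungs in each strip, its vertical
  edges and its wide edges. The first three ingredients are subsets of sets of size
  \<open>O(m n)\<close>; the last one is chosen among polynomially many edges at most
  \<open>M\<close> times.
\<close>
lemma card_triangulations_few_wide:
  assumes A: "\<And>\<sigma>. \<sigma> \<in> A \<Longrightarrow> noncrossing \<sigma> \<and> \<sigma> \<subseteq> edges m n \<and> card {e \<in> \<sigma>. wide e} \<le> M"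
  shows "card A \<le> 2 ^ (m * (2 * n + 1)) * 2 ^ (m * (3 * n + 1)) * 2 ^ ((m + 1) * n) *
    (((m + 1) * (n + 1))\<^sup>2 + 1) ^ M"
proof -
  \<comment> \<open>Either orientation serves for the coding.\<close>
  define b where "b = True"
  define I where "I = {0..<int m}"
  define J1 where "J1 \<sigma> = Sigma I (\<lambda>k. plain_sum ` rungs b \<sigma> k)" for \<sigma>
  define J2 where "J2 \<sigma> = Sigma I (\<lambda>k. skew_sum ` rungs b \<sigma> k)" for \<sigma>
  define code where "code \<sigma> = (J1 \<sigma>, J2 \<sigma>, \<sigma> \<inter> vertical_edges m n, {e \<in> \<sigma>. wide e})" for \<sigma>
  define X1 where "X1 = Pow (I \<times> {0..2 * int n})"
  define X2 where "X2 = Pow (I \<times> {0..3 * int n})"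
  define X3 where "X3 = Pow (vertical_edges m n)"
  define X4 where "X4 = {B. B \<subseteq> edges m n \<and> card B \<le> M}"
  have finV: "finite (vertical_edges m n)" by (simp add: vertical_edges_def)
  have fin: "finite (X1 \<times> X2 \<times> X3 \<times> X4)" by (simp add: X1_def X2_def X3_def X4_def I_def finV)
  have sub: "code ` A \<subseteq> X1 \<times> X2 \<times> X3 \<times> X4"
  proof
    fix z assume "z \<in> code ` A"
    then obtain \<sigma> where \<sigma>: "\<sigma> \<in> A" "z = code \<sigma>" by blast
    have r: "fst p \<in> {0..int n} \<and> snd p \<in> {0..int n}" if "p \<in> rungs b \<sigma> k" for k p
      using that rungs_range[of \<sigma> m n b k] A[OF \<sigma>(1)] by (auto simp: mem_Times_iff)
    have "J1 \<sigma> \<in> X1" "J2 \<sigma> \<in> X2"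
      using r unfolding J1_def J2_def X1_def X2_def plain_sum_def skew_sum_def by fastforce+
    then show "z \<in> X1 \<times> X2 \<times> X3 \<times> X4" using A[OF \<sigma>(1)] \<sigma>(2) by (auto simp: code_def X3_def X4_def)
  qed
  have inj: "inj_on code A"
  proof -
    have "\<sigma> \<subseteq> \<tau>" if \<sigma>: "\<sigma> \<in> A" and \<tau>: "\<tau> \<in> A" and eq: "code \<sigma> = code \<tau>" for \<sigma> \<tau>
    proof
      fix e assume e: "e \<in> \<sigma>"
      note s = A[OF \<sigma>] and t = A[OF \<tau>]
      have ed: "e \<in> edges m n" using s e by blast
      have eqs: "J1 \<sigma> = J1 \<tau>" "J2 \<sigma> = J2 \<tau>" "\<sigma> \<inter> vertical_edges m n = \<tau> \<inter> vertical_edges m n"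
        "{e \<in> \<sigma>. wide e} = {e \<in> \<tau>. wide e}" using eq by (simp_all add: code_def)
      from edge_kinds[OF ed] show "e \<in> \<tau>"
      proof (elim disjE)
        assume "narrow e"
        then obtain k p where kp: "e = rung b k p" using narrowE by blast
        have k: "k \<in> I" using rung_range(1,2)[of b k p m n] ed kp by (simp add: I_def)
        have sl: "plain_sum ` rungs b \<sigma> k = plain_sum ` rungs b \<tau> k" "skew_sum ` rungs b \<sigma> k = skew_sum ` rungs b \<tau> k"
          using eqs(1,2) k unfolding J1_def J2_def by blast+
        have "finite (rungs b \<sigma> k)" using finite_subset[OF rungs_range[of \<sigma> m n b k]] s by blast
        from chain_determined[OF rungs_chain rungs_chain this sl] s t
        have "rungs b \<sigma> k \<subseteq> rungs b \<tau> k" by blast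
        then show ?thesis using e kp by (auto simp: rungs_def)
      next
        assume "e \<in> vertical_edges m n"
        then show ?thesis using eqs(3) e by blast
      next
        assume "wide e"
        then show ?thesis using eqs(4) e by blast
      qed
    qed
    then show ?thesis by (intro inj_onI equalityI) auto
  qed
  have "card A = card (code ` A)" using inj by (simp add: card_image)
  also have "\<dots> \<le> card (X1 \<times> X2 \<times> X3 \<times> X4)" by (rule card_mono[OF fin sub])
  also have "\<dots> = card X1 * card X2 * card X3 * card X4" by (simp add: card_cartesian_product)
  also have "card X1 = 2 ^ (m * (2 * n + 1))"
    by (simp add: X1_def I_def card_Pow card_cartesian_product nat_add_distrib nat_mult_distrib)
  also have "card X2 = 2 ^ (m * (3 * n + 1))"
    by (simp add: X2_def I_def card_Pow card_cartesian_product nat_add_distrib nat_mult_distrib)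
  also have "2 ^ (m * (2 * n + 1)) * 2 ^ (m * (3 * n + 1)) * card X3 * card X4 \<le>
      2 ^ (m * (2 * n + 1)) * 2 ^ (m * (3 * n + 1)) * 2 ^ ((m + 1) * n) * (((m + 1) * (n + 1))\<^sup>2 + 1) ^ M"
  proof (intro mult_mono mult_left_mono)
    have "card (vertical_edges m n) \<le> card ({0..int m} \<times> {0..<int n})"
      unfolding vertical_edges_def by (rule card_image_le) simp
    also have "\<dots> = (m + 1) * n" by (simp add: card_cartesian_product nat_add_distrib)
    finally show "card X3 \<le> 2 ^ ((m + 1) * n)" using finV by (simp add: X3_def card_Pow)
    have "card X4 \<le> (card (edges m n) + 1) ^ M" unfolding X4_def by (rule card_small_subsets) simp
    also have "\<dots> \<le> (((m + 1) * (n + 1))\<^sup>2 + 1) ^ M" by (intro power_mono add_mono card_edges_le) auto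
    finally show "card X4 \<le> (((m + 1) * (n + 1))\<^sup>2 + 1) ^ M" .
  qed auto
  finally show ?thesis .
qed

section \<open>Ground states\<close>

lemma narrow_same_strip_noncrossing:
  fixes k a c a' c' :: int
  assumes "a \<le> a'" "c \<le> c'"
  shows "\<not> crossing {(k, a), (k + 1, c)} {(k, a'), (k + 1, c')}"
proof
  let ?e = "{(k, a), (k + 1, c)}" and ?f = "{(k, a'), (k + 1, c')}"
  assume "crossing ?e ?f"
  then obtain z where ne: "?e \<noteq> ?f" and z: "z \<in> seg ?e" "z \<in> seg ?f" "z \<notin> pt ` (?e \<inter> ?f)"
    unfolding crossing_def by blast
  obtain t where t: "0 \<le> t" "t \<le> 1" "fst z = (1 - t) * real_of_int k + t * real_of_int (k + 1)"
      "snd z = (1 - t) * real_of_int a + t * real_of_int c"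
    using z(1) unfolding seg_pair point_on_closed_segment by auto
  obtain t' where t': "fst z = (1 - t') * real_of_int k + t' * real_of_int (k + 1)"
      "snd z = (1 - t') * real_of_int a' + t' * real_of_int c'"
    using z(2) unfolding seg_pair point_on_closed_segment by auto
  have "t' = t" using t(3) t'(1) by (simp add: algebra_simps)
  then have zero: "(1 - t) * (real_of_int a' - real_of_int a) + t * (real_of_int c' - real_of_int c) = 0"
    using t(4) t'(2) by (simp add: algebra_simps)
  have nn: "0 \<le> (1 - t) * (real_of_int a' - real_of_int a)" "0 \<le> t * (real_of_int c' - real_of_int c)"
    using assms t by simp_all
  have z0: "(1 - t) * (real_of_int a' - real_of_int a) = 0" "t * (real_of_int c' - real_of_int c) = 0"
    using zero nn by linarith+
  consider "t = 0" | "t = 1" | "a' = a" "c' = c" using z0 by auto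
  then show False
  proof cases
    case 1
    then have "a' = a" "z = pt (k, a)" using z0 t by (auto simp: prod_eq_iff)
    then show False using z(3) by auto
  next
    case 2
    then have "c' = c" "z = pt (k + 1, c)" using z0 t by (auto simp: prod_eq_iff)
    then show False using z(3) by auto
  next
    case 3 then show False using ne by simp
  qed
qed

lemma narrow_other_strip_noncrossing:
  fixes k k' a c a' c' :: int
  assumes "k < k'"
  shows "\<not> crossing {(k, a), (k + 1, c)} {(k', a'), (k' + 1, c')}"
proof
  let ?e = "{(k, a), (k + 1, c)}" and ?f = "{(k', a'), (k' + 1, c')}"
  assume "crossing ?e ?f"
  then obtain z where z: "z \<in> seg ?e" "z \<in> seg ?f" "z \<notin> pt ` (?e \<inter> ?f)"
    unfolding crossing_def by blast
  obtain t where t: "0 \<le> t" "t \<le> 1" "fst z = (1 - t) * real_of_int k + t * real_of_int (k + 1)"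
      "snd z = (1 - t) * real_of_int a + t * real_of_int c"
    using z(1) unfolding seg_pair point_on_closed_segment by auto
  obtain t' where t': "0 \<le> t'" "t' \<le> 1" "fst z = (1 - t') * real_of_int k' + t' * real_of_int (k' + 1)"
      "snd z = (1 - t') * real_of_int a' + t' * real_of_int c'"
    using z(2) unfolding seg_pair point_on_closed_segment by auto
  have f: "fst z = real_of_int k + t" "fst z = real_of_int k' + t'" using t(3) t'(3) by (simp_all add: algebra_simps)
  have "real_of_int (k + 1) \<le> real_of_int k'" using assms by (simp only: of_int_le_iff)
  then have tt: "t = 1" "t' = 0" "real_of_int k' = real_of_int (k + 1)" using f t(1,2) t'(1,2) by (simp_all)
  have k': "k' = k + 1" using tt(3) by (simp only: of_int_eq_iff)
  have zc: "z = pt (k + 1, c)" using tt t by (simp add: prod_eq_iff)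
  have za: "z = pt (k + 1, a')" using tt t' k' by (simp add: prod_eq_iff)
  have "c = a'" using zc za by simp
  then show False using z(3) zc k' by auto
qed

text \<open>
  The rungs from the bottom of the low column and those to the top of the high column. They form a
  chain in which every sum from \<open>0\<close> to \<open>2 n\<close> occurs, with the largest
  possible \<open>c - a\<close>.
\<close>
definition ladder :: "nat \<Rightarrow> (int \<times> int) set" where
  "ladder n = (\<lambda>j. (0, j)) ` {0..int n} \<union> (\<lambda>j. (j, int n)) ` {0..int n}"

lemma ladder_sum: "plain_sum ` ladder n = {0..2 * int n}"
proof
  show "plain_sum ` ladder n \<subseteq> {0..2 * int n}" by (auto simp: ladder_def plain_sum_def)
  show "{0..2 * int n} \<subseteq> plain_sum ` ladder n"
  proof
    fix j assume j: "j \<in> {0..2 * int n}"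
    show "j \<in> plain_sum ` ladder n"
    proof (cases "j \<le> int n")
      case True
      then show ?thesis using j by (intro image_eqI[of _ _ "(0, j)"]) (auto simp: ladder_def plain_sum_def)
    next
      case False
      then show ?thesis using j by (intro image_eqI[of _ _ "(j - int n, int n)"]) (auto simp: ladder_def plain_sum_def)
    qed
  qed
qed

lemma ladder_chain: "is_chain (ladder n)"
  unfolding is_chain_def ladder_def by auto

lemma ladder_diff: "p \<in> ladder n \<Longrightarrow> snd p - fst p = corner_weight n (plain_sum p)"
  by (auto simp: ladder_def plain_sum_def corner_weight_def)

lemma chain_inj_plain_sum: "is_chain C \<Longrightarrow> inj_on plain_sum C"
  unfolding is_chain_def plain_sum_def inj_on_def by (fastforce simp: prod_eq_iff)

lemma ladder_total: "(\<Sum>(a, c)\<in>ladder n. c - a) = (int n)\<^sup>2"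
proof -
  have "(\<Sum>(a, c)\<in>ladder n. c - a) = (\<Sum>p\<in>ladder n. corner_weight n (plain_sum p))"
    by (rule sum.cong) (use ladder_diff in \<open>auto simp: case_prod_beta'\<close>)
  also have "\<dots> = (\<Sum>j\<in>plain_sum ` ladder n. corner_weight n j)"
    by (subst sum.reindex[OF chain_inj_plain_sum[OF ladder_chain]]) simp
  finally show ?thesis by (simp add: ladder_sum sum_corner_weight)
qed

lemma extend_to_Omega:
  assumes "noncrossing T" "T \<subseteq> edges m n"
  obtains \<sigma> where "\<sigma> \<in> Omega m n" "T \<subseteq> \<sigma>"
proof -
  let ?X = "{S. S \<subseteq> edges m n \<and> noncrossing S}"
  have "finite ?X" by (rule finite_subset[of _ "Pow (edges m n)"]) auto
  moreover have "T \<in> ?X" using assms by simp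
  ultimately obtain S where S: "S \<in> ?X" "T \<subseteq> S" "\<forall>S'\<in>?X. S \<subseteq> S' \<longrightarrow> S = S'"
    using finite_has_maximal2[of ?X T] by blast
  then have "S \<in> Omega m n" unfolding Omega_def by blast
  then show thesis using that S(2) by blast
qed

text \<open>
  Rungs in different strips do not cross, and those of a ladder do not cross each other, so the
  ladders of all strips extend to a triangulation. It has no further rungs, because all midpoints on
  the middle lines of the strips are occupied.
\<close>
lemma ground_state:
  obtains \<sigma> where "\<sigma> \<in> Omega m n" "total_gain b \<sigma> = int m * (int n)\<^sup>2"
proof -
  define T where "T = (\<lambda>(k, p). rung b k p) ` ({0..<int m} \<times> ladder n)"
  have TE: "T \<subseteq> edges m n"
  proof
    fix e assume "e \<in> T"
    then obtain k p where kp: "e = rung b k p" "k \<in> {0..<int m}" "p \<in> ladder n" unfolding T_def by auto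
    have "fst p \<in> {0..int n}" "snd p \<in> {0..int n}" using kp(3) by (auto simp: ladder_def)
    then show "e \<in> edges m n" unfolding kp(1) rung_cases
      by (intro narrow_mem_edges) (use kp(2) in \<open>auto simp: Lambda0_def\<close>)
  qed
  have TN: "noncrossing T"
    unfolding noncrossing_def
  proof (intro ballI)
    fix e f assume "e \<in> T" "f \<in> T"
    then obtain k p k' p' where kp: "e = rung b k p" "p \<in> ladder n" "f = rung b k' p'" "p' \<in> ladder n"
      unfolding T_def by auto
    have comp: "(fst p \<le> fst p' \<and> snd p \<le> snd p') \<or> (fst p' \<le> fst p \<and> snd p' \<le> snd p)"
      using ladder_chain kp(2,4) unfolding is_chain_def by blast
    have sym: "crossing e f \<longleftrightarrow> crossing f e" by (auto simp: crossing_def Int_commute)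
    consider "k < k'" | "k' < k" | "k' = k" by linarith
    then show "\<not> crossing e f"
    proof cases
      case 1 then show ?thesis unfolding kp rung_cases by (rule narrow_other_strip_noncrossing)
    next
      case 2 then show ?thesis unfolding sym unfolding kp rung_cases by (rule narrow_other_strip_noncrossing)
    next
      case 3
      from comp show ?thesis
      proof
        assume "fst p \<le> fst p' \<and> snd p \<le> snd p'"
        then show ?thesis unfolding kp rung_cases 3 by (intro narrow_same_strip_noncrossing) auto
      next
        assume "fst p' \<le> fst p \<and> snd p' \<le> snd p"
        then show ?thesis unfolding sym unfolding kp rung_cases 3 by (intro narrow_same_strip_noncrossing) auto
      qed
    qed
  qed
  obtain \<sigma> where \<sigma>: "\<sigma> \<in> Omega m n" "T \<subseteq> \<sigma>" by (rule extend_to_Omega[OF TN TE])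
  have \<sigma>': "noncrossing \<sigma>" "\<sigma> \<subseteq> edges m n" using \<sigma>(1) by (auto simp: Omega_def)
  have "rungs b \<sigma> k = ladder n" if k: "k \<in> {0..<int m}" for k
  proof
    show L: "ladder n \<subseteq> rungs b \<sigma> k"
    proof
      fix p assume "p \<in> ladder n"
      then have "rung b k p \<in> T"
        unfolding T_def using k by (intro image_eqI[of _ _ "(k, p)"]) auto
      then show "p \<in> rungs b \<sigma> k" using \<sigma>(2) by (auto simp: rungs_def)
    qed
    show "rungs b \<sigma> k \<subseteq> ladder n"
    proof
      fix p assume p: "p \<in> rungs b \<sigma> k"
      have "plain_sum p \<in> {0..2 * int n}"
        using rungs_range[OF \<sigma>'(2), of b k] p by (auto simp: plain_sum_def mem_Times_iff)
      then obtain q where q: "q \<in> ladder n" "plain_sum p = plain_sum q" using ladder_sum[of n] by (metis imageE)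
      have "p = q" using inj_onD[OF chain_inj_plain_sum[OF rungs_chain[OF \<sigma>'(1)]] q(2) p] L q(1) by blast
      then show "p \<in> ladder n" using q(1) by simp
    qed
  qed
  then have "total_gain b \<sigma> = (\<Sum>k\<in>{0..<int m}. \<Sum>(a, c)\<in>ladder n. c - a)"
    unfolding total_gain_strips[OF \<sigma>'(2)] by (intro sum.cong) auto
  also have "\<dots> = int m * (int n)\<^sup>2" by (simp add: ladder_total)
  finally show thesis using that \<sigma>(1) by blast
qed

lemma total_gain_le_length:
  assumes "\<sigma> \<subseteq> edges m n"
  shows "total_gain b \<sigma> \<le> int (total_length \<sigma>)"
proof -
  have "gain b e \<le> int (edge_length e)" if "e \<in> \<sigma>" for e
  proof (cases "narrow e")
    case True
    then obtain k p where kp: "e = rung b k p" using narrowE by blast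
    have "int (edge_length e) = 1 + \<bar>snd p - fst p\<bar>"
      unfolding kp rung_cases edge_length_pair l1_dist_def by auto
    then show ?thesis by (simp add: kp gain_rung)
  qed (simp add: gain_not_narrow)
  then show ?thesis unfolding total_gain_def total_length_def of_nat_sum by (rule sum_mono)
qed

section \<open>Triangles in the plane\<close>

lemma interior_triangle:
  fixes A B C :: "real \<times> real"
  assumes "\<not> collinear {A, B, C}"
  shows "z \<in> interior (convex hull {A, B, C}) \<longleftrightarrow>
    (\<exists>x y w. 0 < x \<and> 0 < y \<and> 0 < w \<and> x + y + w = 1 \<and> z = x *\<^sub>R A + y *\<^sub>R B + w *\<^sub>R C)"
  using interior_convex_hull_3_minimal[OF assms] by auto

lemma triangle_mem:
  fixes A B C :: "real \<times> real"
  shows "z \<in> convex hull {A, B, C} \<longleftrightarrow>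
    (\<exists>x y w. 0 \<le> x \<and> 0 \<le> y \<and> 0 \<le> w \<and> x + y + w = 1 \<and> z = x *\<^sub>R A + y *\<^sub>R B + w *\<^sub>R C)"
  unfolding convex_hull_3 by auto

text \<open>
  Barycentric coordinates turn the plane geometry below into comparisons of signs.
\<close>
lemma barycentric_unique:
  fixes A B C :: "real \<times> real"
  assumes nc: "\<not> collinear {A, B, C}"
    and eq: "x *\<^sub>R A + y *\<^sub>R B + w *\<^sub>R C = x' *\<^sub>R A + y' *\<^sub>R B + w' *\<^sub>R C"
    and s: "x + y + w = 1" "x' + y' + w' = 1"
  shows "x = x'" "y = y'" "w = w'"
proof -
  have AB: "A \<noteq> B" using nc by auto
  have w: "w = w'"
  proof (rule ccontr)
    assume ne: "w \<noteq> w'"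
    have "(w - w') *\<^sub>R C = (x' - x) *\<^sub>R A + (y' - y) *\<^sub>R B"
      using eq by (simp add: algebra_simps)
    then have "(1 / (w - w')) *\<^sub>R ((w - w') *\<^sub>R C) = (1 / (w - w')) *\<^sub>R ((x' - x) *\<^sub>R A + (y' - y) *\<^sub>R B)"
      by simp
    then have "C = ((x' - x) / (w - w')) *\<^sub>R A + ((y' - y) / (w - w')) *\<^sub>R B"
      using ne by (simp add: scaleR_add_right)
    moreover have "(x' - x) / (w - w') + (y' - y) / (w - w') = 1"
      using s ne by (simp add: add_divide_distrib[symmetric])
    ultimately have "C \<in> affine hull {A, B}" unfolding affine_hull_2 by blast
    then show False using nc collinear_3_affine_hull[OF AB, of C] by simp
  qed
  have y: "y = y'"
  proof -
    have e: "r *\<^sub>R A + q *\<^sub>R B + w *\<^sub>R C = (1 - w) *\<^sub>R A + q *\<^sub>R (B - A) + w *\<^sub>R C"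
      if "r + q + w = 1" for r q
    proof -
      have r: "r = 1 - q - w" using that by simp
      show ?thesis unfolding r by (simp add: algebra_simps)
    qed
    have "y *\<^sub>R (B - A) = y' *\<^sub>R (B - A)"
      using eq e[of x y] e[of x' y'] s w by simp
    then show ?thesis using AB by simp
  qed
  show "x = x'" "y = y'" "w = w'" using y w s by auto
qed

lemma barycentric_exists:
  fixes A B C z :: "real \<times> real"
  assumes "\<not> collinear {A, B, C}"
  shows "\<exists>x y w. x + y + w = 1 \<and> z = x *\<^sub>R A + y *\<^sub>R B + w *\<^sub>R C"
proof -
  have "(1/3) *\<^sub>R A + (1/3) *\<^sub>R B + (1/3) *\<^sub>R C \<in> interior (convex hull {A, B, C})"
    unfolding interior_triangle[OF assms] by (intro exI[of _ "1/3"]) auto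
  then have "interior (convex hull {A, B, C}) \<noteq> {}" by blast
  then have "affine hull (convex hull {A, B, C}) = UNIV" by (rule affine_hull_nonempty_interior)
  then have "z \<in> affine hull {A, B, C}" by simp
  then show ?thesis unfolding affine_hull_3 by blast
qed

lemma triangle_side_not_interior:
  fixes A B C :: "real \<times> real"
  assumes nc: "\<not> collinear {A, B, C}"
  shows "closed_segment A B \<inter> interior (convex hull {A, B, C}) = {}"
proof (rule ccontr)
  assume "\<not> ?thesis"
  then obtain z where z: "z \<in> closed_segment A B" "z \<in> interior (convex hull {A, B, C})" by blast
  from z(1) obtain t where "z = (1 - t) *\<^sub>R A + t *\<^sub>R B" by (auto simp: closed_segment_def)
  then have zt: "z = (1 - t) *\<^sub>R A + t *\<^sub>R B + 0 *\<^sub>R C" by simp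
  from z(2) obtain x y w where xyw: "0 < w" "x + y + w = 1" "z = x *\<^sub>R A + y *\<^sub>R B + w *\<^sub>R C"
    unfolding interior_triangle[OF nc] by blast
  have "w = 0"
    by (rule barycentric_unique(3)[OF nc, of x y w "1 - t" t 0]) (use zt xyw in auto)
  then show False using xyw by simp
qed

lemma triangle_boundary:
  fixes A B C :: "real \<times> real"
  assumes nc: "\<not> collinear {A, B, C}"
    and z: "z \<in> convex hull {A, B, C}" "z \<notin> interior (convex hull {A, B, C})"
  shows "z \<in> closed_segment A B \<or> z \<in> closed_segment B C \<or> z \<in> closed_segment A C"
proof -
  from z(1) obtain x y w where xyw: "0 \<le> x" "0 \<le> y" "0 \<le> w" "x + y + w = 1"
      "z = x *\<^sub>R A + y *\<^sub>R B + w *\<^sub>R C" unfolding triangle_mem by blast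
  then have "\<not> (0 < x \<and> 0 < y \<and> 0 < w)" using z(2) unfolding interior_triangle[OF nc] by blast
  then consider "x = 0" | "y = 0" | "w = 0" using xyw by linarith
  then show ?thesis
  proof cases
    case 1
    then have "z \<in> closed_segment B C" using xyw by (auto simp: closed_segment_def intro!: exI[of _ w])
    then show ?thesis by simp
  next
    case 2
    then have "z \<in> closed_segment A C" using xyw by (auto simp: closed_segment_def intro!: exI[of _ w])
    then show ?thesis by simp
  next
    case 3
    then have "z \<in> closed_segment A B" using xyw by (auto simp: closed_segment_def intro!: exI[of _ y])
    then show ?thesis by simp
  qed
qed

lemma vertices_not_interior:
  fixes A B C :: "real \<times> real"
  assumes nc: "\<not> collinear {A, B, C}" and "z \<in> {A, B, C}"
  shows "z \<notin> interior (convex hull {A, B, C})"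
proof -
  have s: "{A, B, C} = {C, B, A}" by auto
  have "closed_segment C B \<inter> interior (convex hull {A, B, C}) = {}"
    using triangle_side_not_interior[of C B A] nc unfolding s by simp
  moreover note triangle_side_not_interior[OF nc]
  ultimately show ?thesis using assms(2) by auto
qed

text \<open>
  A connected set that meets the interior and its complement meets the frontier, which consists of
  the sides.
\<close>
lemma leave_triangle:
  fixes A B C :: "real \<times> real"
  assumes nc: "\<not> collinear {A, B, C}"
    and z: "z \<in> interior (convex hull {A, B, C})" and P: "P \<notin> interior (convex hull {A, B, C})"
  obtains y where "y \<in> closed_segment z P"
    "y \<in> closed_segment A B \<or> y \<in> closed_segment B C \<or> y \<in> closed_segment A C"
proof -
  let ?K = "convex hull {A, B, C}"
  have "closed_segment z P \<inter> frontier (interior ?K) \<noteq> {}"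
    by (rule connected_Int_frontier) (use z P in auto)
  then obtain y where y: "y \<in> closed_segment z P" "y \<in> frontier (interior ?K)" by blast
  have "closure (interior ?K) \<subseteq> ?K"
    by (intro closure_minimal interior_subset compact_imp_closed finite_imp_compact_convex_hull) simp
  then have "y \<in> ?K" "y \<notin> interior ?K" using y(2) by (auto simp: frontier_def)
  from triangle_boundary[OF nc this] y(1) show thesis using that by blast
qed

section \<open>Faces of a triangulation\<close>

text \<open>
  An edge through the interior leaves the triangle through a side in both directions. It can meet a
  side only at a common endpoint, which is a vertex of the triangle, so both its ends are vertices
  and it would be a side itself; but sides do not meet the interior.
\<close>
lemma empty_triangle_not_met:
  assumes S: "noncrossing S" and sides: "{a, b} \<in> S" "{b, c} \<in> S" "{a, c} \<in> S"
    and nc: "\<not> collinear {pt a, pt b, pt c}"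
    and empty: "\<And>v. pt v \<in> convex hull {pt a, pt b, pt c} \<Longrightarrow> v \<in> {a, b, c}"
    and g: "{p, q} \<in> S" "p \<noteq> q"
  shows "seg {p, q} \<inter> interior (convex hull {pt a, pt b, pt c}) = {}"
proof (rule ccontr)
  let ?K = "convex hull {pt a, pt b, pt c}"
  assume "\<not> ?thesis"
  then obtain z where z: "z \<in> seg {p, q}" "z \<in> interior ?K" by blast
  have perm: "{pt a, pt b, pt c} = {pt b, pt c, pt a}" "{pt a, pt b, pt c} = {pt a, pt c, pt b}" by auto
  have side_miss: "closed_segment (pt a) (pt b) \<inter> interior ?K = {}"
      "closed_segment (pt b) (pt c) \<inter> interior ?K = {}"
      "closed_segment (pt a) (pt c) \<inter> interior ?K = {}"
    using triangle_side_not_interior[OF nc]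
      triangle_side_not_interior[of "pt b" "pt c" "pt a", folded perm(1), OF nc]
      triangle_side_not_interior[of "pt a" "pt c" "pt b", folded perm(2), OF nc] by auto
  have not_side: "{p, q} \<noteq> {a, b}" "{p, q} \<noteq> {b, c}" "{p, q} \<noteq> {a, c}"
    using z side_miss unfolding seg_pair[symmetric] by auto
  have not_int: "pt v \<notin> interior ?K" for v
  proof
    assume v: "pt v \<in> interior ?K"
    then have "v \<in> {a, b, c}" using empty interior_subset by blast
    then show False using v vertices_not_interior[OF nc, of "pt v"] by auto
  qed
  have end_vertex: "x \<in> {a, b, c}" if x: "{p, q} = {x, y}" for x y
  proof -
    obtain w where w: "w \<in> closed_segment z (pt x)"
        "w \<in> closed_segment (pt a) (pt b) \<or> w \<in> closed_segment (pt b) (pt c) \<or> w \<in> closed_segment (pt a) (pt c)"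
      using leave_triangle[OF nc z(2) not_int] by blast
    have zxy: "z \<in> closed_segment (pt x) (pt y)" using z(1) unfolding x seg_pair .
    have "closed_segment z (pt x) \<subseteq> closed_segment (pt x) (pt y)"
      using zxy by (simp add: subset_closed_segment)
    then have wg: "w \<in> seg {p, q}" using w(1) unfolding x seg_pair by blast
    have "\<exists>v \<in> {a, b, c} \<inter> {p, q}. w = pt v"
      using w(2)
    proof (elim disjE)
      assume "w \<in> closed_segment (pt a) (pt b)"
      then have "w \<in> pt ` ({p, q} \<inter> {a, b})"
        using noncrossingD[OF S g(1) sides(1) not_side(1) wg] by (simp add: seg_pair)
      then show ?thesis by blast
    next
      assume "w \<in> closed_segment (pt b) (pt c)"
      then have "w \<in> pt ` ({p, q} \<inter> {b, c})"
        using noncrossingD[OF S g(1) sides(2) not_side(2) wg] by (simp add: seg_pair)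
      then show ?thesis by blast
    next
      assume "w \<in> closed_segment (pt a) (pt c)"
      then have "w \<in> pt ` ({p, q} \<inter> {a, c})"
        using noncrossingD[OF S g(1) sides(3) not_side(3) wg] by (simp add: seg_pair)
      then show ?thesis by blast
    qed
    then obtain v where v: "v \<in> {a, b, c}" "v \<in> {x, y}" "w = pt v" using x by auto
    have "v \<noteq> y"
    proof
      assume "v = y"
      then have "between (z, pt x) (pt y)" using w(1) v(3) by (simp add: between_mem_segment)
      moreover have "between (pt y, pt x) z" using zxy by (simp add: between_mem_segment closed_segment_commute)
      ultimately have "z = pt y" by (intro between_antisym)
      then show False using z(2) not_int by simp
    qed
    then show ?thesis using v by auto
  qed
  have "p \<in> {a, b, c}" "q \<in> {a, b, c}"
    using end_vertex[of p q] end_vertex[of q p] by (auto simp: insert_commute)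
  then show False using not_side g(2) by (auto simp: insert_commute)
qed

lemma triangle_edges:
  assumes "{a, b, c} \<in> triangles \<sigma>"
  shows "a \<noteq> b" "b \<noteq> c" "a \<noteq> c" "{a, b} \<in> \<sigma>" "{b, c} \<in> \<sigma>" "{a, c} \<in> \<sigma>"
    "\<And>f. f \<in> \<sigma> \<Longrightarrow> seg f \<inter> interior (convex hull {pt a, pt b, pt c}) = {}"
proof -
  have card3: "card {a, b, c} = 3" and sub: "\<And>e. e \<subseteq> {a, b, c} \<Longrightarrow> card e = 2 \<Longrightarrow> e \<in> \<sigma>"
    and miss: "\<And>f. f \<in> \<sigma> \<Longrightarrow> seg f \<inter> interior (convex hull (pt ` {a, b, c})) = {}"
    using assms unfolding triangles_def by blast+
  show d: "a \<noteq> b" "b \<noteq> c" "a \<noteq> c" using card3 by (auto simp: card_insert_if split: if_splits)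
  show "{a, b} \<in> \<sigma>" "{b, c} \<in> \<sigma>" "{a, c} \<in> \<sigma>" by (rule sub; use d in auto)+
  show "\<And>f. f \<in> \<sigma> \<Longrightarrow> seg f \<inter> interior (convex hull {pt a, pt b, pt c}) = {}" using miss by simp
qed

text \<open>
  Otherwise one of the three vertices would be a lattice point inside the opposite side.
\<close>
lemma triangle_not_collinear:
  assumes \<sigma>: "\<sigma> \<subseteq> edges m n" and t: "{a, b, c} \<in> triangles \<sigma>"
  shows "\<not> collinear {pt a, pt b, pt c}"
proof
  note tr = triangle_edges[OF t]
  assume "collinear {pt a, pt b, pt c}"
  then consider "pt a \<in> seg {b, c}" | "pt b \<in> seg {a, c}" | "pt c \<in> seg {a, b}"
    unfolding collinear_between_cases between_mem_segment seg_pair by (metis closed_segment_commute)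
  then show False
  proof cases
    case 1 then show False using edge_lattice_point[of "{b, c}" m n a] \<sigma> tr by blast
  next
    case 2 then show False using edge_lattice_point[of "{a, c}" m n b] \<sigma> tr by blast
  next
    case 3 then show False using edge_lattice_point[of "{a, b}" m n c] \<sigma> tr by blast
  qed
qed

text \<open>
  The lattice point on the segment nearest to \<open>v\<close>, other than \<open>v\<close> itself,
  is joined to \<open>v\<close> by an edge.
\<close>
lemma primitive_step:
  fixes v a :: point
  assumes "v \<noteq> a"
  obtains w where "w \<noteq> v" "pt w \<in> closed_segment (pt v) (pt a)" "seg {v, w} \<inter> range pt = {pt v, pt w}"
proof -
  define P where "P w \<longleftrightarrow> w \<noteq> v \<and> pt w \<in> closed_segment (pt v) (pt a)" for w
  have "P a" using assms by (simp add: P_def)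
  then obtain w where w: "P w" "\<And>u. P u \<Longrightarrow> l1_dist v w \<le> l1_dist v u"
    using ex_has_least_nat[of P a "l1_dist v"] by blast
  have sub: "closed_segment (pt v) (pt w) \<subseteq> closed_segment (pt v) (pt a)"
    using w(1) by (simp add: P_def subset_closed_segment)
  have "seg {v, w} \<inter> range pt \<subseteq> {pt v, pt w}"
  proof
    fix z assume z: "z \<in> seg {v, w} \<inter> range pt"
    then obtain u where u: "z = pt u" by blast
    have uw: "pt u \<in> closed_segment (pt v) (pt w)" using z u by (simp add: seg_pair)
    show "z \<in> {pt v, pt w}"
    proof (cases "u = v")
      case False
      have "P u" using False uw sub by (auto simp: P_def)
      then have "l1_dist v w \<le> l1_dist v u" by (rule w(2))
      then have le: "\<bar>fst v - fst w\<bar> + \<bar>snd v - snd w\<bar> \<le> \<bar>fst v - fst u\<bar> + \<bar>snd v - snd u\<bar>"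
        unfolding l1_dist_def by linarith
      from uw obtain t where t: "0 \<le> t" "t \<le> 1"
          "real_of_int (fst u) = (1 - t) * real_of_int (fst v) + t * real_of_int (fst w)"
          "real_of_int (snd u) = (1 - t) * real_of_int (snd v) + t * real_of_int (snd w)"
        unfolding point_on_closed_segment fst_pt snd_pt by blast
      have "real_of_int \<bar>fst v - fst u\<bar> = t * real_of_int \<bar>fst v - fst w\<bar>"
        "real_of_int \<bar>snd v - snd u\<bar> = t * real_of_int \<bar>snd v - snd w\<bar>"
      proof -
        have "real_of_int (fst v - fst u) = t * real_of_int (fst v - fst w)"
          "real_of_int (snd v - snd u) = t * real_of_int (snd v - snd w)"
          using t(3,4) by (simp_all add: algebra_simps)
        then show "real_of_int \<bar>fst v - fst u\<bar> = t * real_of_int \<bar>fst v - fst w\<bar>"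
          "real_of_int \<bar>snd v - snd u\<bar> = t * real_of_int \<bar>snd v - snd w\<bar>"
          using t(1) by (simp_all add: abs_mult)
      qed
      then have eq: "real_of_int (\<bar>fst v - fst u\<bar> + \<bar>snd v - snd u\<bar>) = t * real_of_int (\<bar>fst v - fst w\<bar> + \<bar>snd v - snd w\<bar>)"
        by (simp add: algebra_simps)
      have pos: "0 < \<bar>fst v - fst w\<bar> + \<bar>snd v - snd w\<bar>"
      proof -
        have "v \<noteq> w" using w(1) by (auto simp: P_def)
        then have "fst v \<noteq> fst w \<or> snd v \<noteq> snd w" by (auto simp: prod_eq_iff)
        then show ?thesis by auto
      qed
      have "1 * real_of_int (\<bar>fst v - fst w\<bar> + \<bar>snd v - snd w\<bar>) \<le> t * real_of_int (\<bar>fst v - fst w\<bar> + \<bar>snd v - snd w\<bar>)"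
        using le unfolding eq[symmetric] by (simp only: mult_1 of_int_le_iff)
      moreover have "0 < real_of_int (\<bar>fst v - fst w\<bar> + \<bar>snd v - snd w\<bar>)" using pos by (simp only: of_int_0_less_iff)
      ultimately have "1 \<le> t" by (simp only: mult_le_cancel_right_pos)
      then have "t = 1" using t(2) by simp
      then have "u = w" using t(3,4) by (simp add: prod_eq_iff)
      then show ?thesis using u by simp
    qed (use u in simp)
  qed
  then have "seg {v, w} \<inter> range pt = {pt v, pt w}" by (auto simp: seg_pair)
  then show thesis using that w(1) unfolding P_def by blast
qed

lemma lattice_hull_Lambda0:
  assumes "a \<in> Lambda0 m n" "b \<in> Lambda0 m n" "c \<in> Lambda0 m n" "pt v \<in> convex hull {pt a, pt b, pt c}"
  shows "v \<in> Lambda0 m n"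
proof -
  let ?R = "{0..real m} \<times> {0..real n}"
  have R: "pt u \<in> ?R \<longleftrightarrow> u \<in> Lambda0 m n" for u
    by (auto simp: pt_def Lambda0_def mem_Times_iff)
  have "convex hull {pt a, pt b, pt c} \<subseteq> ?R"
    by (rule hull_minimal) (use R assms in \<open>auto intro!: convex_Times\<close>)
  then show ?thesis using R assms(4) by blast
qed

text \<open>
  From a lattice point \<open>v\<close> in the interior take the primitive step towards the vertex
  \<open>a\<close>. It stays in the interior, except possibly for ending in \<open>a\<close>, so no
  edge of the triangulation crosses it and by maximality it belongs to the triangulation; but then
  it is an edge that meets the interior. On the boundary the only lattice points are the vertices.
\<close>
lemma triangle_empty:
  assumes \<sigma>: "\<sigma> \<in> Omega m n" and t: "{a, b, c} \<in> triangles \<sigma>"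
    and v: "pt v \<in> convex hull {pt a, pt b, pt c}"
  shows "v \<in> {a, b, c}"
proof -
  let ?K = "convex hull {pt a, pt b, pt c}"
  note tr = triangle_edges[OF t] and \<sigma>E = OmegaD(1)[OF \<sigma>]
  note nc = triangle_not_collinear[OF \<sigma>E t]
  have ed: "{a, b} \<in> edges m n" "{b, c} \<in> edges m n" "{a, c} \<in> edges m n" using tr \<sigma>E by auto
  have L: "a \<in> Lambda0 m n" "b \<in> Lambda0 m n" "c \<in> Lambda0 m n" using edge_subset ed by blast+
  show ?thesis
  proof (cases "pt v \<in> interior ?K")
    case False
    then show ?thesis using triangle_boundary[OF nc v] edge_lattice_point ed unfolding seg_pair[symmetric] by blast
  next
    case True
    then have "v \<noteq> a" using vertices_not_interior[OF nc, of "pt a"] by auto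
    then obtain w where w: "w \<noteq> v" "pt w \<in> closed_segment (pt v) (pt a)" "seg {v, w} \<inter> range pt = {pt v, pt w}"
      by (rule primitive_step)
    have "closed_segment (pt v) (pt a) \<subseteq> ?K"
      by (rule closed_segment_subset) (use v in \<open>auto intro: hull_inc\<close>)
    then have wK: "pt w \<in> ?K" using w(2) by blast
    have VW: "v \<in> Lambda0 m n" "w \<in> Lambda0 m n" using lattice_hull_Lambda0[OF L] v wK by auto
    have g: "{v, w} \<in> edges m n"
      unfolding edges_def using VW w(1,3) by blast
    have open_int: "open_segment (pt v) (pt a) \<subseteq> interior ?K"
      by (rule in_interior_closure_convex_segment) (use True in \<open>auto intro: hull_inc closure_subset[THEN subsetD]\<close>)
    have seg_sub: "seg {v, w} \<subseteq> insert (pt a) (interior ?K)"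
    proof -
      have "seg {v, w} \<subseteq> closed_segment (pt v) (pt a)"
        using w(2) by (simp add: seg_pair subset_closed_segment)
      also have "\<dots> = open_segment (pt v) (pt a) \<union> {pt v, pt a}" by (rule closed_segment_eq_open)
      finally show ?thesis using open_int True by blast
    qed
    have "{v, w} \<in> \<sigma>"
    proof (rule Omega_maximal[OF \<sigma> g])
      fix f assume f: "f \<in> \<sigma>"
      show "\<not> crossing {v, w} f"
      proof
        assume "crossing {v, w} f"
        then obtain z where z: "z \<in> seg {v, w}" "z \<in> seg f" "z \<notin> pt ` ({v, w} \<inter> f)"
          unfolding crossing_def by blast
        have "z = pt a" using seg_sub z(1,2) tr(7)[OF f] by blast
        then have "a \<in> {v, w}" "a \<in> f"
          using edge_lattice_point[OF g] edge_lattice_point[of f m n] z \<sigma>E f by blast+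
        then show False using z(3) \<open>z = pt a\<close> by blast
      qed
    qed
    then have "seg {v, w} \<inter> interior ?K = {}" by (rule tr(7))
    then show ?thesis using True by (auto simp: seg_pair)
  qed
qed

text \<open>
  Two faces with a common side lie on different sides of it. Their interiors are disjoint: an
  interior that meets another one without meeting the sides of that face is contained in it, by
  connectedness, and then the apex of the smaller face is a lattice point of the larger one. If the
  apexes were on the same side, a point just off the middle of the common side would be interior to
  both.
\<close>
lemma apex_opposite:
  assumes \<sigma>: "\<sigma> \<in> Omega m n" and s: "{a, b, c} \<in> triangles \<sigma>" and t: "{a, b, d} \<in> triangles \<sigma>" and "c \<noteq> d"
  obtains x y w where "x + y + w = 1" "w < 0" "pt d = x *\<^sub>R pt a + y *\<^sub>R pt b + w *\<^sub>R pt c"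
proof -
  let ?K1 = "convex hull {pt a, pt b, pt c}" and ?K2 = "convex hull {pt a, pt b, pt d}"
  note \<sigma>E = OmegaD(1)[OF \<sigma>]
  note nc1 = triangle_not_collinear[OF \<sigma>E s] and nc2 = triangle_not_collinear[OF \<sigma>E t]
  have closed2: "closed ?K2" "closed ?K1" by (intro compact_imp_closed finite_imp_compact_convex_hull; simp)+
  have disj: "interior ?K1 \<inter> interior ?K2 = {}"
  proof (rule ccontr)
    assume meet: "interior ?K1 \<inter> interior ?K2 \<noteq> {}"
    have "interior ?K1 \<inter> frontier ?K2 = {}"
    proof -
      have "frontier ?K2 \<subseteq> seg {a, b} \<union> seg {b, d} \<union> seg {a, d}"
        using triangle_boundary[OF nc2] closed2 by (auto simp: frontier_def seg_pair)
      then show ?thesis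
        using triangle_edges(7)[OF s triangle_edges(4)[OF t]] triangle_edges(7)[OF s triangle_edges(5)[OF t]]
          triangle_edges(7)[OF s triangle_edges(6)[OF t]] by blast
    qed
    moreover have "connected (interior ?K1)" by (intro convex_connected convex_interior convex_convex_hull)
    ultimately have "interior ?K1 - ?K2 = {}"
      using connected_Int_frontier[of "interior ?K1" ?K2] meet interior_subset by blast
    then have "closure (interior ?K1) \<subseteq> ?K2" using closed2 by (intro closure_minimal) auto
    moreover have "closure (interior ?K1) = closure ?K1"
      by (rule convex_closure_interior) (use meet in auto)
    moreover have "pt c \<in> closure ?K1" by (intro closure_subset[THEN subsetD] hull_inc) simp
    ultimately have "pt c \<in> ?K2" by blast
    then have "c \<in> {a, b, d}" by (rule triangle_empty[OF \<sigma> t])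
    then show False using \<open>c \<noteq> d\<close> triangle_edges(2,3)[OF s] by auto
  qed
  obtain x y w where xyw: "x + y + w = 1" "pt d = x *\<^sub>R pt a + y *\<^sub>R pt b + w *\<^sub>R pt c"
    using barycentric_exists[OF nc1] by blast
  have "w \<noteq> 0"
  proof
    assume "w = 0"
    then have "pt d \<in> affine hull {pt a, pt b}" using xyw unfolding affine_hull_2 by auto
    then show False using nc2 collinear_3_affine_hull[of "pt a" "pt b" "pt d"] triangle_edges(1)[OF s] by simp
  qed
  moreover have "\<not> 0 < w"
  proof
    assume w: "0 < w"
    \<comment> \<open>A point close enough to the midpoint of \<open>a\<close> and \<open>b\<close> for its
        coordinates \<open>x\<close> and \<open>y\<close> to stay positive.\<close>
    define \<epsilon> where "\<epsilon> = 1 / (4 * (1 + \<bar>x\<bar> + \<bar>y\<bar>))"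
    have e: "0 < \<epsilon>" "\<epsilon> \<le> 1 / 4" by (auto simp: \<epsilon>_def divide_simps)
    have "\<epsilon> * (1 + \<bar>x\<bar> + \<bar>y\<bar>) = 1 / 4" by (simp add: \<epsilon>_def divide_simps)
    then have ee: "\<epsilon> + \<epsilon> * \<bar>x\<bar> + \<epsilon> * \<bar>y\<bar> = 1 / 4" by (simp add: algebra_simps)
    have "- (\<epsilon> * \<bar>x\<bar>) \<le> \<epsilon> * x" "- (\<epsilon> * \<bar>y\<bar>) \<le> \<epsilon> * y" "0 \<le> \<epsilon> * \<bar>x\<bar>" "0 \<le> \<epsilon> * \<bar>y\<bar>"
      using e by (auto simp: abs_if)
    then have "- (1 / 4) \<le> \<epsilon> * x" "- (1 / 4) \<le> \<epsilon> * y" "3 / 8 \<le> (1 - \<epsilon>) / 2" using ee e by argo+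
    then have pos: "0 < (1 - \<epsilon>) / 2 + \<epsilon> * x" "0 < (1 - \<epsilon>) / 2 + \<epsilon> * y" by linarith+
    define z where "z = ((1 - \<epsilon>) / 2) *\<^sub>R pt a + ((1 - \<epsilon>) / 2) *\<^sub>R pt b + \<epsilon> *\<^sub>R pt d"
    have "z \<in> interior ?K2"
      unfolding interior_triangle[OF nc2] z_def using e by (intro exI[of _ "(1 - \<epsilon>) / 2"] exI[of _ \<epsilon>]) auto
    moreover have "z \<in> interior ?K1"
      unfolding interior_triangle[OF nc1]
    proof (intro exI conjI)
      show "0 < (1 - \<epsilon>) / 2 + \<epsilon> * x" "0 < (1 - \<epsilon>) / 2 + \<epsilon> * y" "0 < \<epsilon> * w" using pos e w by auto
      have "\<epsilon> * x + \<epsilon> * y + \<epsilon> * w = \<epsilon>" using xyw(1) by (simp flip: distrib_left)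
      then show "(1 - \<epsilon>) / 2 + \<epsilon> * x + ((1 - \<epsilon>) / 2 + \<epsilon> * y) + \<epsilon> * w = 1" by (simp add: field_simps)
      show "z = ((1 - \<epsilon>) / 2 + \<epsilon> * x) *\<^sub>R pt a + ((1 - \<epsilon>) / 2 + \<epsilon> * y) *\<^sub>R pt b + (\<epsilon> * w) *\<^sub>R pt c"
        unfolding z_def xyw(2) by (simp add: algebra_simps)
    qed
    ultimately show False using disj by blast
  qed
  ultimately have "w < 0" by simp
  then show thesis using that xyw by blast
qed

section \<open>Quadrilaterals with crossing diagonals\<close>

text \<open>
  The segments \<open>A B\<close> and \<open>C D\<close> meet in a point interior to both.
\<close>
definition cross_at :: "real \<times> real \<Rightarrow> real \<times> real \<Rightarrow> real \<times> real \<Rightarrow> real \<times> real \<Rightarrow> bool" where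
  "cross_at A B C D \<longleftrightarrow> (\<exists>\<beta> \<delta>. 0 < \<beta> \<and> \<beta> < 1 \<and> 0 < \<delta> \<and> \<delta> < 1 \<and>
     (1 - \<beta>) *\<^sub>R A + \<beta> *\<^sub>R B = (1 - \<delta>) *\<^sub>R C + \<delta> *\<^sub>R D)"

lemma cross_at_swap: "cross_at A B C D \<Longrightarrow> cross_at C D A B"
  unfolding cross_at_def by metis

lemma cross_at_rev: "cross_at A B C D \<Longrightarrow> cross_at B A C D"
  unfolding cross_at_def
proof (elim exE conjE)
  fix \<beta> \<delta> :: real
  assume "0 < \<beta>" "\<beta> < 1" "0 < \<delta>" "\<delta> < 1" "(1 - \<beta>) *\<^sub>R A + \<beta> *\<^sub>R B = (1 - \<delta>) *\<^sub>R C + \<delta> *\<^sub>R D"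
  then show "\<exists>\<beta> \<delta>. 0 < \<beta> \<and> \<beta> < 1 \<and> 0 < \<delta> \<and> \<delta> < 1 \<and> (1 - \<beta>) *\<^sub>R B + \<beta> *\<^sub>R A = (1 - \<delta>) *\<^sub>R C + \<delta> *\<^sub>R D"
    by (intro exI[of _ "1 - \<beta>"] exI[of _ \<delta>]) (simp add: add.commute)
qed

lemma cross_at_not_collinear:
  assumes X: "cross_at A B C D" and nc: "\<not> collinear {A, B, C}"
  shows "\<not> collinear {A, C, D}"
proof
  assume col: "collinear {A, C, D}"
  obtain \<beta> \<delta> where bd: "0 < \<beta>" "\<beta> < 1" "0 < \<delta>" "\<delta> < 1"
      "(1 - \<beta>) *\<^sub>R A + \<beta> *\<^sub>R B = (1 - \<delta>) *\<^sub>R C + \<delta> *\<^sub>R D" using X unfolding cross_at_def by blast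
  obtain u v where uv: "{A, C, D} \<subseteq> affine hull {u, v}" using col unfolding collinear_affine_hull by blast
  have "\<beta> *\<^sub>R B = (1 - \<delta>) *\<^sub>R C + \<delta> *\<^sub>R D - (1 - \<beta>) *\<^sub>R A" using bd(5) by (simp add: algebra_simps)
  then have "(1 / \<beta>) *\<^sub>R (\<beta> *\<^sub>R B) = (1 / \<beta>) *\<^sub>R ((1 - \<delta>) *\<^sub>R C + \<delta> *\<^sub>R D - (1 - \<beta>) *\<^sub>R A)" by simp
  then have B: "B = ((1 - \<delta>) / \<beta>) *\<^sub>R C + (\<delta> / \<beta>) *\<^sub>R D + (- ((1 - \<beta>) / \<beta>)) *\<^sub>R A"
    using bd by (simp add: scaleR_add_right scaleR_diff_right)
  have one: "(1 - \<delta>) / \<beta> + \<delta> / \<beta> + - ((1 - \<beta>) / \<beta>) = 1"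
    using bd by (simp add: add_divide_distrib[symmetric] field_simps)
  have "B \<in> affine hull {C, D, A}" unfolding affine_hull_3 using B one by blast
  moreover have "affine hull {C, D, A} \<subseteq> affine hull {u, v}"
    by (rule hull_minimal) (use uv in auto)
  ultimately have "{A, B, C} \<subseteq> affine hull {u, v}" using uv by auto
  then show False using nc unfolding collinear_affine_hull by blast
qed

text \<open>
  A triangle on the diagonal \<open>A B\<close> is divided by the point where the diagonals cross;
  each part lies in one of the triangles on the diagonal \<open>C D\<close>.
\<close>
lemma cross_at_half:
  assumes X: "cross_at A B C D"
  shows "convex hull {A, B, C} \<subseteq> convex hull {A, C, D} \<union> convex hull {B, C, D}"
proof
  obtain \<beta> \<delta> where bd: "0 < \<beta>" "\<beta> < 1" "0 < \<delta>" "\<delta> < 1"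
      "(1 - \<beta>) *\<^sub>R A + \<beta> *\<^sub>R B = (1 - \<delta>) *\<^sub>R C + \<delta> *\<^sub>R D" using X unfolding cross_at_def by blast
  fix z assume "z \<in> convex hull {A, B, C}"
  then obtain x y w where xyw: "0 \<le> x" "0 \<le> y" "0 \<le> w" "x + y + w = 1" "z = x *\<^sub>R A + y *\<^sub>R B + w *\<^sub>R C"
    unfolding convex_hull_3 by blast
  show "z \<in> convex hull {A, C, D} \<union> convex hull {B, C, D}"
  proof (cases "y * (1 - \<beta>) \<le> x * \<beta>")
    case True
    define k where "k = y / \<beta>"
    have k: "0 \<le> k" "k * \<beta> = y" using xyw bd by (auto simp: k_def)
    have "k * \<beta> * (1 - \<beta>) \<le> x * \<beta>" using True k by simp
    then have le: "k * (1 - \<beta>) \<le> x" using bd(1) by (simp add: mult.assoc mult.left_commute)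
    have "z = (x - k * (1 - \<beta>)) *\<^sub>R A + k *\<^sub>R ((1 - \<beta>) *\<^sub>R A + \<beta> *\<^sub>R B) + w *\<^sub>R C"
      unfolding xyw(5) k(2)[symmetric] by (simp add: algebra_simps)
    also have "\<dots> = (x - k * (1 - \<beta>)) *\<^sub>R A + (w + k * (1 - \<delta>)) *\<^sub>R C + (k * \<delta>) *\<^sub>R D"
      unfolding bd(5) by (simp add: algebra_simps)
    finally have z: "z = (x - k * (1 - \<beta>)) *\<^sub>R A + (w + k * (1 - \<delta>)) *\<^sub>R C + (k * \<delta>) *\<^sub>R D" .
    have sum1: "x - k * (1 - \<beta>) + (w + k * (1 - \<delta>)) + k * \<delta> = 1"
      using xyw(4) k(2) by (simp add: algebra_simps)
    have "z \<in> convex hull {A, C, D}" unfolding convex_hull_3 mem_Collect_eq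
      by (intro exI[of _ "x - k * (1 - \<beta>)"] exI[of _ "w + k * (1 - \<delta>)"] exI[of _ "k * \<delta>"])
        (use z sum1 le k bd xyw in auto)
    then show ?thesis by blast
  next
    case False
    define k where "k = x / (1 - \<beta>)"
    have k: "0 \<le> k" "k * (1 - \<beta>) = x" using xyw bd by (auto simp: k_def)
    have "k * (1 - \<beta>) * \<beta> \<le> y * (1 - \<beta>)" using False k by simp
    then have "(1 - \<beta>) * (k * \<beta>) \<le> (1 - \<beta>) * y" by (simp add: mult_ac)
    then have le: "k * \<beta> \<le> y" using bd(2) by (simp only: mult_le_cancel_left_pos diff_gt_0_iff_gt)
    have "z = (y - k * \<beta>) *\<^sub>R B + k *\<^sub>R ((1 - \<beta>) *\<^sub>R A + \<beta> *\<^sub>R B) + w *\<^sub>R C"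
      unfolding xyw(5) k(2)[symmetric] by (simp add: algebra_simps)
    also have "\<dots> = (y - k * \<beta>) *\<^sub>R B + (w + k * (1 - \<delta>)) *\<^sub>R C + (k * \<delta>) *\<^sub>R D"
      unfolding bd(5) by (simp add: algebra_simps)
    finally have z: "z = (y - k * \<beta>) *\<^sub>R B + (w + k * (1 - \<delta>)) *\<^sub>R C + (k * \<delta>) *\<^sub>R D" .
    have sum1: "y - k * \<beta> + (w + k * (1 - \<delta>)) + k * \<delta> = 1"
      using xyw(4) k(2) by (simp add: algebra_simps)
    have "z \<in> convex hull {B, C, D}" unfolding convex_hull_3 mem_Collect_eq
      by (intro exI[of _ "y - k * \<beta>"] exI[of _ "w + k * (1 - \<delta>)"] exI[of _ "k * \<delta>"])
        (use z sum1 le k bd xyw in auto)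
    then show ?thesis by blast
  qed
qed

lemma cross_at_quadrilateral:
  assumes X: "cross_at A B C D"
  shows "convex hull {A, B, C} \<union> convex hull {A, B, D} \<subseteq> convex hull {A, C, D} \<union> convex hull {B, C, D}"
proof -
  have "cross_at A B D C" using cross_at_swap[OF cross_at_rev[OF cross_at_swap[OF X]]] .
  from cross_at_half[OF this] have "convex hull {A, B, D} \<subseteq> convex hull {A, C, D} \<union> convex hull {B, C, D}"
    by (simp add: insert_commute)
  with cross_at_half[OF X] show ?thesis by blast
qed

text \<open>
  Apart from its ends and the crossing point, a diagonal runs through the interiors of the two
  triangles on the other diagonal. Thus whatever crosses a diagonal passes through the crossing
  point or through an interior.
\<close>
lemma cross_at_diagonal:
  fixes A B C D :: "real \<times> real"
  assumes nc: "\<not> collinear {A, C, D}" "\<not> collinear {B, C, D}"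
    and bd: "0 < \<beta>" "\<beta> < 1" "0 < \<delta>" "\<delta> < 1" "(1 - \<beta>) *\<^sub>R A + \<beta> *\<^sub>R B = (1 - \<delta>) *\<^sub>R C + \<delta> *\<^sub>R D"
    and z: "z \<in> closed_segment A B"
  shows "z = A \<or> z = B \<or> z = (1 - \<beta>) *\<^sub>R A + \<beta> *\<^sub>R B \<or>
    z \<in> interior (convex hull {A, C, D}) \<or> z \<in> interior (convex hull {B, C, D})"
proof -
  from z obtain t where t: "0 \<le> t" "t \<le> 1" "z = (1 - t) *\<^sub>R A + t *\<^sub>R B" by (auto simp: closed_segment_def)
  consider "t = 0" | "t = 1" | "t = \<beta>" | "0 < t" "t < \<beta>" | "\<beta> < t" "t < 1" using t by linarith
  then show ?thesis
  proof cases
    case 4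
    define k where "k = t / \<beta>"
    have k: "0 < k" "k < 1" "k * \<beta> = t" using 4 by (auto simp: k_def)
    have "z = (1 - k) *\<^sub>R A + k *\<^sub>R ((1 - \<beta>) *\<^sub>R A + \<beta> *\<^sub>R B)"
      unfolding t(3) k(3)[symmetric] by (simp add: algebra_simps)
    then have "z = (1 - k) *\<^sub>R A + (k * (1 - \<delta>)) *\<^sub>R C + (k * \<delta>) *\<^sub>R D"
      unfolding bd(5) by (simp add: algebra_simps)
    then have "z \<in> interior (convex hull {A, C, D})"
      unfolding interior_triangle[OF nc(1)] using k bd
      by (intro exI[of _ "1 - k"] exI[of _ "k * (1 - \<delta>)"] exI[of _ "k * \<delta>"]) (auto simp: algebra_simps)
    then show ?thesis by simp
  next
    case 5
    define k where "k = (1 - t) / (1 - \<beta>)"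
    have k: "0 < k" "k < 1" "k * (1 - \<beta>) = 1 - t" using 5 bd by (auto simp: k_def)
    then have tk: "t = 1 - k * (1 - \<beta>)" by simp
    have "z = (1 - k) *\<^sub>R B + k *\<^sub>R ((1 - \<beta>) *\<^sub>R A + \<beta> *\<^sub>R B)"
      unfolding t(3) tk by (simp add: algebra_simps)
    then have "z = (1 - k) *\<^sub>R B + (k * (1 - \<delta>)) *\<^sub>R C + (k * \<delta>) *\<^sub>R D"
      unfolding bd(5) by (simp add: algebra_simps)
    then have "z \<in> interior (convex hull {B, C, D})"
      unfolding interior_triangle[OF nc(2)] using k bd
      by (intro exI[of _ "1 - k"] exI[of _ "k * (1 - \<delta>)"] exI[of _ "k * \<delta>"]) (auto simp: algebra_simps)
    then show ?thesis by simp
  qed (use t in auto)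
qed

text \<open>Its barycentric coordinate at \<open>A\<close> is negative.\<close>
lemma cross_at_far_vertex:
  fixes A B C D :: "real \<times> real"
  assumes X: "cross_at A B C D" and nc: "\<not> collinear {A, C, D}"
  shows "B \<notin> convex hull {A, C, D}"
proof
  obtain \<beta> \<delta> where bd: "0 < \<beta>" "\<beta> < 1" "0 < \<delta>" "\<delta> < 1"
      "(1 - \<beta>) *\<^sub>R A + \<beta> *\<^sub>R B = (1 - \<delta>) *\<^sub>R C + \<delta> *\<^sub>R D" using X unfolding cross_at_def by blast
  assume "B \<in> convex hull {A, C, D}"
  then obtain x y w where q: "0 \<le> x" "x + y + w = 1" "B = x *\<^sub>R A + y *\<^sub>R C + w *\<^sub>R D" unfolding triangle_mem by blast
  have "\<beta> *\<^sub>R B = (\<beta> * x) *\<^sub>R A + (\<beta> * y) *\<^sub>R C + (\<beta> * w) *\<^sub>R D" unfolding q(3) by (simp add: scaleR_add_right)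
  then have eq: "0 *\<^sub>R A + (1 - \<delta>) *\<^sub>R C + \<delta> *\<^sub>R D = (1 - \<beta> + \<beta> * x) *\<^sub>R A + (\<beta> * y) *\<^sub>R C + (\<beta> * w) *\<^sub>R D"
    using bd(5) by (simp add: scaleR_add_left add_ac)
  have "1 - \<beta> + \<beta> * x + \<beta> * y + \<beta> * w = 1 - \<beta> + \<beta> * (x + y + w)" by (simp add: algebra_simps)
  then have "1 - \<beta> + \<beta> * x + \<beta> * y + \<beta> * w = 1" using q(2) by simp
  from barycentric_unique(1)[OF nc eq _ this] have "1 - \<beta> + \<beta> * x = 0" by simp
  moreover have "0 \<le> \<beta> * x" using bd(1) q(1) by simp
  ultimately show False using bd(2) by linarith
qed

section \<open>Flips\<close>

text \<open>The two faces share exactly the two endpoints of the flipped edge.\<close>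
lemma flips_toE:
  assumes \<sigma>: "\<sigma> \<subseteq> edges m n" and f: "flips_to \<sigma> e e'"
  obtains a b c d where "e = {a, b}" "e' = {c, d}" "{a, b, c} \<in> triangles \<sigma>" "{a, b, d} \<in> triangles \<sigma>"
    "c \<noteq> d" "convex_quadrilateral {a, b, c} {a, b, d}" "a \<noteq> b" "c \<notin> {a, b}" "d \<notin> {a, b}"
proof -
  from f obtain s t where e: "e \<in> \<sigma>" and st: "s \<in> triangles \<sigma>" "t \<in> triangles \<sigma>" "s \<noteq> t" "e \<subseteq> s" "e \<subseteq> t"
      "convex_quadrilateral s t" "e' = (s \<union> t) - e" unfolding flips_to_def by blast
  have "e \<in> edges m n" using e \<sigma> by blast
  from edge_pair[OF this] obtain a b where ab: "e = {a, b}" "a \<noteq> b" by auto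
  have third: "\<exists>x. r = {a, b, x} \<and> x \<notin> {a, b}" if r: "r \<in> triangles \<sigma>" "e \<subseteq> r" for r
  proof -
    have c3: "card r = 3" using r(1) by (simp add: triangles_def)
    have "card (r - {a, b}) = card r - card {a, b}" by (rule card_Diff_subset) (use r ab in auto)
    then have "card (r - {a, b}) = 1" using c3 ab(2) by simp
    then obtain x where "r - {a, b} = {x}" by (rule card_1_singletonE)
    then have "r = {a, b, x}" "x \<notin> {a, b}" using r(2) ab(1) by blast+
    then show ?thesis by blast
  qed
  obtain c where c: "s = {a, b, c}" "c \<notin> {a, b}" using third[OF st(1,4)] by blast
  obtain d where d: "t = {a, b, d}" "d \<notin> {a, b}" using third[OF st(2,5)] by blast
  show thesis
  proof (rule that)
    show "e' = {c, d}" using st(7) c d ab by auto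
    show "c \<noteq> d" using st(3) c d by auto
  qed (use ab c d st in auto)
qed

text \<open>
  The line through \<open>c\<close> and \<open>d\<close> meets the line through \<open>a\<close> and
  \<open>b\<close> in a point \<open>p\<close> between \<open>c\<close> and \<open>d\<close>, since
  these lie on different sides. By convexity \<open>p\<close> belongs to the quadrilateral, hence
  lies between \<open>a\<close> and \<open>b\<close>; it is neither of them, because they are
  extreme points.
\<close>
lemma flips_to_cross:
  assumes \<sigma>: "\<sigma> \<in> Omega m n" and s: "{a, b, c} \<in> triangles \<sigma>" and t: "{a, b, d} \<in> triangles \<sigma>" and cd: "c \<noteq> d"
    and Q: "convex_quadrilateral {a, b, c} {a, b, d}"
  shows "cross_at (pt a) (pt b) (pt c) (pt d)"
proof -
  let ?K1 = "convex hull {pt a, pt b, pt c}" and ?K2 = "convex hull {pt a, pt b, pt d}"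
  note \<sigma>E = OmegaD(1)[OF \<sigma>]
  note nc1 = triangle_not_collinear[OF \<sigma>E s] and nc2 = triangle_not_collinear[OF \<sigma>E t]
  have conv: "convex (?K1 \<union> ?K2)" and ext: "\<And>v. v \<in> {a, b, c, d} \<Longrightarrow> pt v extreme_point_of (?K1 \<union> ?K2)"
    using Q unfolding convex_quadrilateral_def Let_def by auto
  obtain x y w where xyw: "x + y + w = 1" "w < 0" "pt d = x *\<^sub>R pt a + y *\<^sub>R pt b + w *\<^sub>R pt c"
    using apex_opposite[OF \<sigma> s t cd] by blast
  \<comment> \<open>Chosen so that the coordinate of \<open>p\<close> at \<open>c\<close> vanishes.\<close>
  define \<delta> where "\<delta> = 1 / (1 - w)"
  have \<delta>: "0 < \<delta>" "\<delta> < 1" using xyw(2) by (auto simp: \<delta>_def)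
  have \<delta>w: "\<delta> * w = \<delta> - 1" using xyw(2) by (simp add: \<delta>_def field_simps)
  define p where "p = (1 - \<delta>) *\<^sub>R pt c + \<delta> *\<^sub>R pt d"
  have p: "p = (\<delta> * x) *\<^sub>R pt a + (\<delta> * y) *\<^sub>R pt b + (1 - \<delta> + \<delta> * w) *\<^sub>R pt c"
    unfolding p_def xyw(3) by (simp add: algebra_simps)
  then have p': "p = (\<delta> * x) *\<^sub>R pt a + (\<delta> * y) *\<^sub>R pt b" by (simp add: \<delta>w)
  have "\<delta> * x + \<delta> * y + \<delta> * w = \<delta>" using xyw(1) by (simp flip: distrib_left)
  then have s1: "\<delta> * x + \<delta> * y = 1" using \<delta>w by simp
  have cQ: "pt c \<in> ?K1 \<union> ?K2" "pt d \<in> ?K1 \<union> ?K2" by (auto intro: hull_inc)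
  have pcd: "p \<in> closed_segment (pt c) (pt d)" unfolding p_def closed_segment_def using \<delta> by auto
  then have "p \<in> ?K1 \<union> ?K2" using closed_segment_subset[OF cQ conv] by blast
  then have nonneg: "0 \<le> \<delta> * x \<and> 0 \<le> \<delta> * y"
  proof
    assume "p \<in> ?K1"
    then obtain x' y' w' where q: "0 \<le> x'" "0 \<le> y'" "x' + y' + w' = 1" "p = x' *\<^sub>R pt a + y' *\<^sub>R pt b + w' *\<^sub>R pt c"
      unfolding triangle_mem by blast
    have "(\<delta> * x) *\<^sub>R pt a + (\<delta> * y) *\<^sub>R pt b + 0 *\<^sub>R pt c = x' *\<^sub>R pt a + y' *\<^sub>R pt b + w' *\<^sub>R pt c"
      using p' q by simp
    from barycentric_unique[OF nc1 this] q s1 show ?thesis by simp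
  next
    assume "p \<in> ?K2"
    then obtain x' y' w' where q: "0 \<le> x'" "0 \<le> y'" "x' + y' + w' = 1" "p = x' *\<^sub>R pt a + y' *\<^sub>R pt b + w' *\<^sub>R pt d"
      unfolding triangle_mem by blast
    have "(\<delta> * x) *\<^sub>R pt a + (\<delta> * y) *\<^sub>R pt b + 0 *\<^sub>R pt d = x' *\<^sub>R pt a + y' *\<^sub>R pt b + w' *\<^sub>R pt d"
      using p' q by simp
    from barycentric_unique[OF nc2 this] q s1 show ?thesis by simp
  qed
  have popen: "p \<in> open_segment (pt c) (pt d)"
    unfolding p_def in_segment using \<delta> cd by auto
  have not_vertex: "p \<noteq> pt v" if "v \<in> {a, b}" for v
    using ext[of v] cQ popen that unfolding extreme_point_of_def by blast
  have na: "p \<noteq> pt a" "p \<noteq> pt b" using not_vertex by blast+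
  have "\<delta> * x \<noteq> 0"
  proof
    assume z: "\<delta> * x = 0"
    then have "\<delta> * y = 1" using s1 by linarith
    then show False using p' z na(2) by simp
  qed
  moreover have "\<delta> * y \<noteq> 0"
  proof
    assume z: "\<delta> * y = 0"
    then have "\<delta> * x = 1" using s1 by linarith
    then show False using p' z na(1) by simp
  qed
  ultimately have pos: "0 < \<delta> * x" "0 < \<delta> * y"
    using nonneg by (metis order_less_le)+
  have "(1 - \<delta> * y) *\<^sub>R pt a + (\<delta> * y) *\<^sub>R pt b = (1 - \<delta>) *\<^sub>R pt c + \<delta> *\<^sub>R pt d"
    using p' s1 p_def by (metis add_diff_cancel_right')
  then show ?thesis unfolding cross_at_def using pos s1 \<delta>
    by (intro exI[of _ "\<delta> * y"] exI[of _ \<delta>]) auto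
qed

text \<open>
  An edge lies in at most two faces: of three apexes, any two would be on different sides of the
  edge.
\<close>
lemma flips_to_unique:
  assumes \<sigma>: "\<sigma> \<in> Omega m n" and f: "flips_to \<sigma> e e1" "flips_to \<sigma> e e2"
  shows "e1 = e2"
proof -
  obtain a b c d where 1: "e = {a, b}" "e1 = {c, d}" "{a, b, c} \<in> triangles \<sigma>" "{a, b, d} \<in> triangles \<sigma>" "c \<noteq> d"
    using flips_toE[OF OmegaD(1)[OF \<sigma>] f(1)] by metis
  obtain a' b' c' d' where 2: "e = {a', b'}" "e2 = {c', d'}" "{a', b', c'} \<in> triangles \<sigma>" "{a', b', d'} \<in> triangles \<sigma>" "c' \<noteq> d'"
    using flips_toE[OF OmegaD(1)[OF \<sigma>] f(2)] by metis
  have "{a', b', x} = {a, b, x}" for x using 1(1) 2(1) by auto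
  then have 3: "{a, b, c'} \<in> triangles \<sigma>" "{a, b, d'} \<in> triangles \<sigma>" using 2 by auto
  note nc = triangle_not_collinear[OF OmegaD(1)[OF \<sigma>] 1(3)]
  have two: "x \<in> {c, d}" if x: "{a, b, x} \<in> triangles \<sigma>" for x
  proof (rule ccontr)
    assume ne: "x \<notin> {c, d}"
    obtain x1 y1 w1 where d1: "x1 + y1 + w1 = 1" "w1 < 0" "pt d = x1 *\<^sub>R pt a + y1 *\<^sub>R pt b + w1 *\<^sub>R pt c"
      using apex_opposite[OF \<sigma> 1(3,4,5)] by blast
    obtain x2 y2 w2 where d2: "x2 + y2 + w2 = 1" "w2 < 0" "pt x = x2 *\<^sub>R pt a + y2 *\<^sub>R pt b + w2 *\<^sub>R pt c"
      using apex_opposite[OF \<sigma> 1(3) x] ne by blast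
    obtain x3 y3 w3 where d3: "x3 + y3 + w3 = 1" "w3 < 0" "pt d = x3 *\<^sub>R pt a + y3 *\<^sub>R pt b + w3 *\<^sub>R pt x"
      using apex_opposite[OF \<sigma> x 1(4)] ne by blast
    have eq: "x1 *\<^sub>R pt a + y1 *\<^sub>R pt b + w1 *\<^sub>R pt c =
        (x3 + w3 * x2) *\<^sub>R pt a + (y3 + w3 * y2) *\<^sub>R pt b + (w3 * w2) *\<^sub>R pt c"
      unfolding d1(3)[symmetric] d3(3) d2(3) by (simp add: algebra_simps)
    have "x3 + w3 * x2 + (y3 + w3 * y2) + w3 * w2 = x3 + y3 + w3 * (x2 + y2 + w2)" by (simp add: algebra_simps)
    then have "x3 + w3 * x2 + (y3 + w3 * y2) + w3 * w2 = 1" using d2(1) d3(1) by simp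
    from barycentric_unique(3)[OF nc eq d1(1) this] have "w1 = w3 * w2" .
    moreover have "0 < w3 * w2" using d2(2) d3(2) by (simp add: mult_neg_neg)
    ultimately show False using d1(2) by simp
  qed
  have "c' \<in> {c, d}" "d' \<in> {c, d}" using two 3 by blast+
  then show ?thesis using 1 2 by auto
qed

text \<open>
  Let the diagonal \<open>e = {a, b}\<close> of the quadrilateral be replaced by
  \<open>e' = {c, d}\<close>. The new triangles cover the same quadrilateral, so they contain no
  lattice points besides their vertices. An old edge crossing \<open>e'\<close> would meet the
  interior of an old face or the crossing point of the diagonals, which is excluded. Conversely an
  edge that is compatible with the new family but not in it must cross \<open>e\<close>, by
  maximality of the old family, hence meets the interior of a new triangle or that crossing point,
  which is excluded too. Therefore the new family is a triangulation, the new triangles are faces of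
  it, and flipping \<open>e'\<close> leads back.
\<close>
lemma flip_reversible:
  assumes \<sigma>: "\<sigma> \<in> Omega m n" and f: "flips_to \<sigma> e e'"
  shows "e \<in> \<sigma>" "e' \<notin> \<sigma>" "insert e' (\<sigma> - {e}) \<in> Omega m n" "flips_to (insert e' (\<sigma> - {e})) e' e"
proof -
  note \<sigma>E = OmegaD(1)[OF \<sigma>] and \<sigma>N = OmegaD(2)[OF \<sigma>]
  show e\<sigma>: "e \<in> \<sigma>" using f by (simp add: flips_to_def)
  obtain a b c d where ab: "e = {a, b}" and cd: "e' = {c, d}" and s: "{a, b, c} \<in> triangles \<sigma>"
    and t: "{a, b, d} \<in> triangles \<sigma>" and ne: "c \<noteq> d" "a \<noteq> b" "c \<notin> {a, b}" "d \<notin> {a, b}"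
    and Q: "convex_quadrilateral {a, b, c} {a, b, d}"
    using flips_toE[OF \<sigma>E f] by metis
  define A B C D where "A = pt a" and "B = pt b" and "C = pt c" and "D = pt d"
  note P = A_def B_def C_def D_def
  note trs = triangle_edges[OF s] and trt = triangle_edges[OF t]
  have nc: "\<not> collinear {A, B, C}" "\<not> collinear {A, B, D}"
    using triangle_not_collinear[OF \<sigma>E s] triangle_not_collinear[OF \<sigma>E t] by (simp_all add: P)
  have X: "cross_at A B C D" using flips_to_cross[OF \<sigma> s t ne(1) Q] by (simp add: P)
  then obtain \<beta> \<delta> where bd: "0 < \<beta>" "\<beta> < 1" "0 < \<delta>" "\<delta> < 1"
      "(1 - \<beta>) *\<^sub>R A + \<beta> *\<^sub>R B = (1 - \<delta>) *\<^sub>R C + \<delta> *\<^sub>R D" unfolding cross_at_def by blast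
  define p where "p = (1 - \<beta>) *\<^sub>R A + \<beta> *\<^sub>R B"
  have p: "p = (1 - \<delta>) *\<^sub>R C + \<delta> *\<^sub>R D" by (simp add: p_def bd(5))
  have pe: "p \<in> seg e" "p \<in> seg e'"
    using bd(1-4) unfolding ab cd seg_pair P[symmetric] closed_segment_def by (auto simp: p_def) (auto simp: p[unfolded p_def])
  have disj: "{a, b} \<inter> {c, d} = {}" using ne by auto
  have nc34: "\<not> collinear {A, C, D}" "\<not> collinear {B, C, D}"
    using cross_at_not_collinear[OF X nc(1)] cross_at_not_collinear[OF cross_at_rev[OF X]] nc(1)
    by (auto simp: insert_commute)
  show e'\<sigma>: "e' \<notin> \<sigma>"
  proof
    assume "e' \<in> \<sigma>"
    moreover have "e \<noteq> e'" using disj ab cd by auto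
    ultimately have "p \<in> pt ` (e \<inter> e')" using noncrossingD[OF \<sigma>N e\<sigma>] pe by blast
    then show False using disj ab cd by auto
  qed
  let ?K1 = "convex hull {A, B, C}" and ?K2 = "convex hull {A, B, D}"
  let ?K3 = "convex hull {A, C, D}" and ?K4 = "convex hull {B, C, D}"
  have conv: "convex (?K1 \<union> ?K2)" using Q by (auto simp: convex_quadrilateral_def Let_def P)
  have Qeq: "?K3 \<union> ?K4 = ?K1 \<union> ?K2"
  proof
    have "{A, B, C, D} \<subseteq> ?K1 \<union> ?K2" by (auto intro: hull_inc)
    then show "?K3 \<union> ?K4 \<subseteq> ?K1 \<union> ?K2" using conv by (intro Un_least hull_minimal) auto
    show "?K1 \<union> ?K2 \<subseteq> ?K3 \<union> ?K4" by (rule cross_at_quadrilateral[OF X])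
  qed
  have empty12: "v \<in> {a, b, c, d}" if "pt v \<in> ?K1 \<union> ?K2" for v
    using triangle_empty[OF \<sigma> s, of v] triangle_empty[OF \<sigma> t, of v] that by (auto simp: P)
  have far: "B \<notin> ?K3" "A \<notin> ?K4"
    using cross_at_far_vertex[OF X nc34(1)] cross_at_far_vertex[OF cross_at_rev[OF X] nc34(2)] by auto
  have empty3: "v \<in> {a, c, d}" if "pt v \<in> convex hull {pt a, pt c, pt d}" for v
    using empty12[of v] that far(1) Qeq by (auto simp: P)
  have empty4: "v \<in> {b, c, d}" if "pt v \<in> convex hull {pt b, pt c, pt d}" for v
    using empty12[of v] that far(2) Qeq by (auto simp: P)
  define T where "T = insert e' (\<sigma> - {e})"
  have sides: "{a, c} \<in> T" "{b, c} \<in> T" "{a, d} \<in> T" "{b, d} \<in> T" "{c, d} \<in> T"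
    using trs trt ne unfolding T_def ab cd by (auto simp: doubleton_eq_iff)
  have ed: "{a, b} \<in> edges m n" "{b, c} \<in> edges m n" "{a, d} \<in> edges m n" using trs trt \<sigma>E by auto
  have L: "c \<in> Lambda0 m n" "d \<in> Lambda0 m n" using edge_subset[OF ed(2)] edge_subset[OF ed(3)] by auto
  have e'_edge: "e' \<in> edges m n"
  proof -
    have "seg {c, d} \<inter> range pt \<subseteq> {pt c, pt d}"
    proof
      fix z assume z: "z \<in> seg {c, d} \<inter> range pt"
      then obtain v where v: "z = pt v" by blast
      have vs: "pt v \<in> closed_segment C D" using z v by (simp add: seg_pair P)
      have "closed_segment C D \<subseteq> ?K3" by (rule closed_segment_subset) (auto intro: hull_inc)
      then have "pt v \<in> ?K3" using vs by blast
      then have "v \<in> {a, c, d}" using empty3[of v] by (simp add: P)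
      moreover have "v \<noteq> a"
      proof
        assume "v = a"
        then have "between (C, D) A" using vs by (simp add: between_mem_segment P)
        then have "collinear {A, C, D}" unfolding collinear_between_cases by blast
        then show False using nc34(1) by simp
      qed
      ultimately show "z \<in> {pt c, pt d}" using v by auto
    qed
    then have "seg {c, d} \<inter> range pt = {pt c, pt d}" by (auto simp: seg_pair)
    then show ?thesis unfolding cd edges_def using L ne(1) by blast
  qed
  have e'_miss: "\<not> crossing e' f" if f: "f \<in> \<sigma>" "f \<noteq> e" for f
  proof
    assume "crossing e' f"
    then obtain z where z: "z \<in> seg e'" "z \<in> seg f" "z \<notin> pt ` (e' \<inter> f)" unfolding crossing_def by blast
    have nc': "\<not> collinear {C, A, B}" "\<not> collinear {D, A, B}" using nc by (auto simp: insert_commute)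
    have "z \<in> closed_segment C D" using z(1) by (simp add: cd seg_pair P)
    from cross_at_diagonal[OF nc' bd(3,4,1,2) bd(5)[symmetric] this]
    consider "z = C" | "z = D" | "z = p" | "z \<in> interior ?K1" | "z \<in> interior ?K2"
      unfolding p by (auto simp: insert_commute)
    then show False
    proof cases
      case 1 then show False using edge_lattice_point[of f m n c] z f \<sigma>E by (auto simp: P cd)
    next
      case 2 then show False using edge_lattice_point[of f m n d] z f \<sigma>E by (auto simp: P cd)
    next
      case 3
      then have "p \<in> pt ` (f \<inter> e)" using noncrossingD[OF \<sigma>N f(1) e\<sigma> f(2)] pe(1) z(2) by blast
      then obtain v where v: "v \<in> {a, b}" "p = pt v" using ab by auto
      then have "p = A \<or> p = B" by (auto simp: P)
      moreover have "p \<noteq> A" "p \<noteq> B"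
      proof -
        have "A \<noteq> B" using ne by (simp add: P)
        have "p - A = \<beta> *\<^sub>R (B - A)" "p - B = (1 - \<beta>) *\<^sub>R (A - B)" by (simp_all add: p_def algebra_simps)
        then show "p \<noteq> A" "p \<noteq> B" using \<open>A \<noteq> B\<close> bd by auto
      qed
      ultimately show False by blast
    next
      case 4 then show False using trs(7)[OF f(1)] z(2) by (auto simp: P)
    next
      case 5 then show False using trt(7)[OF f(1)] z(2) by (auto simp: P)
    qed
  qed
  have TE: "T \<subseteq> edges m n" using \<sigma>E e'_edge by (auto simp: T_def)
  have TN: "noncrossing T"
    unfolding noncrossing_def
  proof (intro ballI)
    fix f g assume "f \<in> T" "g \<in> T"
    moreover have "\<not> crossing f g" if "f \<in> \<sigma>" "g \<in> \<sigma>" for f g using \<sigma>N that by (auto simp: noncrossing_def)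
    moreover have "\<not> crossing e' e'" by (simp add: crossing_def)
    ultimately show "\<not> crossing f g"
      using e'_miss crossing_sym unfolding T_def by (metis Diff_iff insert_iff singletonI)
  qed
  have miss: "seg f \<inter> interior (convex hull {pt x, C, D}) = {}"
    if x: "x \<in> {a, b}" and S: "noncrossing S" "S \<subseteq> edges m n" "T \<subseteq> S" "f \<in> S" for x S f
  proof -
    have "f \<in> edges m n" using S by blast
    from edge_pair[OF this] obtain y z where yz: "f = {y, z}" "y \<noteq> z" by auto
    have xab: "x = a \<or> x = b" using x by simp
    show ?thesis unfolding yz(1) C_def D_def
    proof (rule empty_triangle_not_met[OF S(1)])
      have "{x, c} \<in> T" "{x, d} \<in> T" using xab sides(1-4) by (elim disjE; simp)+
      then show "{x, c} \<in> S" "{c, d} \<in> S" "{x, d} \<in> S" using sides(5) S(3) by blast+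
      show "\<not> collinear {pt x, pt c, pt d}"
        using xab nc34 unfolding P by (elim disjE) simp_all
      show "v \<in> {x, c, d}" if "pt v \<in> convex hull {pt x, pt c, pt d}" for v
        using xab empty3[of v] empty4[of v] that by (elim disjE) simp_all
      show "{y, z} \<in> S" "y \<noteq> z" using yz S(4) by simp_all
    qed
  qed
  \<comment> \<open>The larger family \<open>S\<close> is arbitrary, as the maximality in
      \<open>Omega\<close> requires.\<close>
  have maximal: "g \<in> T" if S: "noncrossing S" "S \<subseteq> edges m n" "T \<subseteq> S" and g: "g \<in> S" for S g
  proof (rule ccontr)
    assume gT: "g \<notin> T"
    have gE: "g \<in> edges m n" using S g by blast
    have e'S: "e' \<in> S" using S(3) by (auto simp: T_def)
    have "e \<notin> S"
    proof
      assume "e \<in> S"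
      moreover have "e \<noteq> e'" using e\<sigma> e'\<sigma> by blast
      ultimately have "p \<in> pt ` (e \<inter> e')" using noncrossingD[OF S(1) _ e'S] pe by blast
      then show False using disj ab cd by auto
    qed
    then have "g \<notin> \<sigma>" using gT g unfolding T_def by blast
    then obtain f where f: "f \<in> \<sigma>" "crossing g f" using Omega_maximal[OF \<sigma> gE] by blast
    have "f = e"
    proof (rule ccontr)
      assume "f \<noteq> e"
      then have "f \<in> S" using f(1) S(3) by (auto simp: T_def)
      then show False using f(2) S(1) g by (auto simp: noncrossing_def)
    qed
    with f(2) obtain z where z: "z \<in> seg g" "z \<in> seg e" "z \<notin> pt ` (g \<inter> e)" unfolding crossing_def by blast
    have "z \<in> closed_segment A B" using z(2) by (simp add: ab seg_pair P)
    from cross_at_diagonal[OF nc34 bd this]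
    consider "z = A" | "z = B" | "z = p" | "z \<in> interior ?K3" | "z \<in> interior ?K4" unfolding p_def by blast
    then show False
    proof cases
      case 1 then show False using edge_lattice_point[OF gE, of a] z by (auto simp: P ab)
    next
      case 2 then show False using edge_lattice_point[OF gE, of b] z by (auto simp: P ab)
    next
      case 3
      have "g \<noteq> e'" using gT by (auto simp: T_def)
      then have "p \<in> pt ` (g \<inter> e')" using noncrossingD[OF S(1) g e'S] pe(2) z(1) 3 by blast
      then obtain v where v: "v \<in> {c, d}" "p = pt v" using cd by auto
      then have "p = C \<or> p = D" by (auto simp: P)
      moreover have "p \<noteq> C" "p \<noteq> D"
      proof -
        have "C \<noteq> D" using ne by (simp add: P)
        have "p - C = \<delta> *\<^sub>R (D - C)" "p - D = (1 - \<delta>) *\<^sub>R (C - D)" by (simp_all add: p algebra_simps)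
        then show "p \<noteq> C" "p \<noteq> D" using \<open>C \<noteq> D\<close> bd by auto
      qed
      ultimately show False by blast
    next
      case 4 then show False using miss[OF _ S g, of a] z(1) by (auto simp: P)
    next
      case 5 then show False using miss[OF _ S g, of b] z(1) by (auto simp: P)
    qed
  qed
  show "insert e' (\<sigma> - {e}) \<in> Omega m n"
    unfolding T_def[symmetric] Omega_def using TE TN maximal by blast
  have subset2: "r = {x, y} \<or> r = {y, z} \<or> r = {x, z}" if r: "r \<subseteq> {x, y, z}" "card r = 2"
    for r and x y z :: point
  proof -
    obtain u v where "r = {u, v}" "u \<noteq> v" using r(2) by (meson card_2_iff)
    then show ?thesis using r(1) by auto
  qed
  have tri: "{x, c, d} \<in> triangles T" if x: "x \<in> {a, b}" for x
    unfolding triangles_def mem_Collect_eq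
  proof (intro conjI ballI allI impI)
    show "card {x, c, d} = 3" using ne x by auto
    fix r assume "r \<subseteq> {x, c, d} \<and> card r = 2"
    then show "r \<in> T" using subset2[of r x c d] sides x by auto
  next
    fix f assume "f \<in> T"
    then show "seg f \<inter> interior (convex hull (pt ` {x, c, d})) = {}" using miss[OF x TN TE] by (simp add: P)
  qed
  have Q': "convex_quadrilateral {a, c, d} {b, c, d}"
  proof -
    have un: "{a, c, d} \<union> {b, c, d} = {a, b, c} \<union> {a, b, d}" by auto
    have h: "convex hull (pt ` {a, c, d}) \<union> convex hull (pt ` {b, c, d}) =
        convex hull (pt ` {a, b, c}) \<union> convex hull (pt ` {a, b, d})" using Qeq by (simp add: P)
    show ?thesis using Q unfolding convex_quadrilateral_def Let_def un h .
  qed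
  have "flips_to T e' e"
    unfolding flips_to_def
  proof (intro conjI bexI)
    show "e' \<in> T" by (simp add: T_def)
    show "{a, c, d} \<noteq> {b, c, d}" using ne by auto
    show "e' \<subseteq> {a, c, d}" "e' \<subseteq> {b, c, d}" by (auto simp: cd)
    show "e = {a, c, d} \<union> {b, c, d} - e'" using ne by (auto simp: ab cd)
  qed (use Q' tri in auto)
  then show "flips_to (insert e' (\<sigma> - {e})) e' e" by (simp add: T_def)
qed

section \<open>The chain and its reversibility\<close>

lemma finite_Lambda [simp]: "finite (Lambda m n)"
proof -
  have "Lambda m n \<subseteq> (\<lambda>(i, j). (real i / 2, real j / 2)) ` ({..2 * m} \<times> {..2 * n})"
    by (auto simp: Lambda_def)
  then show ?thesis by (rule finite_subset) simp
qed

lemma card_Lambda_le: "card (Lambda m n) \<le> (2 * m + 1) * (2 * n + 1)"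
proof -
  have "Lambda m n \<subseteq> (\<lambda>(i, j). (real i / 2, real j / 2)) ` ({..2 * m} \<times> {..2 * n})"
    by (auto simp: Lambda_def)
  then have "card (Lambda m n) \<le> card ({..2 * m} \<times> {..2 * n})"
    by (rule surj_card_le[rotated]) simp
  then show ?thesis by (simp add: card_cartesian_product)
qed

lemma Lambda_nonempty: "1 \<le> m \<Longrightarrow> Lambda m n \<noteq> {}"
proof -
  assume m: "1 \<le> m"
  have "(1 / 2, 0) \<in> {(real i / 2, real j / 2) | i j. i \<le> 2 * m \<and> j \<le> 2 * n}"
    using m by (auto intro!: exI[of _ "1::nat"] exI[of _ "0::nat"])
  moreover have "(1 / 2, 0) \<notin> pt ` Lambda0 m n"
  proof
    assume "(1 / 2, 0) \<in> pt ` Lambda0 m n"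
    then obtain v where "(1 / 2, 0) = pt v" by blast
    then have "1 / 2 = real_of_int (fst v)" by (simp add: pt_def prod_eq_iff)
    then have "real_of_int (2 * fst v) = real_of_int 1" by simp
    then have "2 * fst v = 1" by (simp only: of_int_eq_iff)
    then show False by presburger
  qed
  ultimately show ?thesis unfolding Lambda_def by blast
qed

text \<open>A lattice point on an edge is an endpoint, and the midpoint is not.\<close>
lemma mid_in_Lambda:
  assumes "e \<in> edges m n"
  shows "mid e \<in> Lambda m n"
proof -
  from edge_pair[OF assms] obtain u v where e: "e = {u, v}" "u \<noteq> v" by auto
  have L: "u \<in> Lambda0 m n" "v \<in> Lambda0 m n" using edge_subset[OF assms] e by auto
  have r: "0 \<le> fst u + fst v" "fst u + fst v \<le> 2 * int m" "0 \<le> snd u + snd v" "snd u + snd v \<le> 2 * int n"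
    using L by (auto simp: Lambda0_def mem_Times_iff)
  have mid: "mid e = (real (nat (fst u + fst v)) / 2, real (nat (snd u + snd v)) / 2)"
    using r by (simp add: e mid_pair)
  have "mid e \<notin> pt ` Lambda0 m n"
  proof
    assume "mid e \<in> pt ` Lambda0 m n"
    then obtain w where w: "mid e = pt w" by blast
    then have "pt w \<in> seg e" using mid_in_seg[OF e(2)] e(1) by simp
    then have "w \<in> e" by (rule edge_lattice_point[OF assms])
    moreover have "2 * fst w = fst u + fst v" "2 * snd w = snd u + snd v"
    proof -
      have "pt w = (real_of_int (fst u + fst v) / 2, real_of_int (snd u + snd v) / 2)"
        using w mid_pair[OF e(2)] e(1) by simp
      then have "real_of_int (2 * fst w) = real_of_int (fst u + fst v)" "real_of_int (2 * snd w) = real_of_int (snd u + snd v)"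
        by (simp_all add: pt_def prod_eq_iff)
      then show "2 * fst w = fst u + fst v" "2 * snd w = snd u + snd v" by (simp_all only: of_int_eq_iff)
    qed
    ultimately show False using e by (auto simp: prod_eq_iff)
  qed
  moreover have "nat (fst u + fst v) \<le> 2 * m" "nat (snd u + snd v) \<le> 2 * n" using r by auto
  ultimately show ?thesis unfolding Lambda_def mid by blast
qed

text \<open>
  The value of \<open>edge_at\<close> at a point that is not the midpoint of an edge. It is an
  unspecified set, possibly an edge.
\<close>
definition no_edge :: edge where
  "no_edge = (THE e. False)"

lemma edge_at_mid:
  assumes "\<sigma> \<in> Omega m n" "e \<in> \<sigma>"
  shows "edge_at \<sigma> (mid e) = e"
  unfolding edge_at_def
  by (rule the_equality) (use assms inj_onD[OF inj_on_mid[OF OmegaD(2,1)[OF assms(1)]]] in auto)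

lemma edge_at_empty:
  assumes "z \<notin> mid ` \<sigma>"
  shows "edge_at \<sigma> z = no_edge"
proof -
  have "(\<lambda>e. e \<in> \<sigma> \<and> mid e = z) = (\<lambda>e. False)" using assms by auto
  then show ?thesis by (simp add: edge_at_def no_edge_def)
qed

text \<open>
  The number of points \<open>x\<close> at which the chain selects \<open>e\<close>: the midpoint of
  \<open>e\<close>, and also all points that are not midpoints in case \<open>e\<close> is the
  default value returned there. It depends on \<open>\<sigma>\<close> only through the number of
  edges, which flips preserve.
\<close>
definition multiplicity_at :: "nat \<Rightarrow> nat \<Rightarrow> edge set \<Rightarrow> edge \<Rightarrow> nat" where
  "multiplicity_at m n \<sigma> e = (if e = no_edge then 1 + (card (Lambda m n) - card \<sigma>) else 1)"

lemma card_edge_at: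
  assumes \<sigma>: "\<sigma> \<in> Omega m n" and e: "e \<in> \<sigma>"
  shows "card {z \<in> Lambda m n. edge_at \<sigma> z = e} = multiplicity_at m n \<sigma> e"
proof -
  have sub: "mid ` \<sigma> \<subseteq> Lambda m n" using OmegaD(1)[OF \<sigma>] mid_in_Lambda by blast
  have card_mid: "card (mid ` \<sigma>) = card \<sigma>"
    by (rule card_image[OF inj_on_mid[OF OmegaD(2,1)[OF \<sigma>]]])
  have set_eq: "{z \<in> Lambda m n. edge_at \<sigma> z = e} =
      insert (mid e) (if e = no_edge then Lambda m n - mid ` \<sigma> else {})"
  proof (intro equalityI subsetI)
    fix z assume z: "z \<in> {z \<in> Lambda m n. edge_at \<sigma> z = e}"
    show "z \<in> insert (mid e) (if e = no_edge then Lambda m n - mid ` \<sigma> else {})"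
    proof (cases "z \<in> mid ` \<sigma>")
      case True
      then show ?thesis using z edge_at_mid[OF \<sigma>] by auto
    next
      case False
      then show ?thesis using z edge_at_empty[OF False] by auto
    qed
  next
    fix z assume "z \<in> insert (mid e) (if e = no_edge then Lambda m n - mid ` \<sigma> else {})"
    then show "z \<in> {z \<in> Lambda m n. edge_at \<sigma> z = e}"
      using edge_at_mid[OF \<sigma> e] sub e edge_at_empty[of z \<sigma>] by (auto split: if_splits)
  qed
  have "card (insert (mid e) (Lambda m n - mid ` \<sigma>)) = 1 + (card (Lambda m n) - card \<sigma>)"
    using e sub card_mid by (subst card_insert_disjoint) (auto simp: card_Diff_subset finite_subset)
  then show ?thesis unfolding set_eq multiplicity_at_def by (cases "e = no_edge") auto
qed

definition flip_rate :: "real \<Rightarrow> edge \<Rightarrow> edge \<Rightarrow> real" where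
  "flip_rate lam e e' = lam ^ edge_length e' / (lam ^ edge_length e' + lam ^ edge_length e)"

lemma flipped_eq:
  assumes "\<sigma> \<in> Omega m n" "flips_to \<sigma> e e'"
  shows "flipped \<sigma> e = e'" "flippable \<sigma> e"
proof -
  show "flipped \<sigma> e = e'"
    unfolding flipped_def
  proof (rule the_equality)
    show "flips_to \<sigma> e e'" by (fact assms(2))
    show "x = e'" if "flips_to \<sigma> e x" for x by (rule flips_to_unique[OF assms(1) that assms(2)])
  qed
  show "flippable \<sigma> e" unfolding flippable_def using assms(2) by (rule exI)
qed

lemma flip_rate_bounds:
  assumes "lam > 1"
  shows "0 \<le> flip_rate lam e e'" "flip_rate lam e e' \<le> 1"
proof -
  have "0 < lam ^ edge_length e'" "0 < lam ^ edge_length e" using assms by simp_all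
  then show "0 \<le> flip_rate lam e e'" "flip_rate lam e e' \<le> 1" by (auto simp: flip_rate_def divide_simps)
qed

lemma pmf_bernoulli_choice:
  assumes "0 \<le> p" "p \<le> 1" "y \<noteq> s"
  shows "pmf (map_pmf (\<lambda>b. if b then t else s) (bernoulli_pmf p)) y = (if y = t then p else 0)"
proof -
  have "(\<lambda>b. if b then t else s) -` {y} = (if y = t then {True} else {})"
    using assms(3) by (auto split: if_splits)
  then show ?thesis using assms by (simp add: pmf_map measure_pmf_single)
qed

lemma pmf_glauber_step:
  assumes lam: "lam > 1" and m: "1 \<le> m" and y: "y \<noteq> \<sigma>"
  shows "pmf (glauber_step lam m n \<sigma>) y =
    (\<Sum>z\<in>Lambda m n. if flippable \<sigma> (edge_at \<sigma> z) \<and> y = insert (flipped \<sigma> (edge_at \<sigma> z)) (\<sigma> - {edge_at \<sigma> z})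
       then flip_rate lam (edge_at \<sigma> z) (flipped \<sigma> (edge_at \<sigma> z)) else 0) / real (card (Lambda m n))"
proof -
  have "pmf (let e = edge_at \<sigma> z; e' = flipped \<sigma> e in
       if flippable \<sigma> e then
         map_pmf (\<lambda>b. if b then insert e' (\<sigma> - {e}) else \<sigma>)
           (bernoulli_pmf (lam ^ edge_length e' / (lam ^ edge_length e' + lam ^ edge_length e)))
       else return_pmf \<sigma>) y =
    (if flippable \<sigma> (edge_at \<sigma> z) \<and> y = insert (flipped \<sigma> (edge_at \<sigma> z)) (\<sigma> - {edge_at \<sigma> z})
       then flip_rate lam (edge_at \<sigma> z) (flipped \<sigma> (edge_at \<sigma> z)) else 0)" for z
    using y flip_rate_bounds[OF lam, of "edge_at \<sigma> z" "flipped \<sigma> (edge_at \<sigma> z)"]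
    unfolding Let_def flip_rate_def[symmetric]
    by (cases "flippable \<sigma> (edge_at \<sigma> z)") (simp_all add: pmf_bernoulli_choice)
  then show ?thesis
    unfolding glauber_step_def
    by (simp add: pmf_bind_pmf_of_set[OF Lambda_nonempty[OF m]])
qed

text \<open>
  Since \<open>e'\<close> is not in \<open>\<sigma>\<close>, the new state determines the edge that
  was removed, so the only contributions come from points that select \<open>e\<close>.
\<close>
lemma step_flip_prob:
  assumes lam: "lam > 1" and m: "1 \<le> m" and \<sigma>: "\<sigma> \<in> Omega m n" and f: "flips_to \<sigma> e e'"
  shows "pmf (glauber_step lam m n \<sigma>) (insert e' (\<sigma> - {e})) =
    real (multiplicity_at m n \<sigma> e) * flip_rate lam e e' / real (card (Lambda m n))"
proof -
  note r = flip_reversible[OF \<sigma> f]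
  let ?y = "insert e' (\<sigma> - {e})"
  have ne: "?y \<noteq> \<sigma>" using r(2) by blast
  have cond: "(flippable \<sigma> g \<and> ?y = insert (flipped \<sigma> g) (\<sigma> - {g})) \<longleftrightarrow> g = e" for g
  proof
    assume g: "flippable \<sigma> g \<and> ?y = insert (flipped \<sigma> g) (\<sigma> - {g})"
    then obtain g' where g': "flips_to \<sigma> g g'" by (auto simp: flippable_def)
    note rg = flip_reversible[OF \<sigma> g']
    have y: "?y = insert g' (\<sigma> - {g})" using g unfolding flipped_eq(1)[OF \<sigma> g'] by (rule conjunct2)
    have "g \<noteq> g'" using rg(1,2) by auto
    then have "g \<notin> insert g' (\<sigma> - {g})" by simp
    then have "g \<notin> ?y" unfolding y .
    then show "g = e" using rg(1) by simp
  next
    assume "g = e"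
    then show "flippable \<sigma> g \<and> ?y = insert (flipped \<sigma> g) (\<sigma> - {g})" using flipped_eq[OF \<sigma> f] by simp
  qed
  have "(\<Sum>z\<in>Lambda m n. if flippable \<sigma> (edge_at \<sigma> z) \<and> ?y = insert (flipped \<sigma> (edge_at \<sigma> z)) (\<sigma> - {edge_at \<sigma> z})
       then flip_rate lam (edge_at \<sigma> z) (flipped \<sigma> (edge_at \<sigma> z)) else 0) =
     (\<Sum>z\<in>Lambda m n. if edge_at \<sigma> z = e then flip_rate lam e e' else 0)"
    unfolding cond using flipped_eq(1)[OF \<sigma> f] by (intro sum.cong) auto
  also have "\<dots> = (\<Sum>z\<in>{z \<in> Lambda m n. edge_at \<sigma> z = e}. flip_rate lam e e')"
    by (subst sum.inter_filter) auto
  also have "\<dots> = real (multiplicity_at m n \<sigma> e) * flip_rate lam e e'"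
    by (simp add: card_edge_at[OF \<sigma> r(1)])
  finally show ?thesis using pmf_glauber_step[OF lam m ne] by simp
qed

lemma step_support:
  assumes lam: "lam > 1" and m: "1 \<le> m" and \<sigma>: "\<sigma> \<in> Omega m n"
    and y: "y \<in> set_pmf (glauber_step lam m n \<sigma>)" "y \<noteq> \<sigma>"
  obtains e e' where "flips_to \<sigma> e e'" "y = insert e' (\<sigma> - {e})"
proof -
  have "pmf (glauber_step lam m n \<sigma>) y \<noteq> 0" using y(1) by (simp add: set_pmf_iff)
  then have "(\<Sum>z\<in>Lambda m n. if flippable \<sigma> (edge_at \<sigma> z) \<and> y = insert (flipped \<sigma> (edge_at \<sigma> z)) (\<sigma> - {edge_at \<sigma> z})
       then flip_rate lam (edge_at \<sigma> z) (flipped \<sigma> (edge_at \<sigma> z)) else 0) \<noteq> 0"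
    unfolding pmf_glauber_step[OF lam m y(2)] by auto
  then obtain z where "(if flippable \<sigma> (edge_at \<sigma> z) \<and> y = insert (flipped \<sigma> (edge_at \<sigma> z)) (\<sigma> - {edge_at \<sigma> z})
       then flip_rate lam (edge_at \<sigma> z) (flipped \<sigma> (edge_at \<sigma> z)) else 0) \<noteq> 0"
    by (rule sum.not_neutral_contains_not_neutral)
  then have z: "flippable \<sigma> (edge_at \<sigma> z)" "y = insert (flipped \<sigma> (edge_at \<sigma> z)) (\<sigma> - {edge_at \<sigma> z})"
    by (auto split: if_splits)
  from z(1) obtain e' where "flips_to \<sigma> (edge_at \<sigma> z) e'" by (auto simp: flippable_def)
  then show thesis using that[of "edge_at \<sigma> z" e'] z(2) flipped_eq(1)[OF \<sigma>] by simp
qed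

lemma step_in_Omega:
  assumes "lam > 1" "1 \<le> m" "\<sigma> \<in> Omega m n"
  shows "set_pmf (glauber_step lam m n \<sigma>) \<subseteq> Omega m n"
proof
  fix y assume y: "y \<in> set_pmf (glauber_step lam m n \<sigma>)"
  show "y \<in> Omega m n"
  proof (cases "y = \<sigma>")
    case False
    then show ?thesis using step_support[OF assms y] flip_reversible(3)[OF assms(3)] by metis
  qed (use assms in simp)
qed

text \<open>
  The Gibbs weight, corrected for a possible multiple selection of \<open>no_edge\<close>, so that
  it satisfies detailed balance exactly. The correction is a factor between \<open>1\<close> and
  \<open>card (Lambda m n) + 1\<close>, negligible on an exponential scale.
\<close>
definition weight :: "real \<Rightarrow> nat \<Rightarrow> nat \<Rightarrow> edge set \<Rightarrow> real" where
  "weight lam m n \<sigma> = lam ^ total_length \<sigma> / (if no_edge \<in> \<sigma> then real (multiplicity_at m n \<sigma> no_edge) else 1)"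

lemma multiplicity_pos: "0 < multiplicity_at m n \<sigma> e"
  by (simp add: multiplicity_at_def)

lemma weight_pos: "lam > 1 \<Longrightarrow> 0 < weight lam m n \<sigma>"
  using multiplicity_pos[of m n \<sigma> no_edge] by (simp add: weight_def)

text \<open>
  The heat-bath rates make \<open>lam ^ total_length \<sigma>\<close> times the rate symmetric.
  Flips preserve the number of edges, and a flip can make the default edge appear or disappear; the
  denominator in \<open>weight\<close> compensates its multiplicity in both directions.
\<close>
lemma flip_detailed_balance:
  assumes lam: "lam > 1" and m: "1 \<le> m" and \<sigma>: "\<sigma> \<in> Omega m n" and f: "flips_to \<sigma> e e'"
  defines "y \<equiv> insert e' (\<sigma> - {e})"
  shows "weight lam m n \<sigma> * pmf (glauber_step lam m n \<sigma>) y = weight lam m n y * pmf (glauber_step lam m n y) \<sigma>"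
proof -
  note r = flip_reversible[OF \<sigma> f, folded y_def]
  have fin: "finite \<sigma>" by (rule Omega_finite[OF \<sigma>])
  have undo: "insert e (y - {e'}) = \<sigma>" using r(1,2) by (auto simp: y_def)
  have P1: "pmf (glauber_step lam m n \<sigma>) y = real (multiplicity_at m n \<sigma> e) * flip_rate lam e e' / real (card (Lambda m n))"
    unfolding y_def by (rule step_flip_prob[OF lam m \<sigma> f])
  have P2: "pmf (glauber_step lam m n y) \<sigma> = real (multiplicity_at m n y e') * flip_rate lam e' e / real (card (Lambda m n))"
    using step_flip_prob[OF lam m r(3,4)] unfolding undo .
  have card_eq: "card y = card \<sigma>"
  proof -
    have "card y = Suc (card (\<sigma> - {e}))"
      unfolding y_def by (rule card_insert_disjoint) (use fin r(2) in auto)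
    then show ?thesis using card_Suc_Diff1[OF fin r(1)] by simp
  qed
  then have mult: "multiplicity_at m n y = multiplicity_at m n \<sigma>" by (simp add: multiplicity_at_def fun_eq_iff)
  have len: "total_length y + edge_length e = total_length \<sigma> + edge_length e'"
  proof -
    have "total_length \<sigma> = edge_length e + (\<Sum>g\<in>\<sigma> - {e}. edge_length g)"
      unfolding total_length_def by (rule sum.remove[OF fin r(1)])
    moreover have "total_length y = edge_length e' + (\<Sum>g\<in>\<sigma> - {e}. edge_length g)"
      unfolding total_length_def y_def by (rule sum.insert) (use fin r in auto)
    ultimately show ?thesis by simp
  qed
  define M where "M = real (multiplicity_at m n \<sigma> no_edge)"
  have M: "0 < M" using multiplicity_pos by (simp add: M_def)
  have ratio: "real (multiplicity_at m n \<sigma> e) / (if no_edge \<in> \<sigma> then M else 1) =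
      real (multiplicity_at m n \<sigma> e') / (if no_edge \<in> y then M else 1)"
  proof -
    have e1: "multiplicity_at m n \<sigma> g = 1" if "g \<noteq> no_edge" for g using that by (simp add: multiplicity_at_def)
    consider "no_edge = e" | "no_edge = e'" | "no_edge \<noteq> e" "no_edge \<noteq> e'" by blast
    then show ?thesis
    proof cases
      case 1
      have "e \<notin> y" "e \<in> \<sigma>" "e' \<noteq> e" using r(1,2) by (auto simp: y_def)
      then show ?thesis using 1 M e1[of e'] by (simp add: M_def)
    next
      case 2
      have "e' \<in> y" "e' \<notin> \<sigma>" "e' \<noteq> e" using r(1,2) by (auto simp: y_def)
      then show ?thesis using 2 M e1[of e] by (simp add: M_def)
    next
      case 3
      then have "no_edge \<in> y \<longleftrightarrow> no_edge \<in> \<sigma>" by (auto simp: y_def)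
      then show ?thesis using e1[of e] e1[of e'] 3 by simp
    qed
  qed
  have pw: "lam ^ total_length \<sigma> * lam ^ edge_length e' = lam ^ total_length y * lam ^ edge_length e"
    unfolding power_add[symmetric] len by simp
  define D where "D = lam ^ edge_length e' + lam ^ edge_length e"
  have D: "D \<noteq> 0" using lam by (simp add: D_def add_pos_pos less_imp_neq[THEN not_sym])
  have "weight lam m n \<sigma> * pmf (glauber_step lam m n \<sigma>) y =
      (real (multiplicity_at m n \<sigma> e) / (if no_edge \<in> \<sigma> then M else 1)) *
      (lam ^ total_length \<sigma> * lam ^ edge_length e') / (D * real (card (Lambda m n)))"
    unfolding P1 weight_def flip_rate_def M_def D_def by simp
  also have "\<dots> = (real (multiplicity_at m n \<sigma> e') / (if no_edge \<in> y then M else 1)) *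
      (lam ^ total_length y * lam ^ edge_length e) / (D * real (card (Lambda m n)))"
    unfolding ratio pw ..
  also have "\<dots> = weight lam m n y * pmf (glauber_step lam m n y) \<sigma>"
    unfolding P2 weight_def flip_rate_def M_def D_def mult by (simp add: add.commute)
  finally show ?thesis .
qed

lemma detailed_balance:
  assumes lam: "lam > 1" and m: "1 \<le> m" and x: "x \<in> Omega m n" and y: "y \<in> Omega m n"
  shows "weight lam m n x * pmf (glauber_step lam m n x) y = weight lam m n y * pmf (glauber_step lam m n y) x"
proof -
  have one: "weight lam m n x * pmf (glauber_step lam m n x) y = weight lam m n y * pmf (glauber_step lam m n y) x"
    if x: "x \<in> Omega m n" and ne: "x \<noteq> y" and p: "pmf (glauber_step lam m n x) y \<noteq> 0" for x y
  proof -
    have "y \<in> set_pmf (glauber_step lam m n x)" using p by (simp add: set_pmf_iff)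
    from step_support[OF lam m x this] ne obtain e e' where "flips_to x e e'" "y = insert e' (x - {e})" by metis
    then show ?thesis using flip_detailed_balance[OF lam m x] by simp
  qed
  show ?thesis
  proof (cases "x = y")
    case False
    then show ?thesis using one[OF x False] one[OF y False[symmetric]] by fastforce
  qed simp
qed

lemma glauber_law_Suc: "glauber_law lam m n (Suc t) \<sigma> = bind_pmf (glauber_law lam m n t \<sigma>) (glauber_step lam m n)"
  by (simp add: glauber_law_def)

lemma glauber_law_0: "glauber_law lam m n 0 \<sigma> = return_pmf \<sigma>"
  by (simp add: glauber_law_def)

lemma law_in_Omega:
  assumes "lam > 1" "1 \<le> m" "\<sigma> \<in> Omega m n"
  shows "set_pmf (glauber_law lam m n t \<sigma>) \<subseteq> Omega m n"
proof (induction t)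
  case 0
  then show ?case using assms by (simp add: glauber_law_0)
next
  case (Suc t)
  then show ?case using step_in_Omega[OF assms(1,2)] by (auto simp: glauber_law_Suc)
qed

lemma pmf_law_Suc:
  assumes "lam > 1" "1 \<le> m" "\<sigma> \<in> Omega m n"
  shows "pmf (glauber_law lam m n (Suc t) \<sigma>) y =
    (\<Sum>x\<in>Omega m n. pmf (glauber_step lam m n x) y * pmf (glauber_law lam m n t \<sigma>) x)"
  unfolding glauber_law_Suc pmf_bind
  by (rule integral_measure_pmf_real) (use law_in_Omega[OF assms] in auto)

text \<open>
  The weight divided by that of the initial state is stationary by detailed balance and dominates
  the initial point mass, so it dominates the law at all times.
\<close>
lemma law_le_weight:
  assumes lam: "lam > 1" and m: "1 \<le> m" and \<sigma>: "\<sigma> \<in> Omega m n" and "y \<in> Omega m n"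
  shows "pmf (glauber_law lam m n t \<sigma>) y \<le> weight lam m n y / weight lam m n \<sigma>"
  using assms(4)
proof (induction t arbitrary: y)
  case 0
  have "0 < weight lam m n y" "0 < weight lam m n \<sigma>" using weight_pos[OF lam] by auto
  then show ?case by (simp add: glauber_law_0 indicator_def)
next
  case (Suc t)
  have w0: "0 < weight lam m n \<sigma>" "0 < weight lam m n y" by (simp_all add: weight_pos[OF lam])
  have "pmf (glauber_law lam m n (Suc t) \<sigma>) y =
      (\<Sum>x\<in>Omega m n. pmf (glauber_step lam m n x) y * pmf (glauber_law lam m n t \<sigma>) x)"
    by (rule pmf_law_Suc[OF lam m \<sigma>])
  also have "\<dots> \<le> (\<Sum>x\<in>Omega m n. pmf (glauber_step lam m n x) y * (weight lam m n x / weight lam m n \<sigma>))"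
    by (intro sum_mono mult_left_mono Suc.IH) auto
  also have "\<dots> = (\<Sum>x\<in>Omega m n. weight lam m n x * pmf (glauber_step lam m n x) y) / weight lam m n \<sigma>"
    by (simp add: sum_divide_distrib mult.commute)
  also have "(\<Sum>x\<in>Omega m n. weight lam m n x * pmf (glauber_step lam m n x) y) =
      (\<Sum>x\<in>Omega m n. weight lam m n y * pmf (glauber_step lam m n y) x)"
    by (intro sum.cong detailed_balance[OF lam m] Suc.prems refl)
  also have "\<dots> = weight lam m n y * (\<Sum>x\<in>Omega m n. pmf (glauber_step lam m n y) x)"
    by (simp add: sum_distrib_left)
  also have "(\<Sum>x\<in>Omega m n. pmf (glauber_step lam m n y) x) = 1"
    by (rule sum_pmf_eq_1) (use step_in_Omega[OF lam m Suc.prems] in auto)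
  finally show ?case by simp
qed

lemma weight_ratio_le:
  assumes lam: "lam > 1"
  shows "weight lam m n y / weight lam m n \<sigma> \<le>
    real (card (Lambda m n) + 1) * (lam ^ total_length y / lam ^ total_length \<sigma>)"
proof -
  have p: "0 < lam ^ k" for k :: nat using lam by simp
  have y: "weight lam m n y \<le> lam ^ total_length y"
    using multiplicity_pos[of m n y no_edge] p[of "total_length y"] by (auto simp: weight_def divide_le_eq)
  have "real (multiplicity_at m n \<sigma> no_edge) \<le> real (card (Lambda m n) + 1)" unfolding multiplicity_at_def by simp
  then have "lam ^ total_length \<sigma> \<le> real (card (Lambda m n) + 1) * weight lam m n \<sigma>"
    using multiplicity_pos[of m n \<sigma> no_edge] p[of "total_length \<sigma>"]
      mult_left_mono[of "real (multiplicity_at m n \<sigma> no_edge)" "real (card (Lambda m n) + 1)" "lam ^ total_length \<sigma>"]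
    by (auto simp: weight_def field_simps)
  then have "lam ^ total_length \<sigma> / real (card (Lambda m n) + 1) \<le> weight lam m n \<sigma>"
    by (simp add: divide_le_eq mult.commute)
  then have "weight lam m n y / weight lam m n \<sigma> \<le> lam ^ total_length y / (lam ^ total_length \<sigma> / real (card (Lambda m n) + 1))"
    by (intro frac_le y) (use p less_imp_le[OF p] in auto)
  then show ?thesis by (simp add: mult.commute)
qed

section \<open>Escape from a set of states\<close>

text \<open>
  Mass leaves \<open>A\<close> only from the exit states, and at each time their mass is at most
  their number times \<open>\<epsilon>\<close>.
\<close>
lemma escape_bound:
  assumes lam: "lam > 1" and m: "1 \<le> m" and \<sigma>: "\<sigma> \<in> A" and A: "A \<subseteq> Omega m n"
    and B: "\<And>x. x \<in> A \<Longrightarrow> \<not> set_pmf (glauber_step lam m n x) \<subseteq> A \<Longrightarrow>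
      weight lam m n x / weight lam m n \<sigma> \<le> \<epsilon>" and \<epsilon>: "0 \<le> \<epsilon>"
  shows "1 - real t * (real (card A) * \<epsilon>) \<le> (\<Sum>y\<in>A. pmf (glauber_law lam m n t \<sigma>) y)"
proof (induction t)
  case 0
  have "finite A" using finite_subset[OF A] by simp
  then have "(\<Sum>y\<in>A. pmf (return_pmf \<sigma>) y) = 1" by (intro sum_pmf_eq_1) (use \<sigma> in auto)
  then show ?case by (simp add: glauber_law_0)
next
  case (Suc t)
  have finA: "finite A" using finite_subset[OF A] by simp
  let ?p = "\<lambda>x. pmf (glauber_law lam m n t \<sigma>) x"
  define exits where "exits = {x \<in> A. \<not> set_pmf (glauber_step lam m n x) \<subseteq> A}"
  have stay: "(\<Sum>y\<in>A. pmf (glauber_step lam m n x) y) = 1" if "x \<in> A - exits" for x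
    by (rule sum_pmf_eq_1[OF finA]) (use that in \<open>auto simp: exits_def\<close>)
  have "(\<Sum>x\<in>A. ?p x) - (\<Sum>x\<in>exits. ?p x) = (\<Sum>x\<in>A - exits. ?p x)"
    by (rule sum_diff[symmetric]) (use finA in \<open>auto simp: exits_def\<close>)
  also have "\<dots> = (\<Sum>x\<in>A - exits. (\<Sum>y\<in>A. pmf (glauber_step lam m n x) y) * ?p x)"
    by (intro sum.cong) (simp_all add: stay)
  also have "\<dots> \<le> (\<Sum>x\<in>Omega m n. (\<Sum>y\<in>A. pmf (glauber_step lam m n x) y) * ?p x)"
    by (rule sum_mono2) (use A in \<open>auto intro!: mult_nonneg_nonneg sum_nonneg\<close>)
  also have "\<dots> = (\<Sum>y\<in>A. pmf (glauber_law lam m n (Suc t) \<sigma>) y)"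
    unfolding pmf_law_Suc[OF lam m subsetD[OF A \<sigma>]] sum_distrib_right by (rule sum.swap)
  finally have step: "(\<Sum>x\<in>A. ?p x) - (\<Sum>x\<in>exits. ?p x) \<le> (\<Sum>y\<in>A. pmf (glauber_law lam m n (Suc t) \<sigma>) y)" .
  have "(\<Sum>x\<in>exits. ?p x) \<le> (\<Sum>x\<in>exits. \<epsilon>)"
  proof (rule sum_mono)
    fix x assume x: "x \<in> exits"
    then have "?p x \<le> weight lam m n x / weight lam m n \<sigma>"
      by (intro law_le_weight[OF lam m subsetD[OF A \<sigma>]]) (use A in \<open>auto simp: exits_def\<close>)
    also have "\<dots> \<le> \<epsilon>" using B x by (auto simp: exits_def)
    finally show "?p x \<le> \<epsilon>" .
  qed
  also have "\<dots> \<le> real (card A) * \<epsilon>"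
    using card_mono[OF finA, of exits] \<epsilon> by (auto simp: exits_def intro!: mult_right_mono)
  finally show ?case using step Suc.IH by (simp add: algebra_simps)
qed

lemma tv_dist_lower:
  assumes S: "finite S" "A \<subseteq> S" and p: "(\<Sum>s\<in>S. p s) \<le> 1" and q: "(\<Sum>s\<in>S. q s) = 1"
  shows "(\<Sum>s\<in>A. p s) - (\<Sum>s\<in>A. q s) \<le> tv_dist S p q"
proof -
  have split: "(\<Sum>s\<in>S. f s) = (\<Sum>s\<in>A. f s) + (\<Sum>s\<in>S - A. f s)" for f :: "'a \<Rightarrow> real"
    using sum.subset_diff[OF S(2,1), of f] by simp
  have "(\<Sum>s\<in>A. p s - q s) \<le> (\<Sum>s\<in>A. \<bar>p s - q s\<bar>)" "(\<Sum>s\<in>S - A. q s - p s) \<le> (\<Sum>s\<in>S - A. \<bar>p s - q s\<bar>)"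
    by (auto intro!: sum_mono)
  then have "(\<Sum>s\<in>A. p s) - (\<Sum>s\<in>A. q s) + ((\<Sum>s\<in>S - A. q s) - (\<Sum>s\<in>S - A. p s)) \<le> (\<Sum>s\<in>S. \<bar>p s - q s\<bar>)"
    unfolding split[of "\<lambda>s. \<bar>p s - q s\<bar>"] by (simp add: sum_subtractf)
  then show ?thesis using p q split[of p] split[of q] unfolding tv_dist_def by linarith
qed

section \<open>Two traps\<close>

definition trap :: "bool \<Rightarrow> nat \<Rightarrow> nat \<Rightarrow> real \<Rightarrow> edge set set" where
  "trap b m n \<theta> = {\<sigma> \<in> Omega m n. real m * (real n)\<^sup>2 - \<theta> \<le> real_of_int (total_gain b \<sigma>)}"

lemma gibbs_nonneg: "lam > 1 \<Longrightarrow> 0 \<le> gibbs lam m n \<sigma>"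
  unfolding gibbs_def by (intro divide_nonneg_nonneg sum_nonneg) auto

lemma sum_gibbs:
  assumes "lam > 1" "Omega m n \<noteq> {}"
  shows "(\<Sum>\<sigma>\<in>Omega m n. gibbs lam m n \<sigma>) = 1"
proof -
  have "0 < (\<Sum>\<tau>\<in>Omega m n. lam ^ total_length \<tau>)" by (rule sum_pos) (use assms in auto)
  then show ?thesis unfolding gibbs_def by (simp add: sum_divide_distrib[symmetric])
qed

text \<open>A triangulation in both traps would have gain both positive and negative.\<close>
lemma light_trap:
  assumes lam: "lam > 1" and ne: "Omega m n \<noteq> {}" and \<theta>: "\<theta> < real m * (real n)\<^sup>2"
  obtains b where "(\<Sum>\<sigma>\<in>trap b m n \<theta>. gibbs lam m n \<sigma>) \<le> 1 / 2"
proof -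
  have sub: "trap b m n \<theta> \<subseteq> Omega m n" for b by (auto simp: trap_def)
  have fin: "finite (trap b m n \<theta>)" for b by (rule finite_subset[OF sub]) simp
  have disj: "trap True m n \<theta> \<inter> trap False m n \<theta> = {}"
    using total_gain_swap[of True] \<theta> by (auto simp: trap_def)
  have "(\<Sum>\<sigma>\<in>trap True m n \<theta>. gibbs lam m n \<sigma>) + (\<Sum>\<sigma>\<in>trap False m n \<theta>. gibbs lam m n \<sigma>) =
      (\<Sum>\<sigma>\<in>trap True m n \<theta> \<union> trap False m n \<theta>. gibbs lam m n \<sigma>)"
    by (rule sum.union_disjoint[symmetric]) (use fin disj in auto)
  also have "\<dots> \<le> (\<Sum>\<sigma>\<in>Omega m n. gibbs lam m n \<sigma>)"
    by (rule sum_mono2) (use sub gibbs_nonneg[OF lam] in auto)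
  also have "\<dots> = 1" by (rule sum_gibbs[OF lam ne])
  finally show thesis
    using that[of True] that[of False] by linarith
qed

text \<open>
  A flip changes one edge, whose gain is at most \<open>n\<close> in absolute value before and
  after.
\<close>
lemma exit_gain:
  assumes lam: "lam > 1" and m: "1 \<le> m" and x: "x \<in> trap b m n \<theta>"
    and ex: "\<not> set_pmf (glauber_step lam m n x) \<subseteq> trap b m n \<theta>"
  shows "real_of_int (total_gain b x) < real m * (real n)\<^sup>2 - \<theta> + 2 * real n"
proof -
  have x\<Omega>: "x \<in> Omega m n" using x by (simp add: trap_def)
  obtain y where y: "y \<in> set_pmf (glauber_step lam m n x)" "y \<notin> trap b m n \<theta>" using ex by blast
  then have ne: "y \<noteq> x" using x by blast
  obtain e e' where f: "flips_to x e e'" "y = insert e' (x - {e})"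
    using step_support[OF lam m x\<Omega> y(1) ne] by blast
  note r = flip_reversible[OF x\<Omega> f(1)]
  have fin: "finite x" by (rule Omega_finite[OF x\<Omega>])
  have "y \<in> Omega m n" using r(3) f(2) by simp
  then have less: "real_of_int (total_gain b y) < real m * (real n)\<^sup>2 - \<theta>" using y(2) by (simp add: trap_def)
  have "total_gain b x = gain b e + (\<Sum>g\<in>x - {e}. gain b g)"
    unfolding total_gain_def by (rule sum.remove[OF fin r(1)])
  moreover have "total_gain b y = gain b e' + (\<Sum>g\<in>x - {e}. gain b g)"
    unfolding total_gain_def f(2) by (rule sum.insert) (use fin r in auto)
  moreover have "\<bar>gain b e\<bar> \<le> int n" "\<bar>gain b e'\<bar> \<le> int n"
    using abs_gain_le[of e m n b] abs_gain_le[of e' m n b] r(1) OmegaD(1)[OF x\<Omega>] OmegaD(1)[OF r(3)] by auto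
  ultimately have "total_gain b x \<le> total_gain b y + 2 * int n" by linarith
  then have "real_of_int (total_gain b x) \<le> real_of_int (total_gain b y + 2 * int n)" by (simp only: of_int_le_iff)
  then show ?thesis using less by simp
qed

text \<open>
  The traps have depth \<open>depth * n\<^sup>2 / m\<close>. The gain lost at the exit is linear in
  this constant, while the length of the bad edges is quadratic in it, with a factor
  \<open>6144\<close> in the proof of \<open>exit_energy\<close>; the constant is small enough for a
  quarter of the gain loss to cover the latter.
\<close>
definition depth :: real where "depth = 1 / 30000"

lemma trap_scale:
  fixes M N :: real
  assumes "1 \<le> M" "100 * M\<^sup>2 \<le> depth * N"
  shows "M \<le> N" "0 < N" "M\<^sup>2 \<le> N"
    "0 \<le> 8 * depth * N / M" "8 * (depth * N\<^sup>2 / M) \<le> 8 * depth * N / M * N" "6 * (8 * depth * N / M) < 2 * N"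
proof -
  have big: "3000000 * M\<^sup>2 \<le> N" using assms(2) by (simp add: depth_def)
  have "M \<le> M\<^sup>2" using assms(1) by (simp add: power2_eq_square)
  then show MN: "M \<le> N" "0 < N" "M\<^sup>2 \<le> N" using big assms(1) by linarith+
  show "0 \<le> 8 * depth * N / M" using MN assms(1) by (simp add: depth_def)
  show "8 * (depth * N\<^sup>2 / M) \<le> 8 * depth * N / M * N" by (simp add: power2_eq_square)
  have "6 * (8 * depth * N) < 2 * N * 1" using MN(2) by (simp add: depth_def)
  also have "\<dots> \<le> 2 * N * M" using MN(2) assms(1) by (intro mult_left_mono) auto
  finally show "6 * (8 * depth * N / M) < 2 * N" using assms(1) by (simp add: field_simps)
qed

text \<open>
  Wide edges are confined to bands of height \<open>O(n / m)\<close>, which contain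
  \<open>O(n)\<close> midpoints.
\<close>
lemma trap_few_wide:
  assumes m: "1 \<le> m" and mn: "100 * (real m)\<^sup>2 \<le> depth * real n"
    and x: "noncrossing x" "x \<subseteq> edges m n"
    and G: "real m * (real n)\<^sup>2 - depth * (real n)\<^sup>2 / real m \<le> real_of_int (total_gain b x)"
  shows "card {e \<in> x. wide e} \<le> 7 * n"
proof -
  define \<eta> where "\<eta> = 8 * depth * real n / real m"
  have m': "1 \<le> real m" using m by simp
  note sc = trap_scale[OF m' mn, folded \<eta>_def]
  have n: "0 < n" using sc(2) by simp
  have W: "noncrossing {e \<in> x. wide e}" "{e \<in> x. wide e} \<subseteq> edges m n" using x by (auto simp: noncrossing_def)
  have "real (card {e \<in> x. wide e}) \<le> 2 * (2 * real m + 1) * (2 * (2 * \<eta>) + 1)"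
    by (rule card_confined_edges[OF W])
      (use sc(4) bad_edge_confined[OF x _ _ G sc(4-6) n] in \<open>auto simp: bad_def\<close>)
  also have "\<dots> \<le> 2 * (3 * real m) * (2 * (2 * \<eta>) + 1)"
    by (intro mult_right_mono mult_left_mono) (use m' sc(4) in auto)
  also have "\<dots> = 24 * (real m * \<eta>) + 6 * real m" by (simp add: algebra_simps)
  also have "real m * \<eta> = 8 * depth * real n" using m' by (simp add: \<eta>_def)
  also have "24 * (8 * depth * real n) + 6 * real m \<le> 7 * real n" using sc(1,2) by (simp add: depth_def)
  finally have "real (card {e \<in> x. wide e}) \<le> real (7 * n)" by simp
  then show ?thesis by (simp only: of_nat_le_iff)
qed

text \<open>
  Half of the gain lost at the exit of the trap is left after paying for all that distinguishes
  length from gain: a quarter pays for the quadratic contribution of the bad edges, and the terms of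
  order \<open>m n\<close> and \<open>n\<close> are absorbed because \<open>m\<^sup>2\<close> is
  small compared to \<open>n\<close>.
\<close>
lemma exit_energy:
  assumes m: "1 \<le> m" and mn: "100 * (real m)\<^sup>2 \<le> depth * real n"
    and x: "noncrossing x" "x \<subseteq> edges m n"
    and G: "real m * (real n)\<^sup>2 - depth * (real n)\<^sup>2 / real m \<le> real_of_int (total_gain b x)"
      "real_of_int (total_gain b x) < real m * (real n)\<^sup>2 - depth * (real n)\<^sup>2 / real m + 2 * real n"
  shows "real (total_length x) \<le> real m * (real n)\<^sup>2 - depth * ((real n)\<^sup>2 / real m) / 2"
proof -
  define M N \<eta> Q where "M = real m" and "N = real n" and "\<eta> = 8 * depth * N / M" and "Q = N\<^sup>2 / M"
  have m': "1 \<le> M" using m by (simp add: M_def)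
  note sc = trap_scale[OF m' mn[folded M_def N_def], folded \<eta>_def]
  have n: "0 < n" using sc(2) by (simp add: N_def)
  have M\<eta>: "M * \<eta> = 8 * depth * N" using m' by (simp add: \<eta>_def)
  have \<eta>Q: "\<eta> * (8 * depth * N) = 64 * depth\<^sup>2 * Q"
    by (simp add: \<eta>_def Q_def power2_eq_square)
  have NMN: "N \<le> M * N" using m' sc(2) by simp
  have MMN: "M * M \<le> M * N" using m' sc(1) by (intro mult_left_mono) auto
  have Q0: "0 \<le> Q" using m' by (simp add: Q_def)
  have MN1: "1 \<le> N" using m' sc(1) by linarith
  have junk: "4 * (2 * M + 1) * (4 * \<eta> + 1) * (M + 2 * \<eta>) \<le> 14 * (M * N) + depth / 4 * Q"
  proof -
    have "4 * (2 * M + 1) * ((4 * \<eta> + 1) * (M + 2 * \<eta>)) \<le> 4 * (3 * M) * ((4 * \<eta> + 1) * (M + 2 * \<eta>))"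
      by (intro mult_right_mono mult_left_mono mult_nonneg_nonneg) (use m' sc(4) in auto)
    also have "\<dots> = 48 * (M * (M * \<eta>)) + 96 * (\<eta> * (M * \<eta>)) + 12 * (M * M) + 24 * (M * \<eta>)"
      by (simp add: algebra_simps)
    also have "\<dots> = 384 * depth * (M * N) + 6144 * depth\<^sup>2 * Q + 12 * (M * M) + 192 * depth * N"
      unfolding M\<eta> \<eta>Q by (simp add: algebra_simps)
    also have "384 * depth * (M * N) \<le> 1 * (M * N)"
      by (rule mult_right_mono) (use NMN sc(2) in \<open>auto simp: depth_def\<close>)
    also have "6144 * depth\<^sup>2 * Q \<le> depth / 4 * Q"
      by (rule mult_right_mono) (use Q0 in \<open>auto simp: depth_def power2_eq_square\<close>)
    also have "192 * depth * N \<le> 1 * N"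
      by (rule mult_right_mono) (use sc(2) in \<open>auto simp: depth_def\<close>)
    finally show ?thesis using NMN MMN by (simp add: mult.assoc)
  qed
  have edges_count: "(2 * M + 1) * (2 * N + 1) \<le> 9 * (M * N)"
  proof -
    have "(2 * M + 1) * (2 * N + 1) \<le> (3 * M) * (3 * N)" by (intro mult_mono) (use m' MN1 in auto)
    then show ?thesis by simp
  qed
  have "real (total_length x) \<le> real_of_int (total_gain b x) + (2 * M + 1) * (2 * N + 1)
     + 4 * (2 * M + 1) * (4 * \<eta> + 1) * (M + 2 * \<eta>)"
    using total_length_le[OF x G(1), folded M_def N_def, OF sc(4-6) n] .
  moreover have "real_of_int (total_gain b x) < M * N\<^sup>2 - depth * Q + 2 * N"
    using G(2) by (simp add: M_def N_def Q_def)
  moreover have "100 * (M * N) \<le> depth * Q"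
  proof -
    have "100 * M\<^sup>2 * (N / M) \<le> depth * N * (N / M)"
      using mn[folded M_def N_def] by (rule mult_right_mono) (use m' sc(2) in auto)
    then show ?thesis using m' by (simp add: Q_def power2_eq_square)
  qed
  ultimately have "real (total_length x) \<le> M * N\<^sup>2 - depth * Q / 2"
    using junk edges_count NMN by linarith
  then show ?thesis by (simp add: M_def N_def Q_def)
qed

text \<open>
  The contribution \<open>n * sqrt n\<close> is a crude bound for \<open>n\<close> times the
  logarithm of a polynomial in \<open>m\<close> and \<open>n\<close>.
\<close>
lemma trap_card:
  assumes m: "1 \<le> m" and mn: "100 * (real m)\<^sup>2 \<le> depth * real n"
  shows "real (card (trap b m n (depth * (real n)\<^sup>2 / real m))) \<le> exp (9 * (real m * real n) + 56 * (real n * sqrt (real n)))"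
proof -
  have m': "1 \<le> real m" using m by simp
  note sc = trap_scale[OF m' mn]
  have mn': "m \<le> n" "1 \<le> n" using sc(1) m by simp_all
  let ?A = "trap b m n (depth * (real n)\<^sup>2 / real m)"
  have "card ?A \<le> 2 ^ (m * (2 * n + 1)) * 2 ^ (m * (3 * n + 1)) * 2 ^ ((m + 1) * n) *
    (((m + 1) * (n + 1))\<^sup>2 + 1) ^ (7 * n)"
    by (rule card_triangulations_few_wide)
      (use trap_few_wide[OF m mn] in \<open>auto simp: trap_def Omega_def\<close>)
  also have "2 ^ (m * (2 * n + 1)) * 2 ^ (m * (3 * n + 1)) * 2 ^ ((m + 1) * n) = (2::nat) ^ (6 * (m * n) + 2 * m + n)"
    unfolding power_add[symmetric] by (rule arg_cong[of _ _ "\<lambda>k. 2 ^ k"]) (simp add: algebra_simps)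
  finally have "real (card ?A) \<le> real (2 ^ (6 * (m * n) + 2 * m + n) * (((m + 1) * (n + 1))\<^sup>2 + 1) ^ (7 * n))"
    by (simp only: of_nat_le_iff)
  then have card: "real (card ?A) \<le> 2 ^ (6 * (m * n) + 2 * m + n) * (((real m + 1) * (real n + 1))\<^sup>2 + 1) ^ (7 * n)"
    by (simp only: of_nat_mult of_nat_power of_nat_add of_nat_1 of_nat_numeral)
  have first: "(2::real) ^ (6 * (m * n) + 2 * m + n) \<le> exp (9 * (real m * real n))"
  proof -
    have "(2::real) ^ (6 * (m * n) + 2 * m + n) \<le> exp 1 ^ (6 * (m * n) + 2 * m + n)"
      by (rule power_mono) (use exp_ge_add_one_self[of 1] in auto)
    also have "\<dots> = exp (real (6 * (m * n) + 2 * m + n))" by (simp flip: exp_of_nat_mult)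
    also have "\<dots> \<le> exp (9 * (real m * real n))"
    proof -
      have "m \<le> m * n" "n \<le> m * n" using m mn' by simp_all
      then have "6 * (m * n) + 2 * m + n \<le> 9 * (m * n)" by linarith
      then have "real (6 * (m * n) + 2 * m + n) \<le> real (9 * (m * n))" by (simp only: of_nat_le_iff)
      then show ?thesis by simp
    qed
    finally show ?thesis .
  qed
  have second: "((real m + 1) * (real n + 1))\<^sup>2 + 1 \<le> exp (8 * sqrt (real n))"
  proof -
    have n1: "1 \<le> real n" using mn' by simp
    \<comment> \<open>The polynomial is of degree \<open>8\<close> in \<open>y\<close>, whence the constant in
        the exponent.\<close>
    define y where "y = sqrt (real n)"
    have y: "1 \<le> y" "y\<^sup>2 = real n" using n1 by (auto simp: y_def)
    have "(real m + 1) * (real n + 1) \<le> (2 * real n) * (2 * real n)" by (intro mult_mono) (use sc(1) n1 in auto)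
    then have "((real m + 1) * (real n + 1))\<^sup>2 \<le> ((2 * real n) * (2 * real n))\<^sup>2" by (intro power_mono) auto
    also have "\<dots> = 16 * y ^ 8" unfolding y(2)[symmetric] by (simp add: power_mult_distrib flip: power_mult power_add)
    finally have "((real m + 1) * (real n + 1))\<^sup>2 + 1 \<le> 16 * y ^ 8 + 1" by simp
    also have "\<dots> \<le> 17 * y ^ 8" using one_le_power[OF y(1), of 8] by simp
    also have "\<dots> \<le> exp 8 * exp (y - 1) ^ 8"
    proof (intro mult_mono power_mono)
      have "(2::real) ^ 8 \<le> exp 1 ^ 8" by (rule power_mono) (use exp_ge_add_one_self[of 1] in auto)
      then show "17 \<le> exp (8::real)" by (simp flip: exp_of_nat_mult)
      show "y \<le> exp (y - 1)" using exp_ge_add_one_self[of "y - 1"] by simp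
    qed (use y in auto)
    also have "\<dots> = exp (8 * y)" by (simp add: exp_of_nat_mult[symmetric] exp_add[symmetric])
    finally show ?thesis by (simp add: y_def)
  qed
  have "(((real m + 1) * (real n + 1))\<^sup>2 + 1) ^ (7 * n) \<le> exp (8 * sqrt (real n)) ^ (7 * n)"
    by (rule power_mono[OF second]) simp
  also have "\<dots> = exp (56 * (real n * sqrt (real n)))" by (simp flip: exp_of_nat_mult)
  finally have "2 ^ (6 * (m * n) + 2 * m + n) * (((real m + 1) * (real n + 1))\<^sup>2 + 1) ^ (7 * n) \<le>
      exp (9 * (real m * real n)) * exp (56 * (real n * sqrt (real n)))"
    by (intro mult_mono first) auto
  then show ?thesis using card by (simp add: exp_add)
qed

section \<open>The mixing time\<close>

lemma mixing_time_ge: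
  assumes ne: "Omega m n \<noteq> {}" and \<sigma>: "\<sigma> \<in> Omega m n"
    and t: "\<And>t. tv_dist (Omega m n) (pmf (glauber_law lam m n t \<sigma>)) (gibbs lam m n) \<le> 1 / 4 \<Longrightarrow> r \<le> real t"
  shows "ereal r \<le> ereal_of_enat (mixing_time lam m n)"
proof -
  define X where "X = {t. Max ((\<lambda>\<sigma>. tv_dist (Omega m n) (pmf (glauber_law lam m n t \<sigma>)) (gibbs lam m n)) ` Omega m n) \<le> 1 / 4}"
  have mix: "mixing_time lam m n = Inf (enat ` X)" by (simp add: mixing_time_def X_def)
  have X: "r \<le> real t" if "t \<in> X" for t
  proof (rule t)
    have "tv_dist (Omega m n) (pmf (glauber_law lam m n t \<sigma>)) (gibbs lam m n) \<le>
      Max ((\<lambda>\<sigma>. tv_dist (Omega m n) (pmf (glauber_law lam m n t \<sigma>)) (gibbs lam m n)) ` Omega m n)"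
      by (rule Max_ge) (use \<sigma> in auto)
    then show "tv_dist (Omega m n) (pmf (glauber_law lam m n t \<sigma>)) (gibbs lam m n) \<le> 1 / 4"
      using that by (simp add: X_def)
  qed
  show ?thesis
  proof (cases "X = {}")
    case True
    then show ?thesis by (simp add: mix top_enat_def)
  next
    case False
    then have "enat ` X \<noteq> {}" by simp
    then have "Inf (enat ` X) \<in> enat ` X" by (simp add: Inf_enat_def) (metis LeastI image_eqI ex_in_conv imageE)
    then obtain s where "s \<in> X" "Inf (enat ` X) = enat s" by blast
    then show ?thesis using X by (simp add: mix)
  qed
qed

text \<open>
  In the exponent, the barrier \<open>\<theta> / 2 * ln lam\<close> competes with the size of the
  trap, with the correction factor between \<open>weight\<close> and the Gibbs weight (at most
  \<open>exp (10 m n)\<close>), and with the factor \<open>1 / 4\<close> that remains of the mass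
  \<open>1\<close> after subtracting the equilibrium mass and the distance allowed by the mixing
  time.
\<close>
lemma trap_escape_time:
  assumes lam: "lam > 1" and m: "1 \<le> m" and mn: "100 * (real m)\<^sup>2 \<le> depth * real n"
  shows "ereal (exp (depth * ((real n)\<^sup>2 / real m) / 2 * ln lam - 19 * (real m * real n) - 56 * (real n * sqrt (real n)) - 2))
    \<le> ereal_of_enat (mixing_time lam m n)"
proof -
  define \<theta> where "\<theta> = depth * (real n)\<^sup>2 / real m"
  have m': "1 \<le> real m" using m by simp
  note sc = trap_scale[OF m' mn]
  have n1: "1 \<le> real n" using sc(1) m' by linarith
  have \<theta>_less: "\<theta> < real m * (real n)\<^sup>2"
  proof -
    have "\<theta> \<le> depth * (real n)\<^sup>2"
      unfolding \<theta>_def using m' by (simp add: divide_le_eq depth_def mult_le_cancel_left1)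
    also have "\<dots> < 1 * (real n)\<^sup>2" using n1 by (intro mult_strict_right_mono) (auto simp: depth_def)
    also have "\<dots> \<le> real m * (real n)\<^sup>2" by (intro mult_right_mono) (use m' in auto)
    finally show ?thesis .
  qed
  have \<theta>0: "0 \<le> \<theta>" by (simp add: \<theta>_def depth_def)
  have ne: "Omega m n \<noteq> {}" using ground_state[of m n True] by blast
  obtain b where light: "(\<Sum>\<sigma>\<in>trap b m n \<theta>. gibbs lam m n \<sigma>) \<le> 1 / 2"
    using light_trap[OF lam ne \<theta>_less] by blast
  obtain \<sigma> where \<sigma>: "\<sigma> \<in> Omega m n" "total_gain b \<sigma> = int m * (int n)\<^sup>2" by (rule ground_state)
  let ?A = "trap b m n \<theta>"
  have A: "?A \<subseteq> Omega m n" by (auto simp: trap_def)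
  have \<sigma>A: "\<sigma> \<in> ?A" using \<sigma> \<theta>0 by (simp add: trap_def)
  have E\<sigma>: "real m * (real n)\<^sup>2 \<le> real (total_length \<sigma>)"
  proof -
    have "int m * (int n)\<^sup>2 \<le> int (total_length \<sigma>)"
      using total_gain_le_length[OF OmegaD(1)[OF \<sigma>(1)], of b] \<sigma>(2) by simp
    then have "real_of_int (int m * (int n)\<^sup>2) \<le> real_of_int (int (total_length \<sigma>))" by (simp only: of_int_le_iff)
    then show ?thesis by simp
  qed
  define \<epsilon> where "\<epsilon> = real (card (Lambda m n) + 1) * exp (- (\<theta> / 2 * ln lam))"
  have \<epsilon>0: "0 \<le> \<epsilon>" by (simp add: \<epsilon>_def)
  have exits: "weight lam m n x / weight lam m n \<sigma> \<le> \<epsilon>"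
    if x: "x \<in> ?A" "\<not> set_pmf (glauber_step lam m n x) \<subseteq> ?A" for x
  proof -
    have x\<Omega>: "x \<in> Omega m n" using x A by blast
    have E: "real (total_length x) \<le> real m * (real n)\<^sup>2 - depth * ((real n)\<^sup>2 / real m) / 2"
      by (rule exit_energy[OF m mn OmegaD(2,1)[OF x\<Omega>], of b])
        (use x(1) exit_gain[OF lam m x] in \<open>auto simp: trap_def \<theta>_def\<close>)
    have "lam ^ total_length x / lam ^ total_length \<sigma> = exp ((real (total_length x) - real (total_length \<sigma>)) * ln lam)"
      using lam by (simp add: left_diff_distrib exp_diff exp_of_nat_mult)
    also have "\<dots> \<le> exp (- (\<theta> / 2 * ln lam))"
    proof -
      have "(real (total_length x) - real (total_length \<sigma>)) * ln lam \<le> (- (\<theta> / 2)) * ln lam"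
        by (rule mult_right_mono) (use E E\<sigma> lam in \<open>auto simp: \<theta>_def\<close>)
      then show ?thesis by simp
    qed
    finally have "real (card (Lambda m n) + 1) * (lam ^ total_length x / lam ^ total_length \<sigma>) \<le> \<epsilon>"
      unfolding \<epsilon>_def by (intro mult_left_mono) auto
    then show ?thesis using weight_ratio_le[OF lam, of m n x \<sigma>] by linarith
  qed
  have lam_count: "real (card (Lambda m n) + 1) \<le> exp (10 * (real m * real n))"
  proof -
    have "card (Lambda m n) + 1 \<le> (2 * m + 1) * (2 * n + 1) + 1" using card_Lambda_le[of m n] by simp
    then have "real (card (Lambda m n) + 1) \<le> real ((2 * m + 1) * (2 * n + 1) + 1)" by (simp only: of_nat_le_iff)
    also have "\<dots> = (2 * real m + 1) * (2 * real n + 1) + 1" by (simp add: algebra_simps)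
    also have "\<dots> \<le> (3 * real m) * (3 * real n) + real m * real n"
      by (intro add_mono mult_mono) (use m' n1 mult_mono[OF m' n1] in auto)
    also have "\<dots> = 10 * (real m * real n)" by simp
    also have "\<dots> \<le> exp (10 * (real m * real n))" using exp_ge_add_one_self[of "10 * (real m * real n)"] by linarith
    finally show ?thesis .
  qed
  define K where "K = \<theta> / 2 * ln lam - 19 * (real m * real n) - 56 * (real n * sqrt (real n))"
  have rate: "real (card ?A) * \<epsilon> \<le> exp (- K)"
  proof -
    have "real (card ?A) * \<epsilon> \<le> exp (9 * (real m * real n) + 56 * (real n * sqrt (real n))) *
        (exp (10 * (real m * real n)) * exp (- (\<theta> / 2 * ln lam)))"
      unfolding \<epsilon>_def using trap_card[OF m mn, of b, folded \<theta>_def] lam_count by (intro mult_mono) auto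
    also have "\<dots> = exp (- K)" unfolding exp_add[symmetric] K_def by (simp add: algebra_simps)
    finally show ?thesis .
  qed
  have "exp (K - 2) \<le> real t"
    if tv: "tv_dist (Omega m n) (pmf (glauber_law lam m n t \<sigma>)) (gibbs lam m n) \<le> 1 / 4" for t
  proof -
    have "(\<Sum>s\<in>?A. pmf (glauber_law lam m n t \<sigma>) s) - (\<Sum>s\<in>?A. gibbs lam m n s) \<le> 1 / 4"
    proof (rule order_trans[OF tv_dist_lower tv])
      show "(\<Sum>s\<in>Omega m n. pmf (glauber_law lam m n t \<sigma>) s) \<le> 1"
        using sum_pmf_eq_1[OF finite_Omega law_in_Omega[OF lam m \<sigma>(1)]] by simp
    qed (use A sum_gibbs[OF lam ne] in auto)
    then have "1 / 4 \<le> real t * (real (card ?A) * \<epsilon>)"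
      using escape_bound[OF lam m \<sigma>A A exits \<epsilon>0, of t] light by linarith
    also have "\<dots> \<le> real t * exp (- K)" by (intro mult_left_mono rate) simp
    finally have "1 / 4 * exp K \<le> real t * exp (- K) * exp K" by (rule mult_right_mono) simp
    then have "1 / 4 * exp K \<le> real t" by (simp add: mult.assoc exp_add[symmetric])
    moreover have "exp (K - 2) \<le> 1 / 4 * exp K"
    proof -
      have "(2::real) ^ 2 \<le> exp 1 ^ 2" by (rule power_mono) (use exp_ge_add_one_self[of 1] in auto)
      then have "4 \<le> exp (2::real)" by (simp flip: exp_of_nat_mult)
      then have "exp K / exp 2 \<le> exp K / 4" by (intro divide_left_mono) auto
      then show ?thesis by (simp add: exp_diff)
    qed
    ultimately show ?thesis by linarith
  qed
  then have "ereal (exp (K - 2)) \<le> ereal_of_enat (mixing_time lam m n)" by (rule mixing_time_ge[OF ne \<sigma>(1)])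
  then show ?thesis by (simp add: K_def \<theta>_def algebra_simps)
qed

theorem theorem6p2:
  fixes lam :: real
  assumes "lam > 1"
  shows "\<exists>c::real. c > 0 \<and>
    (\<forall>m n :: nat. m \<ge> 1 \<and> real n \<ge> (real m)\<^sup>2 / c \<longrightarrow>
       ereal_of_enat (mixing_time lam m n) \<ge> ereal (exp (c * (real n)\<^sup>2 / real m)))"
proof -
  \<comment> \<open>The barrier \<open>depth * Q * ln lam / 2\<close> has to pay for
      \<open>c * Q + 19 * M * N + 56 * N * sqrt N + 2\<close>, where
      \<open>Q = N\<^sup>2 / M\<close>. With \<open>s = sqrt c\<close> this is at most
      \<open>(1 + 19 + 56 + 2) * s * Q = 78 * s * Q\<close>, so
      \<open>s \<le> depth * ln lam / 156\<close> suffices.\<close>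
  define a where "a = depth * ln lam / 156"
  define c where "c = min (depth / 100) (a\<^sup>2)"
  have a: "0 < a" using assms by (simp add: a_def depth_def)
  have c: "0 < c" "c \<le> depth / 100" "c \<le> a\<^sup>2" using a by (auto simp: c_def depth_def)
  have c1: "c \<le> 1" using c(2) by (simp add: depth_def)
  define s where "s = sqrt c"
  have s: "0 < s" "s * s = c" "s \<le> 1" using c c1 by (auto simp: s_def)
  have sa: "s \<le> a" using c(3) a by (simp add: s_def real_le_lsqrt)
  have cs: "c \<le> s" using s mult_left_mono[of s 1 s] by simp
  show ?thesis
  proof (intro exI[of _ c] conjI allI impI)
    show "c > 0" by (fact c(1))
    fix m n :: nat assume mn: "m \<ge> 1 \<and> real n \<ge> (real m)\<^sup>2 / c"
    define M N Q where "M = real m" and "N = real n" and "Q = N\<^sup>2 / M"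
    have M: "1 \<le> M" using mn by (simp add: M_def)
    have cN: "M\<^sup>2 \<le> c * N" using mn c(1) by (simp add: M_def N_def divide_le_eq mult.commute)
    have N0: "0 < N"
    proof -
      have "0 < c * N" using cN M by (smt (verit) one_le_power)
      then show ?thesis using c(1) by (simp add: zero_less_mult_iff)
    qed
    have big: "100 * M\<^sup>2 \<le> depth * N"
    proof -
      have "c * N \<le> depth / 100 * N" using c(2) N0 by (intro mult_right_mono) auto
      then show ?thesis using cN by simp
    qed
    have Q0: "0 < Q" using N0 M by (simp add: Q_def)
    have MN: "M * N \<le> c * Q"
    proof -
      have "M * N * M \<le> c * N * N" using mult_right_mono[OF cN, of N] N0 by (simp add: power2_eq_square mult_ac)
      then show ?thesis using M by (simp add: Q_def power2_eq_square field_simps)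
    qed
    have Nroot: "N * sqrt N \<le> s * Q"
    proof -
      have "M \<le> s * sqrt N"
      proof -
        have "sqrt (M\<^sup>2) \<le> sqrt (c * N)" by (rule real_sqrt_le_mono[OF cN])
        then show ?thesis using M by (simp add: s_def real_sqrt_mult)
      qed
      then have "N * sqrt N * M \<le> N * sqrt N * (s * sqrt N)" using N0 by (intro mult_left_mono) auto
      also have "\<dots> = s * N\<^sup>2" using N0 by (simp add: power2_eq_square)
      finally show ?thesis using M by (simp add: Q_def field_simps)
    qed
    have two: "2 \<le> 2 * (c * Q)"
    proof -
      have "1 \<le> M\<^sup>2" using M by simp
      moreover have "c * N \<le> 1 * N" using c1 N0 by (intro mult_right_mono) auto
      ultimately have "1 \<le> N" using cN by linarith
      then have "1 * 1 \<le> M * N" using M by (intro mult_mono) auto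
      then show ?thesis using MN by linarith
    qed
    have "c * Q \<le> s * Q" "19 * (c * Q) \<le> 19 * (s * Q)" using cs Q0 by auto
    moreover have "78 * (s * Q) \<le> depth * Q / 2 * ln lam"
    proof -
      have "156 * (s * Q) \<le> 156 * (a * Q)" using sa Q0 by auto
      also have "\<dots> = depth * Q * ln lam" by (simp add: a_def)
      finally show ?thesis by simp
    qed
    ultimately have "c * Q \<le> depth * Q / 2 * ln lam - 19 * (M * N) - 56 * (N * sqrt N) - 2"
      using MN Nroot two by linarith
    then have "ereal (exp (c * Q)) \<le> ereal (exp (depth * Q / 2 * ln lam - 19 * (M * N) - 56 * (N * sqrt N) - 2))"
      by simp
    also have "\<dots> \<le> ereal_of_enat (mixing_time lam m n)"
      using trap_escape_time[OF assms, of m n] mn big by (simp add: M_def N_def Q_def)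
    finally show "ereal_of_enat (mixing_time lam m n) \<ge> ereal (exp (c * (real n)\<^sup>2 / real m))"
      by (simp add: M_def N_def Q_def)
  qed
qed

end
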